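(* Let $d,k \in \mathbb{N}$ with $1<k<d$ (so $d \geq 2$). Let $\Omega$ be a bounded Lipschitz domain in $\mathbb{R}^{d}$, and let $K \subset \Omega$ be a smooth compact set of class $C^{0,1}$ of codimension $k$ (in the sense defined in the context). Let $p>1$ and $s \in (0,1)$ satisfy $sp=d$. Let $u \in W^{s,p}_{0}(\Omega \setminus K)$ and let $\widetilde{u} \in \widetilde{W}^{s,p}_{0}(\Omega \setminus K)$ be its zero extension. Then there exists a constant $C = C(d,s,k,\Omega,K)>0$ (depending only on $d,s,k,\Omega,K$) such that $$\int_{\Omega}\int_{\Omega} \frac{|u(x)-u(y)|^{p}}{|x-y|^{2d}}\,dx\,dy \leq \int_{\mathbb{R}^{d}}\int_{\mathbb{R}^{d}} \frac{|\widetilde{u}(x)-\widetilde{u}(y)|^{p}}{|x-y|^{2d}}\,dx\,dy \leq C \int_{\Omega}\int_{\Omega} \frac{|u(x)-u(y)|^{p}}{|x-y|^{2d}}\,dx\,dy.$$ In particular, $\widetilde{W}^{s,p}_{0}(\Omega \setminus K) = W^{s,p}_{0}(\Omega \setminus K)$ as Banach spaces (identifying $u$ with $\widetilde{u}$, with equivalent norms $\|u\|_{W^{s,p}(\Omega)}$ and $\|\widetilde{u}\|_{W^{s,p}(\mathbb{R}^{d})}$).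
   Context: Distance: for $K \subset \Omega$ compact and $x \in \Omega$, $\delta_{K}(x) := \inf_{y \in K}|x-y|$. Smooth compact set of class $C^{0,1}$ of codimension $k$: let $k \in \mathbb{N}$, $1<k<d$, and let $Q = B^{k}_{1}(0) \times (0,1)^{d-k}$, where $B^{k}_{1}(0) \subset \mathbb{R}^{k}$ is the unit ball centred at $0$; write $\xi = (\xi_{k},\xi_{d-k}) \in Q$ with $\xi_{k} \in B^{k}_{1}(0)$, $\xi_{d-k} \in (0,1)^{d-k}$. A compact surface $K \subset \Omega$ of codimension $k$ in $\mathbb{R}^{d}$ is of class $C^{0,1}$ if there exists $C>0$ such that for every $x \in K$ there exist a ball $B = B_{r}(x) \subset \mathbb{R}^{d}$, $r>0$, and an isomorphism (bijection) $T: Q \to B$ such that $T \in C^{0,1}(\overline{Q})$, $T^{-1} \in C^{0,1}(\overline{B})$, $\|T\|_{C^{0,1}(\overline{Q})} + \|T^{-1}\|_{C^{0,1}(\overline{B})} \leq C$, and $T^{-1}(B \cap K) = \{(\xi_{k},\xi_{d-k}) \in Q : \xi_{k}=0\}$; moreover, for any $y \in (\Omega \setminus K) \cap B$ with $y = T((\xi_{k},\xi_{d-k}))$ one has $\delta_{K}(y) \sim |\xi_{k}|$, i.e. $C_{1}|\xi_{k}| \leq \delta_{K}(y) \leq C_{2}|\xi_{k}|$ for some $C_{1},C_{2}>0$ very close to $1$. Function spaces: for an open set $U \subset \mathbb{R}^{d}$, $[u]_{W^{s,p}(U)} = \left( \int_{U}\int_{U} \frac{|u(x)-u(y)|^{p}}{|x-y|^{d+sp}}\,dx\,dy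 \right)^{1/p}$ and $\|u\|_{W^{s,p}(U)} = \left([u]^{p}_{W^{s,p}(U)} + \|u\|^{p}_{L^{p}(U)}\right)^{1/p}$. $W^{s,p}_{0}(\Omega \setminus K)$ is the closure of $C^{\infty}_{c}(\Omega \setminus K)$ with respect to $\|\cdot\|_{W^{s,p}(\Omega)}$. For $u \in W^{s,p}_{0}(\Omega \setminus K)$, its zero extension $\widetilde{u}: \mathbb{R}^{d} \to \mathbb{R}$ is $\widetilde{u}(x) = u(x)$ for $x \in \Omega \setminus K$ and $\widetilde{u}(x)=0$ for $x \in (\mathbb{R}^{d} \setminus \Omega) \cup K$. Define $\widetilde{W}^{s,p}_{0}(\Omega \setminus K) := \{\widetilde{u} : u \in W^{s,p}_{0}(\Omega \setminus K)\}$. *)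

theory Defs
  imports "HOL-Analysis.Analysis"
begin

section \<open>Lipschitz domains\<close>

text \<open>The graph coordinates of a boundary point are given by a unit vector \<open>e\<close> (the vertical
  direction); the graph function lives on the hyperplane orthogonal to \<open>e\<close>.\<close>

definition bounded_lipschitz_domain :: "(real ^ 'd) set \<Rightarrow> bool" where
  "bounded_lipschitz_domain \<Omega> \<longleftrightarrow>
     open \<Omega> \<and> connected \<Omega> \<and> \<Omega> \<noteq> {} \<and> bounded \<Omega> \<and>
     (\<forall>x\<in>frontier \<Omega>. \<exists>r>0. \<exists>e \<gamma> L. norm e = 1 \<and> L-lipschitz_on {z. z \<bullet> e = 0} \<gamma> \<and>
        \<Omega> \<inter> ball x r = {y \<in> ball x r. y \<bullet> e > (\<gamma> (y - (y \<bullet> e) *\<^sub>R e) :: real)})"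

section \<open>Compact surfaces of class \<open>C\<^sup>0\<^sup>,\<^sup>1\<close>\<close>

definition C01_on :: "'a::metric_space set \<Rightarrow> ('a \<Rightarrow> 'b::real_normed_vector) \<Rightarrow> bool" where
  "C01_on S f \<longleftrightarrow> bounded (f ` S) \<and> (\<exists>L. L-lipschitz_on S f)"

definition C01_norm :: "'a::metric_space set \<Rightarrow> ('a \<Rightarrow> 'b::real_normed_vector) \<Rightarrow> real" where
  "C01_norm S f = (SUP x\<in>S. norm (f x)) +
     (SUP (x, y)\<in>{(x, y). x \<in> S \<and> y \<in> S \<and> x \<noteq> y}. dist (f x) (f y) / dist x y)"

text \<open>The splitting of the coordinates into \<open>k\<close> and \<open>d - k\<close> of them is given by a set \<open>I\<close> of
  \<open>k\<close> indices: \<open>\<xi>\<^sub>k\<close> is \<open>coords I \<xi>\<close>, padded with zeros (which does not change the norm).\<close>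

definition coords :: "'d set \<Rightarrow> real ^ 'd \<Rightarrow> real ^ 'd" where
  "coords I \<xi> = (\<chi> i. if i \<in> I then \<xi> $ i else 0)"

definition cylinder :: "'d set \<Rightarrow> (real ^ 'd) set" where
  "cylinder I = {\<xi>. norm (coords I \<xi>) < 1 \<and> (\<forall>i. i \<notin> I \<longrightarrow> 0 < \<xi> $ i \<and> \<xi> $ i < 1)}"

text \<open>\<open>T\<close> and its inverse \<open>S\<close> are total functions, of which only the values on the closures of the
  cylinder and of the ball matter. The comparison constants \<open>C\<^sub>1\<close>, \<open>C\<^sub>2\<close> are arbitrary positive
  numbers: the informal requirement that they be very close to 1 is not imposed.\<close>

definition C01_surface :: "(real ^ 'd) set \<Rightarrow> nat \<Rightarrow> (real ^ 'd) set \<Rightarrow> bool" where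
  "C01_surface \<Omega> k K \<longleftrightarrow> compact K \<and> K \<subseteq> \<Omega> \<and>
     (\<exists>I::'d set. card I = k \<and> (\<exists>C>0. \<forall>x\<in>K. \<exists>r>0. \<exists>T S.
        bij_betw T (cylinder I) (ball x r) \<and> (\<forall>\<xi>\<in>cylinder I. S (T \<xi>) = \<xi>) \<and>
        C01_on (closure (cylinder I)) T \<and> C01_on (closure (ball x r)) S \<and>
        C01_norm (closure (cylinder I)) T + C01_norm (closure (ball x r)) S \<le> C \<and>
        {\<xi> \<in> cylinder I. T \<xi> \<in> ball x r \<inter> K} = {\<xi> \<in> cylinder I. coords I \<xi> = 0} \<and>
        (\<exists>C\<^sub>1>0. \<exists>C\<^sub>2>0. \<forall>\<xi>\<in>cylinder I. T \<xi> \<in> (\<Omega> - K) \<inter> ball x r \<longrightarrow>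
           C\<^sub>1 * norm (coords I \<xi>) \<le> infdist (T \<xi>) K \<and>
           infdist (T \<xi>) K \<le> C\<^sub>2 * norm (coords I \<xi>))))"

section \<open>Fractional Sobolev spaces\<close>

text \<open>Elements of the spaces on \<open>U\<close> are represented by total functions, of which only the values
  on \<open>U\<close> matter, up to equality almost everywhere. On the diagonal the integrand is \<open>0 / 0 = 0\<close>.\<close>

definition gagliardo_energy :: "real \<Rightarrow> real \<Rightarrow> (real ^ 'd) set \<Rightarrow> (real ^ 'd \<Rightarrow> real) \<Rightarrow> ennreal" where
  "gagliardo_energy s p U u =
     (\<integral>\<^sup>+ y. \<integral>\<^sup>+ x. ennreal (\<bar>u x - u y\<bar> powr p / norm (x - y) powr (real CARD('d) + s * p))
        \<partial>lebesgue_on U \<partial>lebesgue_on U)"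

definition Lp_energy :: "real \<Rightarrow> (real ^ 'd) set \<Rightarrow> (real ^ 'd \<Rightarrow> real) \<Rightarrow> ennreal" where
  "Lp_energy p U u = (\<integral>\<^sup>+ x. ennreal (\<bar>u x\<bar> powr p) \<partial>lebesgue_on U)"

definition sobolev :: "real \<Rightarrow> real \<Rightarrow> (real ^ 'd) set \<Rightarrow> (real ^ 'd \<Rightarrow> real) set" where
  "sobolev s p U = {u \<in> borel_measurable (lebesgue_on U).
     gagliardo_energy s p U u < \<infinity> \<and> Lp_energy p U u < \<infinity>}"

definition sobolev_norm :: "real \<Rightarrow> real \<Rightarrow> (real ^ 'd) set \<Rightarrow> (real ^ 'd \<Rightarrow> real) \<Rightarrow> real" where
  "sobolev_norm s p U u = enn2real (gagliardo_energy s p U u + Lp_energy p U u) powr (1 / p)"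

fun C_fun :: "nat \<Rightarrow> (real ^ 'd \<Rightarrow> real) \<Rightarrow> bool" where
  "C_fun 0 f \<longleftrightarrow> continuous_on UNIV f"
| "C_fun (Suc n) f \<longleftrightarrow> f differentiable_on UNIV \<and>
     (\<forall>i. C_fun n (\<lambda>x. frechet_derivative f (at x) (axis i 1)))"

definition test_functions :: "(real ^ 'd) set \<Rightarrow> (real ^ 'd \<Rightarrow> real) set" where
  "test_functions U = {f. (\<forall>n. C_fun n f) \<and>
     compact (closure {x. f x \<noteq> 0}) \<and> closure {x. f x \<noteq> 0} \<subseteq> U}"

text \<open>The space \<open>W\<^sub>0\<^sup>s\<^sup>,\<^sup>p(\<Omega> - K)\<close>; the norm is that of \<open>W\<^sup>s\<^sup>,\<^sup>p(\<Omega>)\<close>.\<close>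

definition sobolev0 :: "real \<Rightarrow> real \<Rightarrow> (real ^ 'd) set \<Rightarrow> (real ^ 'd) set \<Rightarrow> (real ^ 'd \<Rightarrow> real) set" where
  "sobolev0 s p \<Omega> K = {u \<in> sobolev s p \<Omega>.
     \<forall>\<epsilon>>0. \<exists>\<phi>\<in>test_functions (\<Omega> - K). sobolev_norm s p \<Omega> (\<lambda>x. u x - \<phi> x) < \<epsilon>}"

definition zero_ext :: "(real ^ 'd) set \<Rightarrow> (real ^ 'd) set \<Rightarrow> (real ^ 'd \<Rightarrow> real) \<Rightarrow> real ^ 'd \<Rightarrow> real" where
  "zero_ext \<Omega> K u = (\<lambda>x. if x \<in> \<Omega> - K then u x else 0)"

definition sobolev0_tilde :: "real \<Rightarrow> real \<Rightarrow> (real ^ 'd) set \<Rightarrow> (real ^ 'd) set \<Rightarrow> (real ^ 'd \<Rightarrow> real) set" where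
  "sobolev0_tilde s p \<Omega> K = zero_ext \<Omega> K ` sobolev0 s p \<Omega> K"

section \<open>Banach spaces of functions modulo almost everywhere equality\<close>

definition banach_function_space ::
    "(real ^ 'd) set \<Rightarrow> (real ^ 'd \<Rightarrow> real) set \<Rightarrow> ((real ^ 'd \<Rightarrow> real) \<Rightarrow> real) \<Rightarrow> bool" where
  "banach_function_space U V N \<longleftrightarrow>
     (\<lambda>x. 0) \<in> V \<and>
     (\<forall>u\<in>V. \<forall>v\<in>V. (\<lambda>x. u x + v x) \<in> V \<and> N (\<lambda>x. u x + v x) \<le> N u + N v) \<and>
     (\<forall>u\<in>V. \<forall>c. (\<lambda>x. c * u x) \<in> V \<and> N (\<lambda>x. c * u x) = \<bar>c\<bar> * N u) \<and>
     (\<forall>u\<in>V. N u = 0 \<longleftrightarrow> (AE x in lebesgue_on U. u x = 0)) \<and>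
     (\<forall>w::nat \<Rightarrow> real ^ 'd \<Rightarrow> real. (\<forall>n. w n \<in> V) \<longrightarrow>
        (\<forall>\<epsilon>>0. \<exists>M. \<forall>m\<ge>M. \<forall>n\<ge>M. N (\<lambda>x. w m x - w n x) < \<epsilon>) \<longrightarrow>
        (\<exists>u\<in>V. (\<lambda>n. N (\<lambda>x. w n x - u x)) \<longlonglongrightarrow> 0))"

text \<open>By the lower norm bound, the map \<open>E\<close> is injective modulo almost everywhere equality.\<close>

definition banach_isomorphism ::
    "((real ^ 'd \<Rightarrow> real) \<Rightarrow> real ^ 'd \<Rightarrow> real) \<Rightarrow>
     (real ^ 'd \<Rightarrow> real) set \<Rightarrow> ((real ^ 'd \<Rightarrow> real) \<Rightarrow> real) \<Rightarrow>
     (real ^ 'd \<Rightarrow> real) set \<Rightarrow> ((real ^ 'd \<Rightarrow> real) \<Rightarrow> real) \<Rightarrow> bool" where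
  "banach_isomorphism E V N V' N' \<longleftrightarrow>
     E ` V = V' \<and>
     (\<forall>u\<in>V. \<forall>v\<in>V. E (\<lambda>x. u x + v x) = (\<lambda>x. E u x + E v x)) \<and>
     (\<forall>u\<in>V. \<forall>c. E (\<lambda>x. c * u x) = (\<lambda>x. c * E u x)) \<and>
     (\<exists>a>0. \<exists>b>0. \<forall>u\<in>V. a * N u \<le> N' (E u) \<and> N' (E u) \<le> b * N u)"

end

theory Submission
  imports Defs
begin

text \<open>The first inequality holds because \<open>u\<close> and its zero extension agree almost everywhere on
  \<open>\<Omega>\<close>: test functions vanish on \<open>K\<close>, hence so does, almost everywhere, each of their limits.

  For the second one let first \<open>\<phi>\<close> be continuous with compact support in \<open>\<Omega>\<close>, and write
  \<open>\<delta> x\<close> for the distance of \<open>x\<close> to the complement of \<open>\<Omega>\<close>. What the energy over the whole space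
  has in addition to that over \<open>\<Omega>\<close> is twice the cross term
  \<open>\<integral>\<^sub>\<Omega> \<bar>\<phi> x\<bar>\<^sup>p (\<integral> \<bar>x - y\<bar>\<^sup>-\<^sup>2\<^sup>d dy) dx\<close> with \<open>y\<close> outside \<open>\<Omega>\<close>, and since such \<open>y\<close> satisfy
  \<open>\<bar>x - y\<bar> \<ge> \<delta> x\<close>, it is at most a multiple of \<open>H = \<integral>\<^sub>\<Omega> \<bar>\<phi>\<bar>\<^sup>p / \<delta>\<^sup>d\<close>. So everything rests on the fractional Hardy
  inequality: \<open>H\<close> is bounded by the energy of \<open>\<phi>\<close> over \<open>\<Omega>\<close>, with no lower order term.

  It follows by comparing the value of \<open>\<phi>\<close> at \<open>x\<close> with its values much closer to the boundary. Let
  \<open>D x\<close> be the set of those \<open>y \<in> \<Omega>\<close> with \<open>\<bar>x - y\<bar> \<le> C \<delta> x\<close> and \<open>\<delta> y \<le> C \<delta> x / n\<close>. In a Lipschitz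
  domain it is as thick as a slab of relative height \<open>1 / n\<close>: its measure is at least
  \<open>c (\<delta> x)\<^sup>d / n\<close>, with constants independent of \<open>n\<close> (lemma \<open>boundary_layer_thick\<close>). Average
  \<open>\<bar>\<phi> x\<bar>\<^sup>p \<le> 2\<^sup>p (\<bar>\<phi> y\<bar>\<^sup>p + \<bar>\<phi> x - \<phi> y\<bar>\<^sup>p)\<close> over \<open>y \<in> D x\<close>, divide by \<open>(\<delta> x)\<^sup>d\<close> and integrate over \<open>x\<close>. The
  differences give a multiple of the energy. In the other term, \<open>x\<close> runs for a given \<open>y\<close> through points at
  distance at least a multiple of \<open>n \<delta> y\<close>, so that term is at most a constant times \<open>n\<^sup>1\<^sup>-\<^sup>d H\<close>. As \<open>d \<ge> 2\<close>,
  this is at most \<open>H / 2\<close> for large \<open>n\<close>, and as \<open>H\<close> is finite it can be absorbed. Points deep inside \<open>\<Omega>\<close>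
  are compared directly with the layer of one fixed point near the boundary, which replaces a
  Poincare inequality.

  Fatou's lemma carries the estimate from test functions to the closure. For the Banach space
  statements, the energies are integrals of \<open>p\<close>-th powers of linear expressions in \<open>u\<close>, namely of \<open>u\<close> and of a
  difference quotient on the product space; convexity of the power gives the triangle inequality,
  and completeness is proved as for Lebesgue spaces. By the two norm estimates, completeness passes
  to the space of extended functions.\<close>

section \<open>Radial integrals\<close>

text \<open>Balls about \<open>y\<close> stand in for dyadic shells, because their measure is known; this costs only a
  constant factor.\<close>

lemma nn_integral_le_ball_shells:
  fixes g :: "'a::euclidean_space \<Rightarrow> ennreal" and c r :: "nat \<Rightarrow> real"
  assumes shell: "\<And>x. g x \<noteq> 0 \<Longrightarrow> \<exists>m. x \<in> ball y (r m) \<and> g x \<le> ennreal (c m)"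
    and c: "\<And>m. 0 \<le> c m" and r: "\<And>m. 0 \<le> r m"
    and S: "(\<lambda>m. c m * r m ^ DIM('a)) sums S"
  shows "(\<integral>\<^sup>+x. g x \<partial>lborel) \<le> ennreal (unit_ball_vol (DIM('a)) * S)"
proof -
  let ?V = "unit_ball_vol (DIM('a))"
  have "(\<integral>\<^sup>+x. g x \<partial>lborel) \<le> (\<integral>\<^sup>+x. (\<Sum>m. ennreal (c m) * indicator (ball y (r m)) x) \<partial>lborel)"
  proof (rule nn_integral_mono)
    fix x
    show "g x \<le> (\<Sum>m. ennreal (c m) * indicator (ball y (r m)) x)"
    proof (cases "g x = 0")
      case False
      then obtain m where m: "x \<in> ball y (r m)" "g x \<le> ennreal (c m)"
        using shell by blast
      have "g x \<le> ennreal (c m) * indicator (ball y (r m)) x"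
        using m by simp
      also have "\<dots> = (\<Sum>m\<in>{m}. ennreal (c m) * indicator (ball y (r m)) x)"
        by (simp del: sum_mult_indicator)
      also have "\<dots> \<le> (\<Sum>m. ennreal (c m) * indicator (ball y (r m)) x)"
        by (rule sum_le_suminf) auto
      finally show ?thesis .
    qed auto
  qed
  also have "\<dots> = (\<Sum>m. \<integral>\<^sup>+x. ennreal (c m) * indicator (ball y (r m)) x \<partial>lborel)"
    by (intro nn_integral_suminf borel_measurable_times_ennreal borel_measurable_const borel_measurable_indicator) auto
  also have "\<dots> = (\<Sum>m. ennreal (?V * (c m * r m ^ DIM('a))))"
    using c r by (intro suminf_cong)
      (simp add: nn_integral_cmult_indicator emeasure_ball ennreal_mult'[symmetric] mult_ac)
  also have "\<dots> = ennreal (\<Sum>m. ?V * (c m * r m ^ DIM('a)))"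
    using c r S by (intro suminf_ennreal2) (auto intro!: summable_mult sums_summable)
  also have "(\<Sum>m. ?V * (c m * r m ^ DIM('a))) = ?V * S"
    using S by (intro sums_unique[symmetric] sums_mult)
  finally show ?thesis .
qed

text \<open>On the shell \<open>2\<^sup>m R \<le> \<bar>x - y\<bar> < 2\<^sup>m\<^sup>+\<^sup>1 R\<close> the integrand is at most \<open>(2\<^sup>m R)\<^sup>-\<^sup>2\<^sup>d\<close>, and the shell has
  measure of order \<open>(2\<^sup>m R)\<^sup>d\<close>; the products form a geometric series of ratio \<open>2\<^sup>-\<^sup>d\<close>.\<close>

lemma nn_integral_inverse_dist_power_outside_ball:
  obtains A :: real where "A > 0"
    "\<And>(y::'a::euclidean_space) R. R > 0 \<Longrightarrow>
       (\<integral>\<^sup>+x. ennreal (1 / dist x y ^ (2 * DIM('a))) * indicator {x. R \<le> dist x y} x \<partial>lborel)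
         \<le> ennreal (A / R ^ DIM('a))"
proof
  let ?d = "DIM('a)" and ?V = "unit_ball_vol (DIM('a))"
  define S :: real where "S = 1 / (1 - (1/2)^?d)"
  have half: "(1/2::real)^?d < 1"
    by (rule power_less_one_iff[THEN iffD2]) auto
  show "?V * (2 ^ ?d * S) > 0"
    using half by (simp add: S_def)
  fix y :: 'a and R :: real assume R: "R > 0"
  have "(\<integral>\<^sup>+x. ennreal (1 / dist x y ^ (2 * ?d)) * indicator {x. R \<le> dist x y} x \<partial>lborel)
     \<le> ennreal (?V * (2 ^ ?d / R ^ ?d * S))"
  proof (rule nn_integral_le_ball_shells[where y=y and c="\<lambda>m. 1 / (2^m * R) ^ (2 * ?d)" and r="\<lambda>m. 2 ^ Suc m * R"])
    fix x assume "ennreal (1 / dist x y ^ (2 * ?d)) * indicator {x. R \<le> dist x y} x \<noteq> 0"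
    then have xR: "R \<le> dist x y"
      by (auto simp: indicator_def split: if_splits)
    define n where "n = (LEAST n. dist x y < 2 ^ n * R)"
    have "\<exists>n. dist x y / R < 2 ^ n"
      by (rule real_arch_pow) simp
    then have "\<exists>n. dist x y < 2 ^ n * R"
      using R by (simp add: field_simps)
    then have n: "dist x y < 2 ^ n * R"
      unfolding n_def by (rule LeastI_ex)
    with xR have "n \<noteq> 0"
      by (intro notI) simp
    then obtain m where m: "n = Suc m"
      using not0_implies_Suc by blast
    have "2 ^ m * R \<le> dist x y"
      using not_less_Least[of m "\<lambda>n. dist x y < 2 ^ n * R"] m unfolding n_def[symmetric] by simp
    then have "(2 ^ m * R) ^ (2 * ?d) \<le> dist x y ^ (2 * ?d)"
      using R by (intro power_mono) auto
    then have "1 / dist x y ^ (2 * ?d) \<le> 1 / (2 ^ m * R) ^ (2 * ?d)"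
      using R by (intro divide_left_mono) (auto intro!: mult_pos_pos zero_less_power simp del: zero_less_dist_iff intro: less_le_trans[OF R xR])
    then show "\<exists>m. x \<in> ball y (2 ^ Suc m * R) \<and>
       ennreal (1 / dist x y ^ (2 * ?d)) * indicator {x. R \<le> dist x y} x \<le> ennreal (1 / (2 ^ m * R) ^ (2 * ?d))"
      using n m xR by (intro exI[of _ m]) (auto simp: dist_commute intro!: ennreal_leI)
  next
    have "(\<lambda>m. ((1/2::real)^?d)^m) sums S"
      unfolding S_def using half by (intro geometric_sums) simp
    then have "(\<lambda>m. 2 ^ ?d / R ^ ?d * ((1/2::real)^?d)^m) sums (2 ^ ?d / R ^ ?d * S)"
      by (rule sums_mult)
    moreover have "1 / (2 ^ m * R) ^ (2 * ?d) * (2 ^ Suc m * R) ^ ?d = 2 ^ ?d / R ^ ?d * ((1/2::real)^?d)^m" for m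
    proof -
      have "1 / (2 ^ m * R) ^ (2 * ?d) * (2 ^ Suc m * R) ^ ?d = 1 / ((2^m * R)^?d * (2^m * R)^?d) * (2^?d * (2^m * R)^?d)"
        by (simp only: mult_2[of "?d"] power_add power_Suc power_mult_distrib[of 2] mult.assoc)
      also have "\<dots> = 2^?d / (2^m * R)^?d"
        using R by simp
      also have "\<dots> = 2 ^ ?d / R ^ ?d * ((1/2::real)^?d)^m"
        by (simp add: power_mult_distrib power_divide power_mult[symmetric] mult.commute)
      finally show ?thesis .
    qed
    ultimately show "(\<lambda>m. 1 / (2 ^ m * R) ^ (2 * ?d) * (2 ^ Suc m * R) ^ ?d) sums (2 ^ ?d / R ^ ?d * S)"
      by simp
  qed (use R in auto)
  then show "(\<integral>\<^sup>+x. ennreal (1 / dist x y ^ (2 * ?d)) * indicator {x. R \<le> dist x y} x \<partial>lborel)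
     \<le> ennreal (?V * (2 ^ ?d * S) / R ^ ?d)"
    by (simp add: mult_ac)
qed

text \<open>Here the shells shrink to \<open>y\<close>. The exponent may have either sign, which costs a factor
  \<open>2 powr \<bar>q\<bar>\<close> on each shell; the geometric series converges because \<open>q > - d\<close>.\<close>

lemma nn_integral_dist_powr_inside_ball:
  fixes q R :: real
  assumes q: "q + real DIM('a::euclidean_space) > 0" and R: "R > 0"
  obtains B :: real where
    "\<And>y::'a. (\<integral>\<^sup>+x. ennreal (dist x y powr q) * indicator (ball y R) x \<partial>lborel) \<le> ennreal B"
proof
  let ?d = "DIM('a)" and ?V = "unit_ball_vol (DIM('a))"
  let ?c = "2 powr \<bar>q\<bar>"
  define \<theta> :: real where "\<theta> = (1/2) powr (q + ?d)"
  have th: "0 < \<theta>" "\<theta> < 1"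
    using q powr_less_mono'[of "1/2" 0 "q + ?d"] by (auto simp: \<theta>_def)
  fix y :: 'a
  show "(\<integral>\<^sup>+x. ennreal (dist x y powr q) * indicator (ball y R) x \<partial>lborel)
     \<le> ennreal (?V * (?c * R powr (q + ?d) * (1 / (1 - \<theta>))))"
  proof (rule nn_integral_le_ball_shells[where y=y and c="\<lambda>m. ?c * (R / 2 ^ m) powr q" and r="\<lambda>m. R / 2 ^ m"])
    fix x assume nz: "ennreal (dist x y powr q) * indicator (ball y R) x \<noteq> 0"
    then have xR: "dist x y < R" and pos: "0 < dist x y"
      by (auto simp: indicator_def dist_commute split: if_splits)
    define n where "n = (LEAST n. R / 2 ^ n \<le> dist x y)"
    have "\<exists>n. R / dist x y < 2 ^ n"
      by (rule real_arch_pow) simp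
    then obtain n0 where "R / dist x y < 2 ^ n0" ..
    then have "R / 2 ^ n0 \<le> dist x y"
      using pos by (simp add: field_simps)
    then have n: "R / 2 ^ n \<le> dist x y"
      unfolding n_def by (rule LeastI)
    with xR have "n \<noteq> 0"
      by (intro notI) simp
    then obtain m where m: "n = Suc m"
      using not0_implies_Suc by blast
    have up: "dist x y < R / 2 ^ m"
      using not_less_Least[of m "\<lambda>n. R / 2 ^ n \<le> dist x y"] m unfolding n_def[symmetric] by simp
    have "dist x y powr q \<le> ?c * (R / 2 ^ m) powr q"
    proof (cases "q \<ge> 0")
      case True
      have "dist x y powr q \<le> (R / 2 ^ m) powr q"
        using True up by (intro powr_mono2) auto
      also have "\<dots> \<le> ?c * (R / 2 ^ m) powr q"
        using ge_one_powr_ge_zero[of 2 "\<bar>q\<bar>"] by (intro mult_le_cancel_right1[THEN iffD2]) auto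
      finally show ?thesis .
    next
      case False
      have "dist x y powr q \<le> (R / 2 ^ n) powr q"
        using False n R by (intro powr_mono2') auto
      also have "R / 2 ^ n = (R / 2 ^ m) / 2"
        by (simp add: m)
      also have "((R / 2 ^ m) / 2) powr q = (R / 2 ^ m) powr q / 2 powr q"
        using R by (subst powr_divide) auto
      also have "\<dots> = (R / 2 ^ m) powr q * ?c"
        using False by (simp add: divide_inverse powr_minus[symmetric])
      also have "\<dots> = ?c * (R / 2 ^ m) powr q"
        by (rule mult.commute)
      finally show ?thesis .
    qed
    then show "\<exists>m. x \<in> ball y (R / 2 ^ m) \<and>
       ennreal (dist x y powr q) * indicator (ball y R) x \<le> ennreal (?c * (R / 2 ^ m) powr q)"
      using up by (intro exI[of _ m]) (auto simp: dist_commute indicator_def intro!: ennreal_leI)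
  next
    have "(\<lambda>m. \<theta> ^ m) sums (1 / (1 - \<theta>))"
      using th by (intro geometric_sums) simp
    then have "(\<lambda>m. ?c * R powr (q + ?d) * \<theta> ^ m) sums (?c * R powr (q + ?d) * (1 / (1 - \<theta>)))"
      by (rule sums_mult)
    moreover have "?c * (R / 2 ^ m) powr q * (R / 2 ^ m) ^ ?d = ?c * R powr (q + ?d) * \<theta> ^ m" for m
    proof -
      have "(R / 2 ^ m) powr q * (R / 2 ^ m) ^ ?d = (R / 2 ^ m) powr (q + ?d)"
        using R by (simp add: powr_add powr_realpow)
      also have "R / 2 ^ m = R * (1/2) powr m"
        by (simp add: powr_realpow power_divide)
      also have "(R * (1/2) powr m) powr (q + ?d) = R powr (q + ?d) * \<theta> powr m"
        using R by (simp add: \<theta>_def powr_mult powr_powr mult.commute)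
      finally show ?thesis
        using th by (simp add: powr_realpow power_one_over)
    qed
    ultimately show "(\<lambda>m. ?c * (R / 2 ^ m) powr q * (R / 2 ^ m) ^ ?d) sums (?c * R powr (q + ?d) * (1 / (1 - \<theta>)))"
      by (simp only: mult.assoc)
  qed (use R in auto)
qed

section \<open>Thick boundary layers of Lipschitz domains\<close>

lemma emeasure_lborel_vimage_translation:
  fixes S :: "'a::euclidean_space set"
  assumes "S \<in> sets borel"
  shows "emeasure lborel ((\<lambda>y. c + y) -` S) = emeasure lborel S"
proof -
  have "emeasure lborel S = emeasure (distr lborel borel ((+) c)) S"
    by (simp add: lborel_distr_plus)
  also have "\<dots> = emeasure lborel ((+) c -` S)"
    using assms by (subst emeasure_distr) auto
  finally show ?thesis by simp
qed

context
  fixes e :: "'a::euclidean_space" and \<gamma> :: "'a \<Rightarrow> real"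
begin

text \<open>Graph coordinates relative to the direction \<open>e\<close>. Projecting along \<open>e\<close> inside the ambient space avoids
  the choice of a basis of the hyperplane on which \<open>\<gamma>\<close> lives, and makes translations
  along \<open>e\<close> plain shifts of the height.\<close>

definition horizontal :: "'a \<Rightarrow> 'a" where
  "horizontal y = y - (y \<bullet> e) *\<^sub>R e"

definition graph_height :: "'a \<Rightarrow> real" where
  "graph_height y = y \<bullet> e - \<gamma> (horizontal y)"

definition thin_layer :: "'a \<Rightarrow> real \<Rightarrow> real \<Rightarrow> 'a set" where
  "thin_layer z h \<tau> = {y. norm (horizontal (y - z)) < h \<and> 0 < graph_height y \<and> graph_height y \<le> \<tau>}"

context
  fixes L :: real
  assumes e: "norm e = 1" and lip: "L-lipschitz_on {z. z \<bullet> e = 0} \<gamma>"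
begin

lemma inner_e_e [simp]: "e \<bullet> e = 1"
  using e by (simp add: norm_eq_1)

lemma horizontal_dot [simp]: "horizontal y \<bullet> e = 0"
  by (simp add: horizontal_def inner_diff_left)

lemma horizontal_diff: "horizontal y - horizontal z = horizontal (y - z)"
  by (simp add: horizontal_def inner_diff_left scaleR_diff_left)

lemma horizontal_add_e [simp]: "horizontal (y + a *\<^sub>R e) = horizontal y"
  by (simp add: horizontal_def inner_add_left scaleR_add_left)

lemma graph_height_add_e [simp]: "graph_height (y + a *\<^sub>R e) = graph_height y + a"
  by (simp add: graph_height_def inner_add_left)

lemma norm_horizontal_le: "norm (horizontal y) \<le> norm y"
proof -
  have "norm (horizontal y) ^ 2 = norm y ^ 2 - (y \<bullet> e) ^ 2"
    unfolding power2_norm_eq_inner horizontal_def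
    by (simp add: inner_diff_left inner_diff_right inner_commute power2_eq_square algebra_simps)
  then have "norm (horizontal y) ^ 2 \<le> norm y ^ 2"
    by simp
  then show ?thesis
    by (rule power2_le_imp_le) simp
qed

lemma abs_dot_e_le: "\<bar>y \<bullet> e\<bar> \<le> norm y"
  using Cauchy_Schwarz_ineq2[of y e] e by simp

lemma L_nonneg: "0 \<le> L"
  using lip by (rule lipschitz_on_nonneg)

lemma graph_function_lipschitz: "\<bar>\<gamma> (horizontal y) - \<gamma> (horizontal z)\<bar> \<le> L * norm (horizontal (y - z))"
  using lipschitz_onD[OF lip, of "horizontal y" "horizontal z"]
  by (simp add: dist_norm horizontal_diff)

lemma continuous_on_graph_height: "continuous_on UNIV graph_height"
proof -
  have h: "continuous_on UNIV horizontal"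
    unfolding horizontal_def by (intro continuous_intros)
  have "continuous_on UNIV (\<lambda>y. \<gamma> (horizontal y))"
    by (rule continuous_on_compose2[OF lipschitz_on_continuous_on[OF lip] h]) auto
  then show ?thesis
    unfolding graph_height_def by (intro continuous_intros)
qed

lemma thin_layer_borel: "thin_layer z h \<tau> \<in> sets borel"
proof -
  have [measurable]: "graph_height \<in> borel_measurable borel"
    by (rule borel_measurable_continuous_onI[OF continuous_on_graph_height])
  have [measurable]: "(\<lambda>y. norm (horizontal (y - z))) \<in> borel_measurable borel"
    unfolding horizontal_def by (intro borel_measurable_continuous_onI continuous_intros)
  show ?thesis
    unfolding thin_layer_def by measurable
qed

lemma dist_thin_layer:
  assumes y: "y \<in> thin_layer z h \<tau>" and z: "graph_height z = 0" and h: "0 \<le> h"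
  shows "dist y z \<le> (1 + L) * h + \<tau>"
proof -
  have 1: "norm (horizontal (y - z)) < h" "0 < graph_height y" "graph_height y \<le> \<tau>"
    using y by (auto simp: thin_layer_def)
  have "(y - z) \<bullet> e = graph_height y + (\<gamma> (horizontal y) - \<gamma> (horizontal z))"
    using z by (simp add: graph_height_def inner_diff_left)
  then have "\<bar>(y - z) \<bullet> e\<bar> \<le> \<tau> + L * norm (horizontal (y - z))"
    using 1 graph_function_lipschitz[of y z] by linarith
  also have "\<dots> \<le> \<tau> + L * h"
    using 1 L_nonneg by (intro add_left_mono mult_left_mono) auto
  finally have 2: "\<bar>(y - z) \<bullet> e\<bar> \<le> \<tau> + L * h" .
  have "y - z = horizontal (y - z) + ((y - z) \<bullet> e) *\<^sub>R e"
    by (simp add: horizontal_def)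
  then have "norm (y - z) \<le> norm (horizontal (y - z)) + norm (((y - z) \<bullet> e) *\<^sub>R e)"
    by (metis norm_triangle_ineq)
  also have "norm (((y - z) \<bullet> e) *\<^sub>R e) = \<bar>(y - z) \<bullet> e\<bar>"
    using e by simp
  finally show ?thesis
    using 1 2 by (simp add: dist_norm distrib_right)
qed

text \<open>Translations along \<open>e\<close> just shift the height. A ball of radius \<open>h\<close> that lies above \<open>z\<close>, at heights
  between \<open>0\<close> and \<open>3 (1 + L) h\<close>, is therefore covered by \<open>n\<close> vertical translates of the slab of
  height \<open>3 (1 + L) h / n\<close>, so the slab has at least the \<open>n\<close>-th part of the measure of the ball.\<close>

lemma emeasure_thin_layer:
  fixes n :: nat
  assumes z: "graph_height z = 0" and h: "0 < h" and n: "0 < n"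
  shows "ennreal (unit_ball_vol (DIM('a)) * h ^ DIM('a) / n) \<le> emeasure lborel (thin_layer z h (3 * (1 + L) * h / n))"
proof -
  define T where "T = 3 * (1 + L) * h"
  define w where "w = z + (2 * (1 + L) * h) *\<^sub>R e"
  let ?S = "thin_layer z h (T / n)"
  let ?U = "\<lambda>i::nat. (\<lambda>y. (- (i * T / n)) *\<^sub>R e + y) -` ?S"
  have T: "T > 0"
    using L_nonneg h by (simp add: T_def)
  have meas: "?U i \<in> sets lborel" for i
    using measurable_sets_borel[OF _ thin_layer_borel, of "\<lambda>y. (- (i * T / n)) *\<^sub>R e + y"] by simp
  have cover: "ball w h \<subseteq> (\<Union>i<n. ?U i)"
  proof
    fix y assume "y \<in> ball w h"
    then have yw: "norm (y - w) < h"
      by (simp add: dist_norm norm_minus_commute)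
    have eq: "y - z = (y - w) + (2 * (1 + L) * h) *\<^sub>R e"
      by (simp add: w_def)
    have hor: "horizontal (y - z) = horizontal (y - w)"
      unfolding eq by simp
    have hz: "norm (horizontal (y - z)) < h"
      unfolding hor using norm_horizontal_le[of "y - w"] yw by linarith
    have lower: "\<bar>\<gamma> (horizontal y) - \<gamma> (horizontal z)\<bar> \<le> L * h"
      using graph_function_lipschitz[of y z] mult_left_mono[OF less_imp_le[OF hz] L_nonneg] by linarith
    have "graph_height y = (y - z) \<bullet> e - (\<gamma> (horizontal y) - \<gamma> (horizontal z))"
      using z by (simp add: graph_height_def inner_diff_left)
    moreover have "(y - z) \<bullet> e = (y - w) \<bullet> e + 2 * (1 + L) * h"
      unfolding eq by (simp add: inner_add_left)
    ultimately have ht: "0 < graph_height y" "graph_height y \<le> T"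
      using lower abs_dot_e_le[of "y - w"] yw mult_nonneg_nonneg[OF L_nonneg less_imp_le[OF h]] h
      by (auto simp: T_def algebra_simps)
    \<comment> \<open>The index of the translate that contains \<open>y\<close>: heights in \<open>(i T / n, (i + 1) T / n]\<close> belong to \<open>i\<close>.\<close>
    define q where "q = graph_height y * n / T"
    define j where "j = \<lceil>q\<rceil> - 1"
    have q: "0 < q" "q \<le> n"
      using ht T n by (auto simp: q_def field_simps)
    then have "0 \<le> j"
      unfolding j_def by linarith
    moreover have "j < n"
      using q unfolding j_def by linarith
    ultimately obtain i :: nat where i: "j = int i" "i < n"
      by (metis of_nat_less_iff zero_le_imp_eq_int)
    have "real i < q" "q \<le> real i + 1"
      using i(1) unfolding j_def by linarith+
    then have "i * T / n < graph_height y" "graph_height y \<le> (i + 1) * T / n"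
      using T n by (auto simp: q_def field_simps)
    then have "0 < graph_height (y + (- (i * T / n)) *\<^sub>R e)" "graph_height (y + (- (i * T / n)) *\<^sub>R e) \<le> T / n"
      unfolding graph_height_add_e by (auto simp: add_divide_distrib distrib_right)
    moreover have "horizontal (y + (- (i * T / n)) *\<^sub>R e - z) = horizontal (y - z)"
      using horizontal_add_e[of "y - z" "- (i * T / n)"] by (simp add: algebra_simps)
    ultimately have "y + (- (i * T / n)) *\<^sub>R e \<in> ?S"
      using hz by (simp add: thin_layer_def)
    then have "y \<in> ?U i"
      by (simp add: add.commute)
    then show "y \<in> (\<Union>i<n. ?U i)"
      using i by blast
  qed
  have "ennreal (unit_ball_vol (DIM('a)) * h ^ DIM('a)) = emeasure lborel (ball w h)"
    using h by (simp add: emeasure_ball)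
  also have "\<dots> \<le> emeasure lborel (\<Union>i<n. ?U i)"
    using meas by (intro emeasure_mono cover) auto
  also have "\<dots> \<le> (\<Sum>i<n. emeasure lborel (?U i))"
    using meas by (intro emeasure_subadditive_finite) auto
  also have "\<dots> = of_nat n * emeasure lborel ?S"
    by (simp only: emeasure_lborel_vimage_translation[OF thin_layer_borel] sum_constant card_lessThan)
  finally have "ennreal (1 / n) * ennreal (unit_ball_vol (DIM('a)) * h ^ DIM('a))
      \<le> ennreal (1 / n) * (of_nat n * emeasure lborel ?S)"
    by (rule mult_left_mono) simp
  also have "\<dots> = ennreal (1 / n * n) * emeasure lborel ?S"
    by (subst ennreal_mult) (auto simp: ennreal_of_nat_eq_real_of_nat mult.assoc)
  also have "\<dots> = emeasure lborel ?S"
    using n by simp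
  finally show ?thesis
    using h by (simp add: T_def ennreal_mult'[symmetric])
qed

end

end


text \<open>The set over which the values of a function will be averaged to bound its value at \<open>x\<close>. The factor
  \<open>C\<close> absorbs the loss from the geometry of \<open>\<Omega>\<close> and stays fixed while \<open>n\<close> becomes large.\<close>

definition boundary_layer :: "'a::metric_space set \<Rightarrow> real \<Rightarrow> nat \<Rightarrow> 'a \<Rightarrow> 'a set" where
  "boundary_layer \<Omega> C n x =
     {y\<in>\<Omega>. dist x y \<le> C * infdist x (- \<Omega>) \<and> infdist y (- \<Omega>) \<le> C * infdist x (- \<Omega>) / n}"

lemma boundary_layer_borel:
  assumes "open \<Omega>"
  shows "boundary_layer \<Omega> C n x \<in> sets borel"
proof -
  have "\<Omega> \<in> sets borel"
    using assms by auto
  moreover have [measurable]: "(\<lambda>y. infdist y (- \<Omega>)) \<in> borel_measurable borel"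
      "(\<lambda>y. dist x y) \<in> borel_measurable borel"
    by (intro borel_measurable_continuous_onI continuous_intros)+
  have "{y. dist x y \<le> C * infdist x (- \<Omega>) \<and> infdist y (- \<Omega>) \<le> C * infdist x (- \<Omega>) / n} \<in> sets borel"
    by measurable
  ultimately have "\<Omega> \<inter> {y. dist x y \<le> C * infdist x (- \<Omega>) \<and> infdist y (- \<Omega>) \<le> C * infdist x (- \<Omega>) / n} \<in> sets borel"
    by (rule sets.Int)
  then show ?thesis
    by (simp add: boundary_layer_def Int_def)
qed

lemma boundary_layer_mono: "C \<le> C' \<Longrightarrow> boundary_layer \<Omega> C n x \<subseteq> boundary_layer \<Omega> C' n x"
  using mult_right_mono[OF _ infdist_nonneg, of C C' x "- \<Omega>"]
    divide_right_mono[OF mult_right_mono[OF _ infdist_nonneg], of C C' "real n" x "- \<Omega>"]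
  by (auto simp: boundary_layer_def)

text \<open>The open ball about \<open>x\<close> up to a nearest point \<open>z\<close> of the complement is contained in \<open>\<Omega>\<close>, so that
  \<open>z\<close> lies in the closure.\<close>

lemma nearest_complement_point_in_frontier:
  fixes x :: "'a::euclidean_space"
  assumes "open \<Omega>" "x \<in> \<Omega>" "\<Omega> \<noteq> UNIV"
  obtains z where "z \<in> frontier \<Omega>" "infdist x (- \<Omega>) = dist x z"
proof -
  obtain z where z: "z \<in> - \<Omega>" "infdist x (- \<Omega>) = dist x z"
    using infdist_attains_inf[of "- \<Omega>" x] assms by (auto simp: closed_Compl)
  have xz: "0 < dist x z"
    using z(1) assms(2) by auto
  have "ball x (dist x z) \<subseteq> \<Omega>"
    using z(2) infdist_le[of _ "- \<Omega>" x] by (force simp: subset_eq)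
  then have "closure (ball x (dist x z)) \<subseteq> closure \<Omega>"
    by (rule closure_mono)
  then have "z \<in> closure \<Omega>"
    using xz by (auto simp: subset_eq)
  then have "z \<in> frontier \<Omega>"
    using z(1) assms(1) by (simp add: frontier_def interior_open)
  with z(2) that show ?thesis by blast
qed

text \<open>The thin layer over the nearest boundary point \<open>z\<close>, at the scale of the distance of \<open>x\<close> to \<open>z\<close>, is part of the
  boundary layer: its points are close to \<open>x\<close>, and going down vertically onto the graph shows that
  they are close to the complement. The smallness condition keeps all points inside the ball in
  which \<open>\<Omega>\<close> is described by the graph.\<close>

lemma boundary_layer_near_graph:
  fixes \<Omega> :: "'a::euclidean_space set"
  assumes e: "norm e = 1" and lip: "L-lipschitz_on {z. z \<bullet> e = 0} \<gamma>" and \<Omega>: "open \<Omega>"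
    and graph: "\<Omega> \<inter> ball x0 r = {y \<in> ball x0 r. y \<bullet> e > \<gamma> (y - (y \<bullet> e) *\<^sub>R e)}"
    and x: "x \<in> \<Omega>" and z: "z \<in> frontier \<Omega>" "dist x0 z < r / 2" "infdist x (- \<Omega>) = dist x z"
    and near: "7 * (1 + L) * dist x z < r / 2" and n: "0 < (n::nat)"
  shows "ennreal (unit_ball_vol (DIM('a)) * infdist x (- \<Omega>) ^ DIM('a) / n)
           \<le> emeasure lborel (boundary_layer \<Omega> (5 * (1 + L)) n x)"
proof -
  let ?t = "graph_height e \<gamma>"
  define h where "h = dist x z"
  define \<tau> where "\<tau> = 3 * (1 + L) * h / n"
  have L: "0 \<le> L"
    using lip by (rule lipschitz_on_nonneg)
  have in_\<Omega>: "y \<in> \<Omega> \<longleftrightarrow> 0 < ?t y" if "dist x0 y < r" for y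
  proof -
    have "y \<in> \<Omega> \<longleftrightarrow> y \<in> \<Omega> \<inter> ball x0 r"
      using that by simp
    also have "\<dots> \<longleftrightarrow> \<gamma> (y - (y \<bullet> e) *\<^sub>R e) < y \<bullet> e"
      unfolding graph using that by simp
    finally show ?thesis
      by (simp add: graph_height_def horizontal_def)
  qed
  have cont: "continuous_on UNIV ?t"
    by (rule continuous_on_graph_height[OF e lip])
  have z_notin: "z \<notin> \<Omega>"
    using z(1) \<Omega> by (simp add: frontier_def interior_open)
  have h: "0 < h"
    using x z_notin by (auto simp: h_def)
  have r: "0 < r"
    using z(2) by (metis dist_not_less_zero half_gt_zero_iff less_trans not_less_iff_gr_or_eq zero_less_dist_iff)
  have z_in: "dist x0 z < r"
    using z(2) r by linarith
  have tz: "?t z = 0"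
  proof (rule antisym)
    show "?t z \<le> 0"
      using in_\<Omega>[OF z_in] z_notin by linarith
    show "0 \<le> ?t z"
    proof (rule ccontr)
      assume neg: "\<not> 0 \<le> ?t z"
      have "open (?t -` {..<0} \<inter> ball x0 r)"
        by (intro open_Int open_vimage cont) auto
      moreover have "z \<in> ?t -` {..<0} \<inter> ball x0 r" "z \<in> closure \<Omega>"
        using neg z_in z(1) by (auto simp: frontier_def)
      ultimately obtain y where "y \<in> \<Omega>" "y \<in> ?t -` {..<0} \<inter> ball x0 r"
        by (metis disjoint_iff open_Int_closure_eq_empty)
      then show False
        using in_\<Omega>[of y] by simp
    qed
  qed
  define b where "b = (1 + L) * h"
  have b: "h \<le> b" "7 * b < r / 2"
    using L h near by (auto simp: b_def h_def algebra_simps)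
  have \<tau>: "\<tau> \<le> 3 * b"
    using n h b divide_left_mono[of 1 "real n" "3 * b"]
    unfolding \<tau>_def mult.assoc b_def[symmetric] by simp
  have "thin_layer e \<gamma> z h \<tau> \<subseteq> boundary_layer \<Omega> (5 * (1 + L)) n x"
  proof
    fix y assume y: "y \<in> thin_layer e \<gamma> z h \<tau>"
    then have ty: "0 < ?t y" "?t y \<le> \<tau>"
      by (auto simp: thin_layer_def)
    have yz: "dist y z \<le> 4 * b"
      using dist_thin_layer[OF e lip y tz] h \<tau> by (simp add: b_def)
    \<comment> \<open>The point of the graph vertically below \<open>y\<close>.\<close>
    define q where "q = y + (- ?t y) *\<^sub>R e"
    have tq: "?t q = 0"
      unfolding q_def graph_height_add_e[OF e lip] by simp
    have qy: "dist y q = ?t y"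
      using ty e by (simp add: q_def dist_norm)
    have "dist x0 y < r"
      using dist_triangle[of x0 y z] dist_commute[of y z] yz z(2) b h by linarith
    then have "y \<in> \<Omega>"
      using in_\<Omega> ty by blast
    have "dist x0 q \<le> dist x0 z + dist y z + dist y q"
      using dist_triangle[of x0 q y] dist_triangle[of x0 y z] dist_commute[of y z] by linarith
    then have "dist x0 q < r"
      using qy ty \<tau> yz b z(2) by linarith
    then have "q \<in> - \<Omega>"
      using in_\<Omega> tq by simp
    then have "infdist y (- \<Omega>) \<le> \<tau>"
      using qy ty by (auto intro: infdist_le2)
    also have "\<tau> \<le> 5 * (1 + L) * infdist x (- \<Omega>) / n"
      unfolding \<tau>_def z(3) h_def[symmetric] using L h n
      by (intro divide_right_mono mult_right_mono) auto
    finally have "infdist y (- \<Omega>) \<le> 5 * (1 + L) * infdist x (- \<Omega>) / n" .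
    moreover have "dist x y \<le> 5 * (1 + L) * infdist x (- \<Omega>)"
      using dist_triangle[of x y z] dist_commute[of y z] yz b
      unfolding z(3) h_def[symmetric] mult.assoc b_def[symmetric] by (simp add: h_def)
    ultimately show "y \<in> boundary_layer \<Omega> (5 * (1 + L)) n x"
      using \<open>y \<in> \<Omega>\<close> by (simp add: boundary_layer_def)
  qed
  then have "emeasure lborel (thin_layer e \<gamma> z h \<tau>) \<le> emeasure lborel (boundary_layer \<Omega> (5 * (1 + L)) n x)"
    by (rule emeasure_mono) (simp add: boundary_layer_borel[OF \<Omega>])
  with emeasure_thin_layer[OF e lip tz h n] show ?thesis
    unfolding z(3) h_def[symmetric] \<tau>_def by (rule order_trans)
qed

text \<open>The frontier is compact, so finitely many graph descriptions suffice and the constants can be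
  chosen uniformly.\<close>

lemma boundary_layer_near_frontier:
  fixes \<Omega> :: "(real ^ 'd) set"
  assumes \<Omega>: "bounded_lipschitz_domain \<Omega>"
  obtains C \<rho> :: real where "\<rho> > 0" "C \<ge> 1"
    "\<And>x n. x \<in> \<Omega> \<Longrightarrow> infdist x (- \<Omega>) < \<rho> \<Longrightarrow> 0 < n \<Longrightarrow>
       ennreal (unit_ball_vol CARD('d) * infdist x (- \<Omega>) ^ CARD('d) / real n)
         \<le> emeasure lborel (boundary_layer \<Omega> C n x)"
proof -
  have op: "open \<Omega>" and bd: "bounded \<Omega>"
    using \<Omega> by (auto simp: bounded_lipschitz_domain_def)
  have nU: "\<Omega> \<noteq> UNIV"
    using bd not_bounded_UNIV by blast
  define good where "good \<epsilon> C x0 \<longleftrightarrow> (\<forall>x z n. x \<in> \<Omega> \<longrightarrow> z \<in> frontier \<Omega> \<longrightarrow> dist x0 z < \<epsilon> \<longrightarrow>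
      infdist x (- \<Omega>) = dist x z \<longrightarrow> dist x z < \<epsilon> \<longrightarrow> 0 < n \<longrightarrow>
      ennreal (unit_ball_vol CARD('d) * infdist x (- \<Omega>) ^ CARD('d) / real n)
         \<le> emeasure lborel (boundary_layer \<Omega> C n x))" for \<epsilon> C :: real and x0
  have "\<exists>\<epsilon>>0. \<exists>C. good \<epsilon> C x0" if x0: "x0 \<in> frontier \<Omega>" for x0
  proof -
    obtain r e \<gamma> L where *: "r > 0" "norm e = 1" "L-lipschitz_on {z. z \<bullet> e = 0} \<gamma>"
      "\<Omega> \<inter> ball x0 r = {y \<in> ball x0 r. y \<bullet> e > (\<gamma> (y - (y \<bullet> e) *\<^sub>R e) :: real)}"
      using \<Omega> x0 unfolding bounded_lipschitz_domain_def by (elim conjE ballE exE) (rule that, assumption+, blast)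
    have L: "0 \<le> L"
      using *(3) by (rule lipschitz_on_nonneg)
    \<comment> \<open>Chosen such that points within \<open>7 (1 + L) \<epsilon>\<close> of the half ball stay in the ball of radius \<open>r\<close>.\<close>
    define \<epsilon> where "\<epsilon> = r / (14 * (1 + L))"
    have \<epsilon>: "0 < \<epsilon>" "\<epsilon> \<le> r / 2" "7 * (1 + L) * \<epsilon> = r / 2"
      using L *(1) by (auto simp: \<epsilon>_def field_simps)
    have "good \<epsilon> (5 * (1 + L)) x0"
      unfolding good_def
    proof (intro allI impI)
      fix x z and n :: nat
      assume a: "x \<in> \<Omega>" "z \<in> frontier \<Omega>" "dist x0 z < \<epsilon>" "infdist x (- \<Omega>) = dist x z" "dist x z < \<epsilon>" "0 < n"
      have "7 * (1 + L) * dist x z < 7 * (1 + L) * \<epsilon>"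
        using a(5) L by (intro mult_strict_left_mono) auto
      then show "ennreal (unit_ball_vol CARD('d) * infdist x (- \<Omega>) ^ CARD('d) / real n)
         \<le> emeasure lborel (boundary_layer \<Omega> (5 * (1 + L)) n x)"
        using boundary_layer_near_graph[OF *(2,3) op *(4) a(1,2) _ a(4) _ a(6)] a(3) \<epsilon> by simp
    qed
    then show ?thesis
      using \<epsilon> by blast
  qed
  then obtain \<epsilon> C where good: "\<And>x0. x0 \<in> frontier \<Omega> \<Longrightarrow> 0 < \<epsilon> x0 \<and> good (\<epsilon> x0) (C x0) x0"
    by metis
  have "compact (frontier \<Omega>)"
    using bd by (rule compact_frontier_bounded)
  moreover have "frontier \<Omega> \<subseteq> (\<Union>x0\<in>frontier \<Omega>. ball x0 (\<epsilon> x0))"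
    using good by force
  ultimately obtain F where F: "F \<subseteq> frontier \<Omega>" "finite F" "frontier \<Omega> \<subseteq> (\<Union>x0\<in>F. ball x0 (\<epsilon> x0))"
    by (metis (no_types, lifting) compactE_image open_ball)
  define \<rho> where "\<rho> = Min (insert 1 (\<epsilon> ` F))"
  define C' where "C' = Max (insert 1 (C ` F))"
  show thesis
  proof
    show "\<rho> > 0" "C' \<ge> 1"
      using F good by (auto simp: \<rho>_def C'_def)
    fix x and n :: nat assume x: "x \<in> \<Omega>" "infdist x (- \<Omega>) < \<rho>" and n: "0 < n"
    obtain z where z: "z \<in> frontier \<Omega>" "infdist x (- \<Omega>) = dist x z"
      using nearest_complement_point_in_frontier[OF op x(1) nU] .
    then obtain x0 where x0: "x0 \<in> F" "dist x0 z < \<epsilon> x0"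
      using F by auto
    have "\<rho> \<le> \<epsilon> x0" "C x0 \<le> C'"
      using x0 F by (auto simp: \<rho>_def C'_def)
    have "ennreal (unit_ball_vol CARD('d) * infdist x (- \<Omega>) ^ CARD('d) / real n)
         \<le> emeasure lborel (boundary_layer \<Omega> (C x0) n x)"
      using good[of x0] x0 F(1) x z n \<open>\<rho> \<le> \<epsilon> x0\<close> unfolding good_def by auto
    also have "\<dots> \<le> emeasure lborel (boundary_layer \<Omega> C' n x)"
      using boundary_layer_mono[OF \<open>C x0 \<le> C'\<close>] by (rule emeasure_mono) (simp add: boundary_layer_borel[OF op])
    finally show "ennreal (unit_ball_vol CARD('d) * infdist x (- \<Omega>) ^ CARD('d) / real n)
         \<le> emeasure lborel (boundary_layer \<Omega> C' n x)" .
  qed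
qed

text \<open>For a point \<open>x\<close> far from the boundary, the layer of one fixed point \<open>x1\<close> near the boundary serves:
  all distances in \<open>\<Omega>\<close> are bounded by a multiple of the distance from \<open>x\<close> to the complement.\<close>

lemma boundary_layer_thick:
  fixes \<Omega> :: "(real ^ 'd) set"
  assumes \<Omega>: "bounded_lipschitz_domain \<Omega>"
  obtains C c :: real where "C \<ge> 1" "c > 0"
    "\<And>x n. x \<in> \<Omega> \<Longrightarrow> 0 < n \<Longrightarrow>
       ennreal (c * infdist x (- \<Omega>) ^ CARD('d) / real n) \<le> emeasure lborel (boundary_layer \<Omega> C n x)"
proof -
  have op: "open \<Omega>" and bd: "bounded \<Omega>" and ne: "\<Omega> \<noteq> {}"
    using \<Omega> by (auto simp: bounded_lipschitz_domain_def)
  have nU: "\<Omega> \<noteq> UNIV"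
    using bd not_bounded_UNIV by blast
  let ?V = "unit_ball_vol (real CARD('d))" and ?\<delta> = "\<lambda>x. infdist x (- \<Omega>)"
  have V: "?V > 0" by simp
  obtain C \<rho> where C: "\<rho> > 0" "C \<ge> 1" "\<And>x n. x \<in> \<Omega> \<Longrightarrow> ?\<delta> x < \<rho> \<Longrightarrow> 0 < n \<Longrightarrow>
       ennreal (?V * ?\<delta> x ^ CARD('d) / real n) \<le> emeasure lborel (boundary_layer \<Omega> C n x)"
    by (rule boundary_layer_near_frontier[OF \<Omega>]) blast
  obtain z0 where z0: "z0 \<in> frontier \<Omega>"
    using ne nU frontier_eq_empty by blast
  then have z0': "z0 \<in> closure \<Omega>" "z0 \<in> - \<Omega>"
    using op by (auto simp: frontier_def interior_open)
  obtain x1 where x1: "x1 \<in> \<Omega>" "dist x1 z0 < \<rho>"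
    using z0'(1) C(1) closure_approachable by blast
  have \<delta>1: "?\<delta> x1 < \<rho>"
    using infdist_le[OF z0'(2), of x1] x1 by linarith
  have \<delta>1_pos: "0 < ?\<delta> x1"
    using x1(1) nU op by (intro infdist_pos_not_in_closed) (auto simp: closed_Compl)
  obtain D where D: "\<And>x y. x \<in> closure \<Omega> \<Longrightarrow> y \<in> closure \<Omega> \<Longrightarrow> dist x y \<le> D"
    using bounded_closure[OF bd] bounded_two_points by metis
  have \<delta>D: "?\<delta> x \<le> D" if "x \<in> \<Omega>" for x
    using infdist_le[OF z0'(2), of x] D[of x z0] z0'(1) that closure_subset[of \<Omega>] by fastforce
  have D_pos: "0 < D"
    using \<delta>1_pos \<delta>D[OF x1(1)] by linarith
  define C' where "C' = max C (D / \<rho>)"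
  define c where "c = ?V * min 1 ((?\<delta> x1 / D) ^ CARD('d))"
  show thesis
  proof
    show "C' \<ge> 1"
      using C(2) by (simp add: C'_def)
    show "c > 0"
      using V \<delta>1_pos D_pos unfolding c_def by (intro mult_pos_pos) auto
    fix x and n :: nat assume x: "x \<in> \<Omega>" and n: "0 < n"
    have sub: "emeasure lborel (boundary_layer \<Omega> C n w) \<le> emeasure lborel (boundary_layer \<Omega> C' n x)"
      if "boundary_layer \<Omega> C n w \<subseteq> boundary_layer \<Omega> C' n x" for w
      using that by (rule emeasure_mono) (simp add: boundary_layer_borel[OF op])
    show "ennreal (c * ?\<delta> x ^ CARD('d) / real n) \<le> emeasure lborel (boundary_layer \<Omega> C' n x)"
    proof (cases "?\<delta> x < \<rho>")
      case True
      have "c * ?\<delta> x ^ CARD('d) / real n \<le> ?V * ?\<delta> x ^ CARD('d) / real n"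
        using V by (intro divide_right_mono mult_right_mono) (auto simp: c_def infdist_nonneg mult_le_cancel_left1)
      then have "ennreal (c * ?\<delta> x ^ CARD('d) / real n) \<le> ennreal (?V * ?\<delta> x ^ CARD('d) / real n)"
        by (rule ennreal_leI)
      also note C(3)[OF x True n]
      also have "emeasure lborel (boundary_layer \<Omega> C n x) \<le> emeasure lborel (boundary_layer \<Omega> C' n x)"
        by (intro sub boundary_layer_mono) (simp add: C'_def)
      finally show ?thesis .
    next
      case False
      have "c * ?\<delta> x ^ CARD('d) \<le> (?V * (?\<delta> x1 / D) ^ CARD('d)) * D ^ CARD('d)"
        using V \<delta>D[OF x] \<delta>1_pos D_pos unfolding c_def
        by (intro mult_mono power_mono) (auto simp: infdist_nonneg)
      also have "\<dots> = ?V * ?\<delta> x1 ^ CARD('d)"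
        using D_pos by (simp add: power_divide)
      finally have "ennreal (c * ?\<delta> x ^ CARD('d) / real n) \<le> ennreal (?V * ?\<delta> x1 ^ CARD('d) / real n)"
        by (intro ennreal_leI divide_right_mono) auto
      also note C(3)[OF x1(1) \<delta>1 n]
      also have "emeasure lborel (boundary_layer \<Omega> C n x1) \<le> emeasure lborel (boundary_layer \<Omega> C' n x)"
      proof (rule sub, rule subsetI)
        fix y assume y: "y \<in> boundary_layer \<Omega> C n x1"
        have "dist x y \<le> D"
          using y x D closure_subset[of \<Omega>] by (auto simp: boundary_layer_def)
        also have "D \<le> D / \<rho> * ?\<delta> x"
          using False D_pos C(1) by (simp add: field_simps)
        also have "\<dots> \<le> C' * ?\<delta> x"
          by (intro mult_right_mono) (auto simp: C'_def infdist_nonneg)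
        finally have "dist x y \<le> C' * ?\<delta> x" .
        moreover have "C * ?\<delta> x1 / n \<le> C' * ?\<delta> x / n"
          using False \<delta>1 C(2) by (intro divide_right_mono mult_mono) (auto simp: C'_def infdist_nonneg)
        ultimately show "y \<in> boundary_layer \<Omega> C' n x"
          using y by (auto simp: boundary_layer_def)
      qed
      finally show ?thesis .
    qed
  qed
qed

section \<open>The fractional Hardy inequality\<close>

text \<open>The absorption argument. Below, \<open>F\<close> collects the values of \<open>\<phi>\<close> on the boundary layer of \<open>x\<close>, and \<open>G\<close>
  the differences. Integrating \<open>F\<close> first over \<open>x\<close> gains the factor \<open>n powr (- d)\<close> from
  the tail of \<open>\<bar>x - y\<bar> powr (- 2 d)\<close>, which beats the loss of \<open>n\<close> from the measure of the layer as soon as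
  \<open>d \<ge> 2\<close>. Continuity and compact support ensure that the integral to be absorbed is finite.\<close>

lemma fractional_hardy_inequality_of_thick_layers:
  fixes \<Omega> :: "'a::euclidean_space set" and C c p :: real
  assumes op: "open \<Omega>" and nU: "\<Omega> \<noteq> UNIV" and dim: "2 \<le> DIM('a)"
    and C: "C \<ge> 1" and c: "c > 0" and p: "p > 0"
    and thick: "\<And>x n. x \<in> \<Omega> \<Longrightarrow> 0 < n \<Longrightarrow>
       ennreal (c * infdist x (- \<Omega>) ^ DIM('a) / real n) \<le> emeasure lborel (boundary_layer \<Omega> C n x)"
  obtains M :: real where "M \<ge> 0"
    "\<And>\<phi> S. continuous_on UNIV \<phi> \<Longrightarrow> compact S \<Longrightarrow> S \<subseteq> \<Omega> \<Longrightarrow> (\<And>x. x \<notin> S \<Longrightarrow> \<phi> x = 0) \<Longrightarrow>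
       (\<integral>\<^sup>+x. ennreal (\<bar>\<phi> x\<bar> powr p / infdist x (- \<Omega>) ^ DIM('a)) * indicator \<Omega> x \<partial>lborel)
       \<le> ennreal M * (\<integral>\<^sup>+x. \<integral>\<^sup>+y. ennreal (\<bar>\<phi> x - \<phi> y\<bar> powr p / dist x y ^ (2 * DIM('a)))
            * (indicator \<Omega> x * indicator \<Omega> y) \<partial>lborel \<partial>lborel)"
proof -
  let ?d = "DIM('a)" and ?\<delta> = "\<lambda>x. infdist x (- \<Omega>)"
  have \<delta>_pos: "0 < ?\<delta> x" if "x \<in> \<Omega>" for x
    using that op nU by (intro infdist_pos_not_in_closed) (auto simp: closed_Compl)
  obtain A where A: "A > 0" "\<And>(y::'a) R. R > 0 \<Longrightarrow>
       (\<integral>\<^sup>+x. ennreal (1 / dist x y ^ (2 * ?d)) * indicator {x. R \<le> dist x y} x \<partial>lborel)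
         \<le> ennreal (A / R ^ ?d)"
    by (rule nn_integral_inverse_dist_power_outside_ball) blast
  define K where "K = 2 powr p / c"
  have K: "K > 0" using c by (simp add: K_def)
  define Q where "Q = K * C ^ (2 * ?d) * A * (2 * C) ^ ?d"
  have Q: "Q > 0" using K A C by (simp add: Q_def)
  \<comment> \<open>\<open>n > 2 C\<close> makes the points of the layer at most half as far from the complement as \<open>x\<close>; \<open>n > 2 Q\<close> makes the absorbed coefficient \<open>Q n / n\<^sup>d\<close> at most \<open>1 / 2\<close>.\<close>
  obtain n :: nat where n: "max (2 * C) (2 * Q) < n"
    using reals_Archimedean2 by blast
  have n_pos: "0 < n" using n C by (intro gr0I) auto
  define M where "M = 2 * (K * n * C ^ (2 * ?d))"
  show thesis
  proof (rule that)
    show "M \<ge> 0" using K C by (simp add: M_def)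
    fix \<phi> :: "'a \<Rightarrow> real" and S
    assume cont: "continuous_on UNIV \<phi>" and S: "compact S" "S \<subseteq> \<Omega>" and supp: "\<And>x. x \<notin> S \<Longrightarrow> \<phi> x = 0"
    have [measurable]: "\<phi> \<in> borel_measurable borel" "?\<delta> \<in> borel_measurable borel" "\<Omega> \<in> sets borel"
      using cont op by (auto intro!: borel_measurable_continuous_onI continuous_intros)
    define H where "H = (\<integral>\<^sup>+x. ennreal (\<bar>\<phi> x\<bar> powr p / ?\<delta> x ^ ?d) * indicator \<Omega> x \<partial>lborel)"
    define E where "E = (\<integral>\<^sup>+x. \<integral>\<^sup>+y. ennreal (\<bar>\<phi> x - \<phi> y\<bar> powr p / dist x y ^ (2 * ?d))
            * (indicator \<Omega> x * indicator \<Omega> y) \<partial>lborel \<partial>lborel)"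
    let ?P = "\<lambda>x y. x \<in> \<Omega> \<and> y \<in> \<Omega> \<and> dist x y \<le> C * ?\<delta> x \<and> ?\<delta> y \<le> C * ?\<delta> x / n"
    let ?I = "\<lambda>x y. indicator {(x, y). ?P x y} (x, y) :: ennreal"
    have "{z \<in> space (borel \<Otimes>\<^sub>M borel). ?P (fst z) (snd z)} \<in> sets (borel \<Otimes>\<^sub>M borel)"
      by measurable
    then have [measurable]: "{(x, y). ?P x y} \<in> sets (borel \<Otimes>\<^sub>M borel)"
      by (simp add: space_pair_measure case_prod_beta')
    define F where "F x y = ennreal (K * n * \<bar>\<phi> y\<bar> powr p / ?\<delta> x ^ (2 * ?d)) * ?I x y" for x y
    define G where "G x y = ennreal (K * n * \<bar>\<phi> x - \<phi> y\<bar> powr p / ?\<delta> x ^ (2 * ?d)) * ?I x y" for x y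
    have [measurable]: "(\<lambda>(x, y). F x y) \<in> borel_measurable (borel \<Otimes>\<^sub>M borel)"
        "(\<lambda>(x, y). G x y) \<in> borel_measurable (borel \<Otimes>\<^sub>M borel)"
      unfolding F_def G_def by measurable
    have "H \<le> (\<integral>\<^sup>+x. \<integral>\<^sup>+y. F x y + G x y \<partial>lborel \<partial>lborel)"
      unfolding H_def
    proof (intro nn_integral_mono)
      fix x
      show "ennreal (\<bar>\<phi> x\<bar> powr p / ?\<delta> x ^ ?d) * indicator \<Omega> x \<le> (\<integral>\<^sup>+y. F x y + G x y \<partial>lborel)"
      proof (cases "x \<in> \<Omega>")
        case True
        let ?D = "boundary_layer \<Omega> C n x"
        \<comment> \<open>The constant whose integral over a set of the minimal measure \<open>c (\<delta> x)\<^sup>d / n\<close> is the integrand of \<open>H\<close>.\<close>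
        define a where "a = n / c * \<bar>\<phi> x\<bar> powr p / ?\<delta> x ^ (2 * ?d)"
        have a: "0 \<le> a" using c by (simp add: a_def infdist_nonneg)
        have "a * (c * ?\<delta> x ^ ?d / n) = \<bar>\<phi> x\<bar> powr p / ?\<delta> x ^ ?d"
          using c n_pos \<delta>_pos[OF True] by (simp add: a_def mult_2 power_add)
        then have "ennreal (\<bar>\<phi> x\<bar> powr p / ?\<delta> x ^ ?d) * indicator \<Omega> x = ennreal a * ennreal (c * ?\<delta> x ^ ?d / n)"
          using True a c by (simp add: ennreal_mult[symmetric] infdist_nonneg)
        also have "\<dots> \<le> ennreal a * emeasure lborel ?D"
          using thick[OF True n_pos] by (rule mult_left_mono) simp
        also have "\<dots> = (\<integral>\<^sup>+y. ennreal a * indicator ?D y \<partial>lborel)"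
          by (simp add: nn_integral_cmult_indicator boundary_layer_borel[OF op])
        also have "\<dots> \<le> (\<integral>\<^sup>+y. F x y + G x y \<partial>lborel)"
        proof (rule nn_integral_mono)
          fix y
          show "ennreal a * indicator ?D y \<le> F x y + G x y"
          proof (cases "y \<in> ?D")
            case y: True
            then have I: "?I x y = 1"
              using True by (simp add: boundary_layer_def)
            have "\<bar>\<phi> x\<bar> powr p \<le> (2 * max \<bar>\<phi> y\<bar> \<bar>\<phi> x - \<phi> y\<bar>) powr p"
              using p abs_triangle_ineq[of "\<phi> y" "\<phi> x - \<phi> y"] by (intro powr_mono2) (simp_all add: max_def)
            also have "\<dots> = 2 powr p * max \<bar>\<phi> y\<bar> \<bar>\<phi> x - \<phi> y\<bar> powr p"
              by (simp add: powr_mult)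
            also have "\<dots> \<le> 2 powr p * (\<bar>\<phi> y\<bar> powr p + \<bar>\<phi> x - \<phi> y\<bar> powr p)"
              by (intro mult_left_mono) (auto simp: max_def)
            finally have "a \<le> n / c * (2 powr p * (\<bar>\<phi> y\<bar> powr p + \<bar>\<phi> x - \<phi> y\<bar> powr p)) / ?\<delta> x ^ (2 * ?d)"
              unfolding a_def using c by (intro divide_right_mono mult_left_mono) (auto simp: infdist_nonneg)
            also have "\<dots> = K * n * \<bar>\<phi> y\<bar> powr p / ?\<delta> x ^ (2 * ?d) + K * n * \<bar>\<phi> x - \<phi> y\<bar> powr p / ?\<delta> x ^ (2 * ?d)"
              by (simp add: K_def distrib_left add_divide_distrib mult_ac)
            finally have "ennreal a \<le> ennreal (K * n * \<bar>\<phi> y\<bar> powr p / ?\<delta> x ^ (2 * ?d))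
                + ennreal (K * n * \<bar>\<phi> x - \<phi> y\<bar> powr p / ?\<delta> x ^ (2 * ?d))"
              using K by (subst ennreal_plus[symmetric]) (simp_all add: infdist_nonneg ennreal_leI del: ennreal_plus)
            then show ?thesis
              using y by (simp only: F_def G_def I mult_1_right indicator_simps)
          qed simp
        qed
        finally show ?thesis .
      qed simp
    qed
    also have "\<dots> = (\<integral>\<^sup>+x. \<integral>\<^sup>+y. F x y \<partial>lborel \<partial>lborel) + (\<integral>\<^sup>+x. \<integral>\<^sup>+y. G x y \<partial>lborel \<partial>lborel)"
      by (simp add: nn_integral_add)
    also have "(\<integral>\<^sup>+x. \<integral>\<^sup>+y. G x y \<partial>lborel \<partial>lborel) \<le> ennreal (K * n * C ^ (2 * ?d)) * E"
    proof -
      have "G x y \<le> ennreal (K * n * C ^ (2 * ?d)) * (ennreal (\<bar>\<phi> x - \<phi> y\<bar> powr p / dist x y ^ (2 * ?d))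
            * (indicator \<Omega> x * indicator \<Omega> y))" for x y
      proof (cases "?P x y \<and> x \<noteq> y")
        case True
        then have \<delta>: "0 < ?\<delta> x" and xy: "0 < dist x y"
          using \<delta>_pos by auto
        have "dist x y ^ (2 * ?d) \<le> (C * ?\<delta> x) ^ (2 * ?d)"
          using True by (intro power_mono) auto
        then have "1 / ?\<delta> x ^ (2 * ?d) \<le> C ^ (2 * ?d) / dist x y ^ (2 * ?d)"
          using \<delta> xy by (simp add: divide_simps power_mult_distrib mult.commute)
        then have "K * n * \<bar>\<phi> x - \<phi> y\<bar> powr p * (1 / ?\<delta> x ^ (2 * ?d))
            \<le> K * n * \<bar>\<phi> x - \<phi> y\<bar> powr p * (C ^ (2 * ?d) / dist x y ^ (2 * ?d))"
          using K by (intro mult_left_mono) auto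
        then have "ennreal (K * n * \<bar>\<phi> x - \<phi> y\<bar> powr p / ?\<delta> x ^ (2 * ?d))
            \<le> ennreal (K * n * C ^ (2 * ?d) * (\<bar>\<phi> x - \<phi> y\<bar> powr p / dist x y ^ (2 * ?d)))"
          by (intro ennreal_leI) (simp add: mult_ac)
        also have "\<dots> = ennreal (K * n * C ^ (2 * ?d)) * ennreal (\<bar>\<phi> x - \<phi> y\<bar> powr p / dist x y ^ (2 * ?d))"
          using K C by (intro ennreal_mult) auto
        finally show ?thesis
          using True by (simp add: G_def)
      next
        case False
        then have "G x y = 0"
          by (auto simp: G_def)
        then show ?thesis by simp
      qed
      then have "(\<integral>\<^sup>+x. \<integral>\<^sup>+y. G x y \<partial>lborel \<partial>lborel) \<le>
          (\<integral>\<^sup>+x. \<integral>\<^sup>+y. ennreal (K * n * C ^ (2 * ?d)) * (ennreal (\<bar>\<phi> x - \<phi> y\<bar> powr p / dist x y ^ (2 * ?d))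
            * (indicator \<Omega> x * indicator \<Omega> y)) \<partial>lborel \<partial>lborel)"
        by (intro nn_integral_mono)
      also have "\<dots> = ennreal (K * n * C ^ (2 * ?d)) * E"
        unfolding E_def by (simp add: nn_integral_cmult)
      finally show ?thesis .
    qed
    also have "(\<integral>\<^sup>+x. \<integral>\<^sup>+y. F x y \<partial>lborel \<partial>lborel) = (\<integral>\<^sup>+y. \<integral>\<^sup>+x. F x y \<partial>lborel \<partial>lborel)"
      by (rule lborel_pair.Fubini'[symmetric]) simp
    also have "\<dots> \<le> (\<integral>\<^sup>+y. ennreal (1/2) * (ennreal (\<bar>\<phi> y\<bar> powr p / ?\<delta> y ^ ?d) * indicator \<Omega> y) \<partial>lborel)"
    proof (rule nn_integral_mono)
      fix y
      show "(\<integral>\<^sup>+x. F x y \<partial>lborel) \<le> ennreal (1/2) * (ennreal (\<bar>\<phi> y\<bar> powr p / ?\<delta> y ^ ?d) * indicator \<Omega> y)"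
      proof (cases "y \<in> \<Omega>")
        case True
        \<comment> \<open>Every \<open>x\<close> whose layer contains \<open>y\<close> has at least this distance from \<open>y\<close>.\<close>
        define R where "R = n * ?\<delta> y / (2 * C)"
        have R: "R > 0"
          using True \<delta>_pos n_pos C by (simp add: R_def)
        define b where "b = K * n * \<bar>\<phi> y\<bar> powr p * C ^ (2 * ?d)"
        have b: "b \<ge> 0" using K C by (simp add: b_def)
        have "F x y \<le> ennreal b * (ennreal (1 / dist x y ^ (2 * ?d)) * indicator {x. R \<le> dist x y} x)" for x
        proof (cases "?P x y")
          case P: True
          have \<delta>: "0 < ?\<delta> x" using P \<delta>_pos by auto
          have "n * ?\<delta> y \<le> C * ?\<delta> x"
            using P n_pos by (simp add: field_simps)
          have "?\<delta> x \<le> ?\<delta> y + dist x y"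
            by (rule infdist_triangle)
          moreover have "?\<delta> y \<le> ?\<delta> x / 2"
          proof -
            have "C * ?\<delta> x / n \<le> ?\<delta> x / 2"
              using n n_pos \<delta> by (simp add: field_simps)
            then show ?thesis using P by linarith
          qed
          ultimately have "?\<delta> x / 2 \<le> dist x y"
            by linarith
          moreover have "R \<le> ?\<delta> x / 2"
            using \<open>n * ?\<delta> y \<le> C * ?\<delta> x\<close> C by (simp add: R_def field_simps)
          ultimately have Rx: "R \<le> dist x y" by linarith
          then have xy: "0 < dist x y" using R by linarith
          have "dist x y ^ (2 * ?d) \<le> (C * ?\<delta> x) ^ (2 * ?d)"
            using P by (intro power_mono) auto
          then have "1 / ?\<delta> x ^ (2 * ?d) \<le> C ^ (2 * ?d) / dist x y ^ (2 * ?d)"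
            using \<delta> xy by (simp add: divide_simps power_mult_distrib mult.commute)
          then have "K * n * \<bar>\<phi> y\<bar> powr p * (1 / ?\<delta> x ^ (2 * ?d))
              \<le> K * n * \<bar>\<phi> y\<bar> powr p * (C ^ (2 * ?d) / dist x y ^ (2 * ?d))"
            using K by (intro mult_left_mono) auto
          then have "ennreal (K * n * \<bar>\<phi> y\<bar> powr p / ?\<delta> x ^ (2 * ?d)) \<le> ennreal (b * (1 / dist x y ^ (2 * ?d)))"
            by (intro ennreal_leI) (simp add: b_def mult_ac)
          also have "\<dots> = ennreal b * ennreal (1 / dist x y ^ (2 * ?d))"
            using b by (intro ennreal_mult) auto
          finally show ?thesis
            using P Rx by (simp add: F_def)
        next
          case False
          then have "F x y = 0" by (simp add: F_def)
          then show ?thesis by simp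
        qed
        then have "(\<integral>\<^sup>+x. F x y \<partial>lborel) \<le>
            (\<integral>\<^sup>+x. ennreal b * (ennreal (1 / dist x y ^ (2 * ?d)) * indicator {x. R \<le> dist x y} x) \<partial>lborel)"
          by (intro nn_integral_mono)
        also have "\<dots> = ennreal b * (\<integral>\<^sup>+x. (ennreal (1 / dist x y ^ (2 * ?d)) * indicator {x. R \<le> dist x y} x) \<partial>lborel)"
          by (rule nn_integral_cmult) simp
        also have "\<dots> \<le> ennreal b * ennreal (A / R ^ ?d)"
          by (intro mult_left_mono A R) simp
        also have "\<dots> = ennreal (b * (A / R ^ ?d))"
          using b A R by (intro ennreal_mult[symmetric]) auto
        also have "b * (A / R ^ ?d) \<le> 1/2 * (\<bar>\<phi> y\<bar> powr p / ?\<delta> y ^ ?d)"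
        proof -
          have "b * (A / R ^ ?d) = Q * (n / n ^ ?d) * (\<bar>\<phi> y\<bar> powr p / ?\<delta> y ^ ?d)"
            by (simp add: b_def Q_def R_def power_divide power_mult_distrib)
          also have "\<dots> \<le> 1/2 * (\<bar>\<phi> y\<bar> powr p / ?\<delta> y ^ ?d)"
          proof (rule mult_right_mono)
            have "real n ^ 2 \<le> real n ^ ?d"
              using n_pos dim by (intro power_increasing) auto
            then have "n / real n ^ ?d \<le> n / real n ^ 2"
              using n_pos by (intro divide_left_mono) auto
            also have "\<dots> = 1 / n"
              using n_pos by (simp add: power2_eq_square)
            finally have "Q * (n / n ^ ?d) \<le> Q * (1 / n)"
              using Q by (intro mult_left_mono) auto
            also have "\<dots> \<le> 1 / 2"
              using n n_pos by (simp add: field_simps)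
            finally show "Q * (n / n ^ ?d) \<le> 1 / 2" by simp
          qed (simp add: infdist_nonneg)
          finally show ?thesis .
        qed
        finally have "(\<integral>\<^sup>+x. F x y \<partial>lborel) \<le> ennreal (1/2 * (\<bar>\<phi> y\<bar> powr p / ?\<delta> y ^ ?d))"
          by (simp add: ennreal_leI)
        also have "\<dots> = ennreal (1/2) * ennreal (\<bar>\<phi> y\<bar> powr p / ?\<delta> y ^ ?d)"
          by (intro ennreal_mult) (auto simp: infdist_nonneg)
        finally show ?thesis
          using True by simp
      next
        case False
        then show ?thesis by (simp add: F_def)
      qed
    qed
    also have "\<dots> = ennreal (1/2) * H"
      unfolding H_def by (rule nn_integral_cmult) measurable
    finally have main: "H \<le> ennreal (1/2) * H + ennreal (K * n * C ^ (2 * ?d)) * E"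
      by (simp add: add_mono)
    have H_fin: "H < \<infinity>"
    proof -
      have "continuous_on S (\<lambda>x. \<bar>\<phi> x\<bar> powr p / ?\<delta> x ^ ?d)"
        using S(2) \<delta>_pos p
        by (intro continuous_intros continuous_on_powr' continuous_on_subset[OF cont]) (auto simp: less_imp_neq[symmetric] dest: \<delta>_pos subsetD)
      then have "bounded ((\<lambda>x. \<bar>\<phi> x\<bar> powr p / ?\<delta> x ^ ?d) ` S)"
        using S(1) compact_continuous_image compact_imp_bounded by blast
      then obtain B where B: "\<And>x. x \<in> S \<Longrightarrow> \<bar>\<phi> x\<bar> powr p / ?\<delta> x ^ ?d \<le> B"
        unfolding bounded_iff by (force simp: infdist_nonneg)
      have "H \<le> (\<integral>\<^sup>+x. ennreal B * indicator S x \<partial>lborel)"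
        unfolding H_def
      proof (rule nn_integral_mono)
        fix x
        show "ennreal (\<bar>\<phi> x\<bar> powr p / ?\<delta> x ^ ?d) * indicator \<Omega> x \<le> ennreal B * indicator S x"
          using B[of x] supp[of x] S(2) by (cases "x \<in> S") (auto simp: indicator_def intro: ennreal_leI)
      qed
      also have "\<dots> = ennreal B * emeasure lborel S"
        using S(1) by (intro nn_integral_cmult_indicator) (auto intro: borel_compact)
      also have "\<dots> < \<infinity>"
        using emeasure_compact_finite[OF S(1)] by (simp add: ennreal_mult_less_top)
      finally show ?thesis .
    qed
    show "H \<le> ennreal M * E" 
    proof (cases "E = \<infinity>")
      case True
      then show ?thesis
        using K n_pos C by (simp add: M_def ennreal_mult_top)
    next
      case False
      obtain h where h: "H = ennreal h" "0 \<le> h"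
        using H_fin by (cases H) auto
      obtain e where e: "E = ennreal e" "0 \<le> e"
        using False by (cases E) auto
      let ?m = "K * n * C ^ (2 * ?d)"
      have m: "0 \<le> ?m" using K C by simp
      have "ennreal (1/2 * h + ?m * e) = ennreal (1/2 * h) + ennreal (?m * e)"
        using h e m by (intro ennreal_plus) auto
      also have "\<dots> = ennreal (1/2) * ennreal h + ennreal ?m * ennreal e"
        using h e m by (intro arg_cong2[where f="(+)"] ennreal_mult) auto
      finally have "ennreal h \<le> ennreal (1/2 * h + ?m * e)"
        using main h e by simp
      then have "h \<le> 1/2 * h + ?m * e"
        using h e m by (subst (asm) ennreal_le_iff) auto
      then have "h \<le> M * e"
        by (simp add: M_def)
      then show ?thesis
        using h e m by (simp add: ennreal_mult[symmetric] M_def ennreal_leI)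
    qed
  qed
qed

section \<open>Energies of power type\<close>

definition power_energy :: "real \<Rightarrow> 'a measure \<Rightarrow> ('a \<Rightarrow> real) \<Rightarrow> ennreal" where
  "power_energy p M f = (\<integral>\<^sup>+x. ennreal (\<bar>f x\<bar> powr p) \<partial>M)"

text \<open>Convexity of the power at \<open>\<bar>a\<bar> + \<bar>b\<bar> = l (\<bar>a\<bar> / l) + (1 - l) (\<bar>b\<bar> / (1 - l))\<close>. Keeping the weight \<open>l\<close>
  free is what allows to deduce the triangle inequality by optimising over \<open>l\<close>. If one argument is zero, the
  claim reduces to the coefficients being at least \<open>1\<close>.\<close>

lemma powr_abs_add_le:
  fixes a b l p :: real
  assumes p: "1 \<le> p" and l: "0 < l" "l < 1"
  shows "\<bar>a + b\<bar> powr p \<le> l powr (1 - p) * \<bar>a\<bar> powr p + (1 - l) powr (1 - p) * \<bar>b\<bar> powr p"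
proof -
  have scale: "t * (\<bar>c\<bar> / t) powr p = t powr (1 - p) * \<bar>c\<bar> powr p" if "0 < t" for t c :: real
    using that by (simp add: powr_divide powr_diff)
  have zero: "\<bar>c\<bar> powr p \<le> t powr (1 - p) * \<bar>c\<bar> powr p" if "0 < t" "t < 1" for t c :: real
  proof -
    have "t powr 0 \<le> t powr (1 - p)"
      using that p by (intro powr_mono') auto
    then have "1 \<le> t powr (1 - p)"
      using that by simp
    then show ?thesis
      by (simp add: mult_le_cancel_right1)
  qed
  consider "a = 0" | "b = 0" | "a \<noteq> 0" "b \<noteq> 0" by blast
  then show ?thesis
  proof cases
    case 1
    then show ?thesis using zero[of "1 - l" b] l by simp
  next
    case 2
    then show ?thesis using zero[of l a] l by simp
  next
    case 3
    have "\<bar>a + b\<bar> powr p \<le> (\<bar>a\<bar> + \<bar>b\<bar>) powr p"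
      using p by (intro powr_mono2) auto
    also have "\<bar>a\<bar> + \<bar>b\<bar> = (1 - l) *\<^sub>R (\<bar>b\<bar> / (1 - l)) + l *\<^sub>R (\<bar>a\<bar> / l)"
      using l by simp
    also have "\<dots> powr p \<le> (1 - l) * (\<bar>b\<bar> / (1 - l)) powr p + l * (\<bar>a\<bar> / l) powr p"
      using convex_onD[OF powr_convex[OF p], of l "\<bar>b\<bar> / (1 - l)" "\<bar>a\<bar> / l"] l 3 by simp
    also have "\<dots> = l powr (1 - p) * \<bar>a\<bar> powr p + (1 - l) powr (1 - p) * \<bar>b\<bar> powr p"
      using scale[of l a] scale[of "1 - l" b] l by simp
    finally show ?thesis .
  qed
qed

lemma power_energy_add_le:
  assumes "1 \<le> p" "0 < l" "l < 1"
    and [measurable]: "f \<in> borel_measurable M" "g \<in> borel_measurable M"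
  shows "power_energy p M (\<lambda>x. f x + g x)
    \<le> ennreal (l powr (1 - p)) * power_energy p M f + ennreal ((1 - l) powr (1 - p)) * power_energy p M g"
proof -
  have "power_energy p M (\<lambda>x. f x + g x)
      \<le> (\<integral>\<^sup>+x. ennreal (l powr (1 - p)) * ennreal (\<bar>f x\<bar> powr p)
            + ennreal ((1 - l) powr (1 - p)) * ennreal (\<bar>g x\<bar> powr p) \<partial>M)"
    unfolding power_energy_def
    by (intro nn_integral_mono)
      (simp add: ennreal_mult[symmetric] ennreal_plus[symmetric] powr_abs_add_le assms(1-3) ennreal_leI del: ennreal_plus)
  also have "\<dots> = ennreal (l powr (1 - p)) * power_energy p M f + ennreal ((1 - l) powr (1 - p)) * power_energy p M g"
    unfolding power_energy_def by (simp add: nn_integral_add nn_integral_cmult)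
  finally show ?thesis .
qed

lemma power_energy_scale:
  assumes [measurable]: "f \<in> borel_measurable M"
  shows "power_energy p M (\<lambda>x. c * f x) = ennreal (\<bar>c\<bar> powr p) * power_energy p M f"
  unfolding power_energy_def by (simp add: abs_mult powr_mult ennreal_mult nn_integral_cmult)

lemma power_energy_cong_AE:
  assumes "AE x in M. f x = g x"
  shows "power_energy p M f = power_energy p M g"
  unfolding power_energy_def using assms by (intro nn_integral_cong_AE) auto

lemma power_energy_eq_0_iff:
  assumes [measurable]: "f \<in> borel_measurable M"
  shows "power_energy p M f = 0 \<longleftrightarrow> (AE x in M. f x = 0)"
  unfolding power_energy_def by (subst nn_integral_0_iff_AE) auto

lemma power_energy_Fatou:
  assumes p: "0 < p" and meas: "\<And>k. f k \<in> borel_measurable M"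
    and lim: "AE x in M. (\<lambda>k. f k x) \<longlonglongrightarrow> g x"
    and bound: "\<And>k. power_energy p M (f k) \<le> B"
  shows "power_energy p M g \<le> B"
proof -
  note [measurable] = meas
  have "power_energy p M g \<le> (\<integral>\<^sup>+x. liminf (\<lambda>k. ennreal (\<bar>f k x\<bar> powr p)) \<partial>M)"
    unfolding power_energy_def
  proof (intro nn_integral_mono_AE, use lim in eventually_elim)
    case (elim x)
    then have "(\<lambda>k. \<bar>f k x\<bar> powr p) \<longlonglongrightarrow> \<bar>g x\<bar> powr p"
      using p by (intro tendsto_powr' tendsto_rabs tendsto_const) auto
    then have "(\<lambda>k. ennreal (\<bar>f k x\<bar> powr p)) \<longlonglongrightarrow> ennreal (\<bar>g x\<bar> powr p)"
      by (rule tendsto_ennrealI)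
    then have "liminf (\<lambda>k. ennreal (\<bar>f k x\<bar> powr p)) = ennreal (\<bar>g x\<bar> powr p)"
      by (intro lim_imp_Liminf) auto
    then show ?case by simp
  qed
  also have "\<dots> \<le> liminf (\<lambda>k. power_energy p M (f k))"
    unfolding power_energy_def by (rule nn_integral_liminf) measurable
  also have "\<dots> \<le> liminf (\<lambda>k. B)"
    using bound by (intro Liminf_mono) auto
  finally show ?thesis
    by (simp add: Liminf_const)
qed

text \<open>The integrals of \<open>\<bar>2\<^sup>k f k\<bar>\<^sup>p\<close> are summable, so almost everywhere the terms
  themselves are summable and in particular eventually at most \<open>1\<close>.\<close>

lemma power_energy_fast_decay_AE:
  assumes p: "0 < p" and meas: "\<And>k. f k \<in> borel_measurable M"
    and bound: "\<And>k::nat. power_energy p M (f k) \<le> ennreal (((1/4)^k) powr p)"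
  shows "AE x in M. \<forall>\<^sub>F k in sequentially. \<bar>f k x\<bar> \<le> (1/2)^k"
proof -
  note [measurable] = meas
  define \<theta> :: real where "\<theta> = (1/2) powr p"
  have th: "0 < \<theta>" "\<theta> < 1"
    using p powr_less_mono'[of "1/2" 0 p] by (auto simp: \<theta>_def)
  have "(\<integral>\<^sup>+x. (\<Sum>k. ennreal (\<bar>2^k * f k x\<bar> powr p)) \<partial>M) = (\<Sum>k. \<integral>\<^sup>+x. ennreal (\<bar>2^k * f k x\<bar> powr p) \<partial>M)"
    by (intro nn_integral_suminf) measurable
  also have "\<dots> \<le> (\<Sum>k. ennreal (\<theta> ^ k))"
  proof (intro suminf_le summableI)
    fix k :: nat
    have "(\<integral>\<^sup>+x. ennreal (\<bar>2^k * f k x\<bar> powr p) \<partial>M) = ennreal ((2^k) powr p) * power_energy p M (f k)"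
      using power_energy_scale[OF meas, of p "2^k" k] by (simp add: power_energy_def)
    also have "\<dots> \<le> ennreal ((2^k) powr p) * ennreal (((1/4)^k) powr p)"
      by (intro mult_left_mono bound) simp
    also have "\<dots> = ennreal ((2^k * (1/4)^k) powr p)"
      by (simp add: ennreal_mult powr_mult)
    also have "2^k * (1/4::real)^k = (1/2)^k"
      by (simp add: power_mult_distrib[symmetric])
    also have "((1/2::real)^k) powr p = \<theta> ^ k"
      by (simp add: \<theta>_def powr_realpow[symmetric] powr_powr mult.commute)
    finally show "(\<integral>\<^sup>+x. ennreal (\<bar>2^k * f k x\<bar> powr p) \<partial>M) \<le> ennreal (\<theta> ^ k)" .
  qed
  also have "\<dots> = ennreal (\<Sum>k. \<theta> ^ k)"
    using th by (intro suminf_ennreal2) (auto intro: summable_geometric)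
  finally have "(\<integral>\<^sup>+x. (\<Sum>k. ennreal (\<bar>2^k * f k x\<bar> powr p)) \<partial>M) \<noteq> \<infinity>"
    by (auto simp: top_unique)
  then have "AE x in M. (\<Sum>k. ennreal (\<bar>2^k * f k x\<bar> powr p)) \<noteq> \<infinity>"
    by (intro nn_integral_PInf_AE) measurable
  then show ?thesis
  proof eventually_elim
    case (elim x)
    then have "summable (\<lambda>k. \<bar>2^k * f k x\<bar> powr p)"
      by (intro summable_suminf_not_top) auto
    then have "(\<lambda>k. \<bar>2^k * f k x\<bar> powr p) \<longlonglongrightarrow> 0"
      by (rule summable_LIMSEQ_zero)
    then have "\<forall>\<^sub>F k in sequentially. \<bar>2^k * f k x\<bar> powr p < 1"
      by (rule order_tendstoD) simp
    then show ?case
    proof eventually_elim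
      case (elim k)
      have "\<bar>2^k * f k x\<bar> \<le> 1"
      proof (rule ccontr)
        assume "\<not> \<bar>2^k * f k x\<bar> \<le> 1"
        then have "1 \<le> \<bar>2^k * f k x\<bar> powr p"
          using p by (intro ge_one_powr_ge_zero) auto
        with elim show False by simp
      qed
      then show ?case
        by (simp add: abs_mult power_one_over field_simps)
    qed
  qed
qed

lemma sigma_finite_lebesgue: "sigma_finite_measure lebesgue"
proof
  obtain A :: "'a set set" where "countable A" "A \<subseteq> sets lborel" "\<Union>A = space lborel" "\<forall>a\<in>A. emeasure lborel a \<noteq> \<infinity>"
    using lborel.sigma_finite_countable by blast
  then show "\<exists>A::'a set set. countable A \<and> A \<subseteq> sets lebesgue \<and> \<Union>A = space lebesgue \<and> (\<forall>a\<in>A. emeasure lebesgue a \<noteq> \<infinity>)"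
    by (intro exI[of _ A]) (auto simp: emeasure_completion main_part_sets)
qed

lemma sigma_finite_lebesgue_on: "U \<in> sets lebesgue \<Longrightarrow> sigma_finite_measure (lebesgue_on U)"
  by (intro sigma_finite_measure_restrict_space sigma_finite_lebesgue)

lemma id_measurable_lebesgue_on: "(\<lambda>x. x) \<in> measurable (lebesgue_on U) borel"
  by (intro measurable_restrict_space1 measurable_completion) simp

lemma AE_pair_fst:
  assumes "sigma_finite_measure N" "AE x in M. P x"
  shows "AE z in M \<Otimes>\<^sub>M N. P (fst z)"
proof -
  interpret sigma_finite_measure N by fact
  obtain S where S: "{x \<in> space M. \<not> P x} \<subseteq> S" "emeasure M S = 0" "S \<in> sets M"
    using assms(2) by (rule AE_E)
  have "S \<times> space N \<in> null_sets (M \<Otimes>\<^sub>M N)"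
    using S by (intro null_setsI) (auto simp: emeasure_pair_measure_Times)
  then show ?thesis
    by (rule AE_I') (use S in \<open>auto simp: space_pair_measure\<close>)
qed

lemma AE_pair_snd:
  assumes "sigma_finite_measure N" "AE x in N. P x"
  shows "AE z in M \<Otimes>\<^sub>M N. P (snd z)"
proof -
  interpret sigma_finite_measure N by fact
  obtain S where S: "{x \<in> space N. \<not> P x} \<subseteq> S" "emeasure N S = 0" "S \<in> sets N"
    using assms(2) by (rule AE_E)
  have "space M \<times> S \<in> null_sets (M \<Otimes>\<^sub>M N)"
    using S by (intro null_setsI) (auto simp: emeasure_pair_measure_Times)
  then show ?thesis
    by (rule AE_I') (use S in \<open>auto simp: space_pair_measure\<close>)
qed

text \<open>The exponent is chosen so that the \<open>p\<close>-th power of this function is the integrand of the Gagliardo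
  energy, which becomes a power energy on the product space.\<close>

definition difference_quotient :: "real \<Rightarrow> real \<Rightarrow> (real ^ 'd \<Rightarrow> real) \<Rightarrow> (real ^ 'd) \<times> (real ^ 'd) \<Rightarrow> real" where
  "difference_quotient s p u = (\<lambda>(x, y). (u x - u y) / norm (x - y) powr ((real CARD('d) + s * p) / p))"

lemma difference_quotient_measurable [measurable]:
  fixes u :: "real ^ 'd \<Rightarrow> real"
  assumes u [measurable]: "u \<in> borel_measurable (lebesgue_on U)"
  shows "difference_quotient s p u \<in> borel_measurable (lebesgue_on U \<Otimes>\<^sub>M lebesgue_on U)"
proof -
  have 1 [measurable]: "fst \<in> measurable (lebesgue_on U \<Otimes>\<^sub>M lebesgue_on U) (borel :: (real^'d) measure)"
      "snd \<in> measurable (lebesgue_on U \<Otimes>\<^sub>M lebesgue_on U) (borel :: (real^'d) measure)"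
    by (rule measurable_compose[OF measurable_fst id_measurable_lebesgue_on]
      measurable_compose[OF measurable_snd id_measurable_lebesgue_on])+
  have [measurable]: "(\<lambda>z. u (fst z)) \<in> borel_measurable (lebesgue_on U \<Otimes>\<^sub>M lebesgue_on U)"
     "(\<lambda>z. u (snd z)) \<in> borel_measurable (lebesgue_on U \<Otimes>\<^sub>M lebesgue_on U)"
    using measurable_compose[OF measurable_fst u] measurable_compose[OF measurable_snd u] by simp_all
  show ?thesis
    unfolding difference_quotient_def case_prod_beta by measurable
qed

lemma gagliardo_energy_eq_power_energy:
  assumes U: "U \<in> sets lebesgue" and p: "0 < p" and [measurable]: "u \<in> borel_measurable (lebesgue_on U)"
  shows "gagliardo_energy s p U u = power_energy p (lebesgue_on U \<Otimes>\<^sub>M lebesgue_on U) (difference_quotient s p u)"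
proof -
  interpret sigma_finite_measure "lebesgue_on U" by (rule sigma_finite_lebesgue_on[OF U])
  interpret pair_sigma_finite "lebesgue_on U" "lebesgue_on U" ..
  have "power_energy p (lebesgue_on U \<Otimes>\<^sub>M lebesgue_on U) (difference_quotient s p u) =
    (\<integral>\<^sup>+y. \<integral>\<^sup>+x. ennreal (\<bar>difference_quotient s p u (x, y)\<bar> powr p) \<partial>lebesgue_on U \<partial>lebesgue_on U)"
    unfolding power_energy_def by (rule nn_integral_snd[symmetric]) measurable
  also have "\<dots> = gagliardo_energy s p U u"
    unfolding gagliardo_energy_def difference_quotient_def using p
    by (simp add: abs_divide powr_divide powr_powr)
  finally show ?thesis ..
qed

lemma Lp_energy_eq_power_energy: "Lp_energy p U u = power_energy p (lebesgue_on U) u"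
  by (simp add: Lp_energy_def power_energy_def)

section \<open>The fractional Sobolev space as a complete normed space\<close>

definition total_energy :: "real \<Rightarrow> real \<Rightarrow> (real ^ 'd) set \<Rightarrow> (real ^ 'd \<Rightarrow> real) \<Rightarrow> ennreal" where
  "total_energy s p U u = gagliardo_energy s p U u + Lp_energy p U u"

lemma sobolev_norm_eq: "sobolev_norm s p U u = enn2real (total_energy s p U u) powr (1 / p)"
  by (simp add: sobolev_norm_def total_energy_def)

lemma sobolev_iff: "u \<in> sobolev s p U \<longleftrightarrow> u \<in> borel_measurable (lebesgue_on U) \<and> total_energy s p U u < \<infinity>"
  by (auto simp: sobolev_def total_energy_def)

lemma sobolev_norm_nonneg [simp]: "0 \<le> sobolev_norm s p U u"
  by (simp add: sobolev_norm_def)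

text \<open>Finiteness is essential, because the norm of a function of infinite energy is \<open>0\<close> by the
  convention for \<open>enn2real\<close>. Norm estimates are obtained through this equivalence, so that the
  arithmetic takes place with energies.\<close>

lemma sobolev_norm_le_iff:
  assumes p: "0 < p" and fin: "total_energy s p U u < \<infinity>" and A: "0 \<le> A"
  shows "sobolev_norm s p U u \<le> A \<longleftrightarrow> total_energy s p U u \<le> ennreal (A powr p)"
proof -
  obtain w where w: "total_energy s p U u = ennreal w" "0 \<le> w"
    using fin by (cases "total_energy s p U u") auto
  have "w powr (1 / p) \<le> A \<longleftrightarrow> w \<le> A powr p"
  proof
    assume "w powr (1 / p) \<le> A"
    then have "(w powr (1 / p)) powr p \<le> A powr p"
      using p by (intro powr_mono2) auto
    then show "w \<le> A powr p"
      using p w by (simp add: powr_powr)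
  next
    assume "w \<le> A powr p"
    then have "w powr (1 / p) \<le> (A powr p) powr (1 / p)"
      using p w by (intro powr_mono2) auto
    then show "w powr (1 / p) \<le> A"
      using p A by (simp add: powr_powr)
  qed
  then show ?thesis
    using w by (simp add: sobolev_norm_eq)
qed

lemma difference_quotient_add:
  "difference_quotient s p (\<lambda>x. u x + v x) = (\<lambda>z. difference_quotient s p u z + difference_quotient s p v z)"
  by (auto simp: difference_quotient_def fun_eq_iff add_divide_distrib[symmetric] algebra_simps)

lemma difference_quotient_scale:
  "difference_quotient s p (\<lambda>x. c * u x) = (\<lambda>z. c * difference_quotient s p u z)"
  by (auto simp: difference_quotient_def fun_eq_iff right_diff_distrib[symmetric])

context
  fixes U :: "(real ^ 'd) set" and s p :: real
  assumes U: "U \<in> sets lebesgue" and p: "1 \<le> p"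
begin

lemma p_pos: "0 < p"
  using p by simp

lemma total_energy_eq:
  assumes "u \<in> borel_measurable (lebesgue_on U)"
  shows "total_energy s p U u = power_energy p (lebesgue_on U \<Otimes>\<^sub>M lebesgue_on U) (difference_quotient s p u)
     + power_energy p (lebesgue_on U) u"
  unfolding total_energy_def
  by (simp add: gagliardo_energy_eq_power_energy[OF U p_pos assms] Lp_energy_eq_power_energy)

lemma gagliardo_energy_add_le:
  assumes l: "0 < l" "l < 1"
    and [measurable]: "u \<in> borel_measurable (lebesgue_on U)" "v \<in> borel_measurable (lebesgue_on U)"
  shows "gagliardo_energy s p U (\<lambda>x. u x + v x) \<le>
     ennreal (l powr (1 - p)) * gagliardo_energy s p U u + ennreal ((1 - l) powr (1 - p)) * gagliardo_energy s p U v"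
  using power_energy_add_le[OF p l, of "difference_quotient s p u" "lebesgue_on U \<Otimes>\<^sub>M lebesgue_on U" "difference_quotient s p v"]
  by (simp add: gagliardo_energy_eq_power_energy[OF U p_pos] difference_quotient_add)

lemma total_energy_add_le:
  assumes l: "0 < l" "l < 1"
    and [measurable]: "u \<in> borel_measurable (lebesgue_on U)" "v \<in> borel_measurable (lebesgue_on U)"
  shows "total_energy s p U (\<lambda>x. u x + v x) \<le>
     ennreal (l powr (1 - p)) * total_energy s p U u + ennreal ((1 - l) powr (1 - p)) * total_energy s p U v"
proof -
  have "total_energy s p U (\<lambda>x. u x + v x) \<le>
     (ennreal (l powr (1 - p)) * gagliardo_energy s p U u + ennreal ((1 - l) powr (1 - p)) * gagliardo_energy s p U v)
   + (ennreal (l powr (1 - p)) * Lp_energy p U u + ennreal ((1 - l) powr (1 - p)) * Lp_energy p U v)"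
    unfolding total_energy_def Lp_energy_eq_power_energy
    by (intro add_mono gagliardo_energy_add_le power_energy_add_le l p) measurable
  also have "\<dots> = ennreal (l powr (1 - p)) * total_energy s p U u + ennreal ((1 - l) powr (1 - p)) * total_energy s p U v"
    by (simp add: total_energy_def distrib_left add_ac)
  finally show ?thesis .
qed

text \<open>The optimal weight in the convexity estimate is \<open>l = A / (A + B)\<close>.\<close>

lemma total_energy_triangle:
  assumes A: "0 < A" "total_energy s p U u \<le> ennreal (A powr p)" and B: "0 < B" "total_energy s p U v \<le> ennreal (B powr p)"
    and meas: "u \<in> borel_measurable (lebesgue_on U)" "v \<in> borel_measurable (lebesgue_on U)"
  shows "total_energy s p U (\<lambda>x. u x + v x) \<le> ennreal ((A + B) powr p)"
proof -
  define l where "l = A / (A + B)"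
  have l: "0 < l" "l < 1" "1 - l = B / (A + B)"
    using A B by (auto simp: l_def field_simps)
  have scale: "(D / (A + B)) powr (1 - p) * D powr p = (A + B) powr (p - 1) * D" if "0 < D" for D
    using that A B by (simp add: powr_divide powr_diff)
  have "total_energy s p U (\<lambda>x. u x + v x) \<le>
      ennreal (l powr (1 - p)) * ennreal (A powr p) + ennreal ((1 - l) powr (1 - p)) * ennreal (B powr p)"
    by (rule order_trans[OF total_energy_add_le[OF l(1,2) meas]]) (intro add_mono mult_left_mono A B; simp)
  also have "\<dots> = ennreal (l powr (1 - p) * A powr p) + ennreal ((1 - l) powr (1 - p) * B powr p)"
    by (simp add: ennreal_mult)
  also have "\<dots> = ennreal (l powr (1 - p) * A powr p + (1 - l) powr (1 - p) * B powr p)"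
    by (intro ennreal_plus[symmetric]) auto
  also have "l powr (1 - p) * A powr p + (1 - l) powr (1 - p) * B powr p = (A + B) powr (p - 1) * (A + B)"
    unfolding l(3) using scale[OF A(1)] scale[OF B(1)] by (simp add: l_def distrib_left)
  also have "\<dots> = (A + B) powr p"
    using A B by (simp add: powr_diff)
  finally show ?thesis .
qed

lemma total_energy_scale:
  assumes [measurable]: "u \<in> borel_measurable (lebesgue_on U)"
  shows "total_energy s p U (\<lambda>x. c * u x) = ennreal (\<bar>c\<bar> powr p) * total_energy s p U u"
  by (simp add: total_energy_eq difference_quotient_scale power_energy_scale distrib_left)

lemma sobolev_add:
  assumes u: "u \<in> sobolev s p U" and v: "v \<in> sobolev s p U"
  shows "(\<lambda>x. u x + v x) \<in> sobolev s p U"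
    and "sobolev_norm s p U (\<lambda>x. u x + v x) \<le> sobolev_norm s p U u + sobolev_norm s p U v"
proof -
  have meas: "u \<in> borel_measurable (lebesgue_on U)" "v \<in> borel_measurable (lebesgue_on U)"
    and fin: "total_energy s p U u < \<infinity>" "total_energy s p U v < \<infinity>"
    using u v by (auto simp: sobolev_iff)
  \<comment> \<open>The norms may vanish, so both are enlarged by a positive amount before the weight is chosen.\<close>
  have bound: "total_energy s p U (\<lambda>x. u x + v x)
      \<le> ennreal ((sobolev_norm s p U u + e / 2 + (sobolev_norm s p U v + e / 2)) powr p)" if "0 < e" for e
    using that fin
    by (intro total_energy_triangle meas sobolev_norm_le_iff[THEN iffD1, OF p_pos])
      (auto intro: add_nonneg_pos)
  have "total_energy s p U (\<lambda>x. u x + v x) < \<infinity>"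
    by (rule le_less_trans[OF bound[of 1]]) auto
  then show 1: "(\<lambda>x. u x + v x) \<in> sobolev s p U"
    using meas by (auto simp: sobolev_iff)
  show "sobolev_norm s p U (\<lambda>x. u x + v x) \<le> sobolev_norm s p U u + sobolev_norm s p U v"
  proof (rule field_le_epsilon)
    fix e :: real assume e: "0 < e"
    have "sobolev_norm s p U (\<lambda>x. u x + v x) \<le> sobolev_norm s p U u + e / 2 + (sobolev_norm s p U v + e / 2)"
      using bound[OF e] 1 e by (subst sobolev_norm_le_iff[OF p_pos]) (auto simp: sobolev_iff add_nonneg_nonneg)
    then show "sobolev_norm s p U (\<lambda>x. u x + v x) \<le> sobolev_norm s p U u + sobolev_norm s p U v + e"
      by simp
  qed
qed

lemma sobolev_scale:
  assumes u: "u \<in> sobolev s p U"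
  shows "(\<lambda>x. c * u x) \<in> sobolev s p U"
    and "sobolev_norm s p U (\<lambda>x. c * u x) = \<bar>c\<bar> * sobolev_norm s p U u"
proof -
  have meas [measurable]: "u \<in> borel_measurable (lebesgue_on U)"
    and fin: "total_energy s p U u < \<infinity>"
    using u by (auto simp: sobolev_iff)
  show "(\<lambda>x. c * u x) \<in> sobolev s p U"
    unfolding sobolev_iff total_energy_scale[OF meas]
    using fin by (auto simp: ennreal_mult_less_top)
  show "sobolev_norm s p U (\<lambda>x. c * u x) = \<bar>c\<bar> * sobolev_norm s p U u"
    using p by (simp add: sobolev_norm_eq total_energy_scale enn2real_mult powr_mult powr_powr)
qed

lemma sobolev_diff:
  assumes u: "u \<in> sobolev s p U" and v: "v \<in> sobolev s p U"
  shows "(\<lambda>x. u x - v x) \<in> sobolev s p U"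
  using sobolev_add(1)[OF u sobolev_scale(1)[OF v, of "-1"]] by simp

lemma sobolev_norm_diff_commute:
  assumes u: "u \<in> sobolev s p U" and v: "v \<in> sobolev s p U"
  shows "sobolev_norm s p U (\<lambda>x. u x - v x) = sobolev_norm s p U (\<lambda>x. v x - u x)"
  using sobolev_scale(2)[OF sobolev_diff[OF u v], of "-1"] by simp

lemma sobolev_norm_triangle_diff:
  assumes "u \<in> sobolev s p U" "v \<in> sobolev s p U" "w \<in> sobolev s p U"
  shows "sobolev_norm s p U (\<lambda>x. u x - w x) \<le> sobolev_norm s p U (\<lambda>x. u x - v x) + sobolev_norm s p U (\<lambda>x. v x - w x)"
  using sobolev_add(2)[OF sobolev_diff[OF assms(1,2)] sobolev_diff[OF assms(2,3)]] by simp

text \<open>If \<open>u\<close> vanishes almost everywhere, then so does the difference quotient on the product space.\<close>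

lemma sobolev_norm_eq_0_iff:
  assumes u: "u \<in> sobolev s p U"
  shows "sobolev_norm s p U u = 0 \<longleftrightarrow> (AE x in lebesgue_on U. u x = 0)"
proof -
  have meas: "u \<in> borel_measurable (lebesgue_on U)"
    and fin: "total_energy s p U u < \<infinity>"
    using u by (auto simp: sobolev_iff)
  have "sobolev_norm s p U u = 0 \<longleftrightarrow> total_energy s p U u = 0"
    using fin by (auto simp: sobolev_norm_eq enn2real_eq_0_iff)
  also have "\<dots> \<longleftrightarrow> (AE x in lebesgue_on U. u x = 0)"
  proof
    assume "total_energy s p U u = 0"
    then show "AE x in lebesgue_on U. u x = 0"
      using power_energy_eq_0_iff[OF meas] by (simp add: total_energy_def Lp_energy_eq_power_energy)
  next
    assume ae: "AE x in lebesgue_on U. u x = 0"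
    then have "Lp_energy p U u = 0"
      using power_energy_eq_0_iff[OF meas] by (simp add: Lp_energy_eq_power_energy)
    moreover have "AE z in lebesgue_on U \<Otimes>\<^sub>M lebesgue_on U. difference_quotient s p u z = 0"
      using AE_pair_fst[OF sigma_finite_lebesgue_on[OF U] ae] AE_pair_snd[OF sigma_finite_lebesgue_on[OF U] ae]
      by eventually_elim (auto simp: difference_quotient_def)
    then have "gagliardo_energy s p U u = 0"
      using power_energy_eq_0_iff[OF difference_quotient_measurable[OF meas]]
      by (simp add: gagliardo_energy_eq_power_energy[OF U p_pos meas])
    ultimately show "total_energy s p U u = 0"
      by (simp add: total_energy_def)
  qed
  finally show ?thesis .
qed

lemma Lp_energy_Fatou:
  assumes "\<And>k. u k \<in> borel_measurable (lebesgue_on U)"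
    and "AE x in lebesgue_on U. (\<lambda>k. u k x) \<longlonglongrightarrow> v x" and "\<And>k. Lp_energy p U (u k) \<le> B"
  shows "Lp_energy p U v \<le> B"
  using power_energy_Fatou[OF p_pos assms(1,2)] assms(3) by (simp add: Lp_energy_eq_power_energy)

lemma gagliardo_energy_Fatou:
  assumes u: "\<And>k. u k \<in> borel_measurable (lebesgue_on U)" and v: "v \<in> borel_measurable (lebesgue_on U)"
    and lim: "AE x in lebesgue_on U. (\<lambda>k. u k x) \<longlonglongrightarrow> v x" and bound: "\<And>k. gagliardo_energy s p U (u k) \<le> B"
  shows "gagliardo_energy s p U v \<le> B"
proof -
  have "AE z in lebesgue_on U \<Otimes>\<^sub>M lebesgue_on U. (\<lambda>k. difference_quotient s p (u k) z) \<longlonglongrightarrow> difference_quotient s p v z"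
    using AE_pair_fst[OF sigma_finite_lebesgue_on[OF U] lim] AE_pair_snd[OF sigma_finite_lebesgue_on[OF U] lim]
  proof eventually_elim
    case (elim z)
    then show ?case
      unfolding difference_quotient_def case_prod_beta divide_inverse
      by (intro tendsto_mult tendsto_diff tendsto_const)
  qed
  from power_energy_Fatou[OF p_pos difference_quotient_measurable[OF u] this] bound
  show ?thesis
    by (simp add: gagliardo_energy_eq_power_energy[OF U p_pos] u v)
qed

lemma sobolev_fast_decay_AE:
  assumes u: "\<And>k. u k \<in> sobolev s p U" and bound: "\<And>k::nat. sobolev_norm s p U (u k) \<le> (1/4)^k"
  shows "AE x in lebesgue_on U. \<forall>\<^sub>F k in sequentially. \<bar>u k x\<bar> \<le> (1/2)^k"
proof (rule power_energy_fast_decay_AE[OF p_pos])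
  fix k
  show "u k \<in> borel_measurable (lebesgue_on U)"
    using u by (auto simp: sobolev_iff)
  have "power_energy p (lebesgue_on U) (u k) \<le> total_energy s p U (u k)"
    by (simp add: total_energy_def Lp_energy_eq_power_energy)
  also have "\<dots> \<le> ennreal (((1/4)^k) powr p)"
    using bound[of k] u[of k] by (subst (asm) sobolev_norm_le_iff[OF p_pos]) (auto simp: sobolev_iff)
  finally show "power_energy p (lebesgue_on U) (u k) \<le> ennreal (((1/4)^k) powr p)" .
qed

text \<open>A subsequence with fast decaying differences converges almost everywhere, and Fatou's lemma
  turns the Cauchy condition into convergence in norm of the whole sequence to that pointwise limit.\<close>

lemma sobolev_complete:
  fixes w :: "nat \<Rightarrow> real ^ 'd \<Rightarrow> real"
  assumes w: "\<And>n. w n \<in> sobolev s p U"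
    and Cauchy: "\<And>\<epsilon>. \<epsilon> > 0 \<Longrightarrow> \<exists>M. \<forall>m\<ge>M. \<forall>n\<ge>M. sobolev_norm s p U (\<lambda>x. w m x - w n x) < \<epsilon>"
  obtains u where "u \<in> sobolev s p U" "(\<lambda>n. sobolev_norm s p U (\<lambda>x. w n x - u x)) \<longlonglongrightarrow> 0"
proof -
  have meas [measurable]: "w n \<in> borel_measurable (lebesgue_on U)" for n
    using w by (auto simp: sobolev_iff)
  obtain M where M: "\<And>\<epsilon> m n. \<epsilon> > 0 \<Longrightarrow> m \<ge> M \<epsilon> \<Longrightarrow> n \<ge> M \<epsilon> \<Longrightarrow> sobolev_norm s p U (\<lambda>x. w m x - w n x) < \<epsilon>"
    using Cauchy by metis
  \<comment> \<open>Adding up all earlier thresholds makes \<open>r\<close> monotone; the summand \<open>k\<close> makes it unbounded.\<close>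
  define r where "r k = k + (\<Sum>j\<le>k. M ((1/4)^j))" for k :: nat
  have r_ge: "M ((1/4)^k) \<le> r k" "k \<le> r k" "r k \<le> r (Suc k)" for k
    by (auto simp: r_def intro: trans_le_add2 member_le_sum)
  define v where "v k = w (r k)" for k
  have v: "v k \<in> sobolev s p U" for k
    by (simp add: v_def w)
  have "AE x in lebesgue_on U. \<forall>\<^sub>F k in sequentially. \<bar>v (Suc k) x - v k x\<bar> \<le> (1/2)^k"
  proof (rule sobolev_fast_decay_AE)
    fix k
    show "sobolev_norm s p U (\<lambda>x. v (Suc k) x - v k x) \<le> (1/4)^k"
      unfolding v_def using r_ge[of k] by (intro M[THEN less_imp_le]) auto
  qed (intro sobolev_diff v)
  then have conv: "AE x in lebesgue_on U. (\<lambda>k. v k x) \<longlonglongrightarrow> lim (\<lambda>k. v k x)"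
  proof eventually_elim
    case (elim x)
    have "summable (\<lambda>k. v (Suc k) x - v k x)"
      using elim by (intro summable_comparison_test_ev[OF _ summable_geometric[of "1/2"]]) auto
    then have "convergent (\<lambda>n. \<Sum>k<n. v (Suc k) x - v k x)"
      by (rule summable_LIMSEQ[THEN convergentI])
    then have "convergent (\<lambda>n. v n x - v 0 x)"
      by (simp add: sum_lessThan_telescope[of "\<lambda>k. v k x"])
    then have "convergent (\<lambda>n. (v n x - v 0 x) + v 0 x)"
      by (intro convergent_add convergent_const)
    then show ?case
      by (simp add: convergent_LIMSEQ_iff)
  qed
  define u where "u x = lim (\<lambda>k. v k x)" for x
  have u_meas [measurable]: "u \<in> borel_measurable (lebesgue_on U)"
    unfolding u_def v_def by (rule borel_measurable_lim_metric) (rule meas)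
  have close: "(\<lambda>x. w n x - u x) \<in> sobolev s p U \<and> sobolev_norm s p U (\<lambda>x. w n x - u x) \<le> 2 * \<epsilon>"
    if \<epsilon>: "0 < \<epsilon>" and n: "M \<epsilon> \<le> n" for \<epsilon> n
  proof -
    \<comment> \<open>Shifting the subsequence by \<open>M \<epsilon>\<close> puts all its indices beyond the threshold for \<open>\<epsilon>\<close>.\<close>
    let ?f = "\<lambda>k x. w n x - v (k + M \<epsilon>) x"
    have f: "?f k \<in> sobolev s p U" for k
      by (intro sobolev_diff w v)
    have total: "total_energy s p U (?f k) \<le> ennreal (\<epsilon> powr p)" for k
    proof -
      have "sobolev_norm s p U (?f k) \<le> \<epsilon>"
        unfolding v_def using r_ge(2)[of "k + M \<epsilon>"] n \<epsilon> by (intro M[THEN less_imp_le]) auto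
      then show ?thesis
        using f[of k] \<epsilon> by (subst (asm) sobolev_norm_le_iff[OF p_pos]) (auto simp: sobolev_iff)
    qed
    have bounds: "gagliardo_energy s p U (?f k) \<le> ennreal (\<epsilon> powr p)"
        "Lp_energy p U (?f k) \<le> ennreal (\<epsilon> powr p)" for k
      by (rule order_trans[OF _ total[of k]], simp add: total_energy_def)+
    have lim: "AE x in lebesgue_on U. (\<lambda>k. ?f k x) \<longlonglongrightarrow> w n x - u x"
      using conv unfolding u_def
      by eventually_elim (rule tendsto_diff[OF tendsto_const LIMSEQ_ignore_initial_segment])
    have f_meas: "?f k \<in> borel_measurable (lebesgue_on U)" for k
      using f by (auto simp: sobolev_iff)
    have "total_energy s p U (\<lambda>x. w n x - u x) \<le> ennreal (\<epsilon> powr p) + ennreal (\<epsilon> powr p)"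
      unfolding total_energy_def
      by (intro add_mono gagliardo_energy_Fatou[OF f_meas _ lim bounds(1)] Lp_energy_Fatou[OF f_meas lim bounds(2)]) measurable
    also have "\<dots> = ennreal (2 * \<epsilon> powr p)"
      by (subst ennreal_plus[symmetric]) auto
    also have "\<dots> \<le> ennreal ((2 * \<epsilon>) powr p)"
    proof (rule ennreal_leI)
      have "2 powr 1 \<le> 2 powr p"
        using p by (intro powr_mono) auto
      then show "2 * \<epsilon> powr p \<le> (2 * \<epsilon>) powr p"
        by (simp add: powr_mult mult_right_mono)
    qed
    finally have *: "total_energy s p U (\<lambda>x. w n x - u x) \<le> ennreal ((2 * \<epsilon>) powr p)" .
    then have fin: "total_energy s p U (\<lambda>x. w n x - u x) < \<infinity>"
      by (rule le_less_trans) simp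
    then have "sobolev_norm s p U (\<lambda>x. w n x - u x) \<le> 2 * \<epsilon>"
      using * \<epsilon> by (subst sobolev_norm_le_iff[OF p_pos]) auto
    with fin show ?thesis
      by (auto simp: sobolev_iff)
  qed
  show thesis
  proof
    have "(\<lambda>x. w (M 1) x - u x) \<in> sobolev s p U"
      using close[of 1 "M 1"] by simp
    from sobolev_diff[OF w this] have "(\<lambda>x. w (M 1) x - (w (M 1) x - u x)) \<in> sobolev s p U" .
    then show "u \<in> sobolev s p U" by simp
    show "(\<lambda>n. sobolev_norm s p U (\<lambda>x. w n x - u x)) \<longlonglongrightarrow> 0"
    proof (rule LIMSEQ_I)
      fix \<epsilon> :: real assume \<epsilon>: "0 < \<epsilon>"
      then have "sobolev_norm s p U (\<lambda>x. w n x - u x) < \<epsilon>" if "M (\<epsilon> / 4) \<le> n" for n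
        using close[of "\<epsilon> / 4" n] that by auto
      then show "\<exists>no. \<forall>n\<ge>no. norm (sobolev_norm s p U (\<lambda>x. w n x - u x) - 0) < \<epsilon>"
        by auto
    qed
  qed
qed

end

section \<open>Test functions\<close>

lemma C_fun_const: "C_fun n (\<lambda>x. c)"
proof (induction n arbitrary: c)
  case (Suc n)
  show ?case
    using Suc.IH[of 0] by simp
qed simp

lemma C_fun_add: "C_fun n f \<Longrightarrow> C_fun n g \<Longrightarrow> C_fun n (\<lambda>x. f x + g x)"
proof (induction n arbitrary: f g)
  case 0
  then show ?case by (auto intro: continuous_intros)
next
  case (Suc n)
  have df: "f differentiable at x" and dg: "g differentiable at x" for x
    using Suc.prems by (auto simp: differentiable_on_def)
  have "frechet_derivative (\<lambda>x. f x + g x) (at x) = (\<lambda>h. frechet_derivative f (at x) h + frechet_derivative g (at x) h)" for x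
    using df[of x] dg[of x] unfolding frechet_derivative_works
    by (intro frechet_derivative_at[symmetric] has_derivative_add)
  moreover have "C_fun n (\<lambda>x. frechet_derivative f (at x) (axis i 1) + frechet_derivative g (at x) (axis i 1))" for i
    using Suc.prems by (intro Suc.IH) simp_all
  moreover have "(\<lambda>x. f x + g x) differentiable_on UNIV"
    using Suc.prems by (intro differentiable_on_add) simp_all
  ultimately show ?case by simp
qed

lemma C_fun_scale: "C_fun n f \<Longrightarrow> C_fun n (\<lambda>x. c * f x)"
proof (induction n arbitrary: f)
  case 0
  then show ?case by (auto intro: continuous_intros)
next
  case (Suc n)
  have df: "f differentiable at x" for x
    using Suc.prems by (auto simp: differentiable_on_def)
  have "frechet_derivative (\<lambda>x. c * f x) (at x) = (\<lambda>h. c * frechet_derivative f (at x) h)" for x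
    using df[of x] unfolding frechet_derivative_works
    by (intro frechet_derivative_at[symmetric] has_derivative_mult_right)
  moreover have "C_fun n (\<lambda>x. c * frechet_derivative f (at x) (axis i 1))" for i
    using Suc.prems by (intro Suc.IH) simp
  moreover have "(\<lambda>x. c * f x) differentiable_on UNIV"
    using Suc.prems by (intro differentiable_on_mult) simp_all
  ultimately show ?case by simp
qed

lemma test_functions_iff:
  "f \<in> test_functions U \<longleftrightarrow> (\<forall>n. C_fun n f) \<and> bounded {x. f x \<noteq> 0} \<and> closure {x. f x \<noteq> 0} \<subseteq> U"
  unfolding test_functions_def mem_Collect_eq compact_closure ..

lemma test_functions_0: "(\<lambda>x. 0) \<in> test_functions U"
  unfolding test_functions_iff by (intro conjI allI C_fun_const) auto

lemma test_functions_add: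
  assumes f: "f \<in> test_functions U" and g: "g \<in> test_functions U"
  shows "(\<lambda>x. f x + g x) \<in> test_functions U"
  unfolding test_functions_iff
proof (intro conjI allI)
  have sub: "{x. f x + g x \<noteq> 0} \<subseteq> {x. f x \<noteq> 0} \<union> {x. g x \<noteq> 0}"
    by auto
  show "C_fun n (\<lambda>x. f x + g x)" for n
    using f g unfolding test_functions_iff by (intro C_fun_add) blast+
  show "bounded {x. f x + g x \<noteq> 0}"
    using f g unfolding test_functions_iff by (intro bounded_subset[OF _ sub] bounded_Un[THEN iffD2]) blast
  show "closure {x. f x + g x \<noteq> 0} \<subseteq> U"
    using closure_mono[OF sub] f g unfolding closure_Un test_functions_iff by blast
qed

lemma test_functions_scale:
  assumes f: "f \<in> test_functions U"
  shows "(\<lambda>x. c * f x) \<in> test_functions U"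
  unfolding test_functions_iff
proof (intro conjI allI)
  have sub: "{x. c * f x \<noteq> 0} \<subseteq> {x. f x \<noteq> 0}"
    by auto
  show "C_fun n (\<lambda>x. c * f x)" for n
    using f unfolding test_functions_iff by (intro C_fun_scale) blast
  show "bounded {x. c * f x \<noteq> 0}"
    using f unfolding test_functions_iff by (intro bounded_subset[OF _ sub]) blast
  show "closure {x. c * f x \<noteq> 0} \<subseteq> U"
    using closure_mono[OF sub] f unfolding test_functions_iff by blast
qed

lemma test_functions_continuous:
  assumes "\<phi> \<in> test_functions U"
  shows "continuous_on UNIV \<phi>"
proof -
  have "C_fun 0 \<phi>"
    using assms unfolding test_functions_iff by blast
  then show ?thesis by simp
qed

lemma test_functions_zero:
  assumes "\<phi> \<in> test_functions U" "x \<notin> U"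
  shows "\<phi> x = 0"
  using assms closure_subset[of "{x. \<phi> x \<noteq> 0}"] unfolding test_functions_iff by blast

text \<open>The partial derivatives are continuous, hence bounded on the ball, and the sum of their bounds
  bounds the operator norm of the derivative.\<close>

lemma C_fun_1_lipschitz_on_cball:
  fixes \<phi> :: "real ^ 'd \<Rightarrow> real"
  assumes "C_fun (Suc 0) \<phi>"
  obtains L where "L \<ge> 0" "\<And>x y. x \<in> cball 0 R \<Longrightarrow> y \<in> cball 0 R \<Longrightarrow> \<bar>\<phi> x - \<phi> y\<bar> \<le> L * norm (x - y)"
proof -
  let ?D = "\<lambda>x. frechet_derivative \<phi> (at x)"
  have D: "(\<phi> has_derivative ?D x) (at x)" for x
    using assms by (auto simp: differentiable_on_def frechet_derivative_works)
  have "bounded ((\<lambda>x. ?D x (axis i 1)) ` cball 0 R)" for i :: 'd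
    using assms by (intro compact_imp_bounded compact_continuous_image) (auto intro: continuous_on_subset)
  then have "\<exists>b. \<forall>x\<in>cball 0 R. \<bar>?D x (axis i 1)\<bar> \<le> b" for i :: 'd
    by (auto simp: bounded_iff)
  then obtain b where b: "\<And>i x. x \<in> cball 0 R \<Longrightarrow> \<bar>?D x (axis i 1)\<bar> \<le> b i"
    by metis
  define L where "L = (\<Sum>i\<in>UNIV. \<bar>b i\<bar>)"
  have "onorm (?D x) \<le> L" if x: "x \<in> cball 0 R" for x
  proof (rule onorm_bound)
    fix h :: "real ^ 'd"
    have lin: "linear (?D x)"
      using D has_derivative_linear by blast
    have "?D x h = ?D x (\<Sum>i\<in>UNIV. h $ i *\<^sub>R axis i 1)"
      using basis_expansion[of h] by (simp add: scalar_mult_eq_scaleR)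
    also have "\<dots> = (\<Sum>i\<in>UNIV. h $ i * ?D x (axis i 1))"
      by (simp add: linear_sum[OF lin] linear_scale[OF lin])
    finally have "\<bar>?D x h\<bar> \<le> (\<Sum>i\<in>UNIV. \<bar>h $ i * ?D x (axis i 1)\<bar>)"
      by (simp add: sum_abs)
    also have "\<dots> \<le> (\<Sum>i\<in>UNIV. norm h * \<bar>b i\<bar>)"
      unfolding abs_mult using b[OF x] by (intro sum_mono mult_mono component_le_norm_cart order_trans[OF b[OF x] abs_ge_self]) auto
    also have "\<dots> = L * norm h"
      by (simp add: L_def sum_distrib_left mult.commute)
    finally show "norm (?D x h) \<le> L * norm h" by simp
  qed (simp add: L_def sum_nonneg)
  then have "norm (\<phi> x - \<phi> y) \<le> L * norm (x - y)" if "x \<in> cball 0 R" "y \<in> cball 0 R" for x y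
    using that D by (intro differentiable_bound[of "cball 0 R" \<phi> ?D L x y]) (auto intro: has_derivative_at_withinI)
  moreover have "L \<ge> 0" by (simp add: L_def sum_nonneg)
  ultimately show thesis
    using that by simp
qed

lemma nn_integral_lebesgue_on:
  assumes "U \<in> sets borel"
  shows "(\<integral>\<^sup>+x. f x \<partial>lebesgue_on U) = (\<integral>\<^sup>+x. f x * indicator U x \<partial>lborel)"
  using assms by (subst nn_integral_restrict_space) (auto simp: nn_integral_completion)

text \<open>For a Lipschitz function the integrand of the Gagliardo energy is at most a multiple of
  \<open>\<bar>x - y\<bar> powr q\<close> with \<open>q + d = p (1 - s) > 0\<close>, which is integrable near the diagonal.\<close>

lemma test_functions_sobolev:
  fixes \<Omega> :: "(real ^ 'd) set"
  assumes \<Omega>: "\<Omega> \<in> sets borel" "bounded \<Omega>" and p: "1 \<le> p" and s: "s < 1" and \<phi>: "\<phi> \<in> test_functions V"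
  shows "\<phi> \<in> sobolev s p \<Omega>"
proof -
  obtain R where R: "0 < R" "\<Omega> \<subseteq> ball 0 R"
    using \<Omega>(2) bounded_subset_ballD by blast
  have fin: "emeasure lborel \<Omega> < \<infinity>"
    using \<Omega>(2) by (rule emeasure_bounded_finite)
  have cont: "continuous_on UNIV \<phi>" and C1: "C_fun (Suc 0) \<phi>"
    using \<phi> test_functions_continuous unfolding test_functions_iff by blast+
  have meas: "\<phi> \<in> borel_measurable (lebesgue_on U)" for U
    using cont by (intro measurable_restrict_space1 measurable_completion) (simp add: borel_measurable_continuous_onI)
  obtain L where L: "L \<ge> 0" "\<And>x y. x \<in> cball 0 R \<Longrightarrow> y \<in> cball 0 R \<Longrightarrow> \<bar>\<phi> x - \<phi> y\<bar> \<le> L * norm (x - y)"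
    using C_fun_1_lipschitz_on_cball[OF C1] by blast
  have "bounded (\<phi> ` cball 0 R)"
    by (intro compact_imp_bounded compact_continuous_image continuous_on_subset[OF cont]) auto
  then have "\<exists>B. \<forall>x\<in>cball 0 R. \<bar>\<phi> x\<bar> \<le> B"
    by (auto simp: bounded_iff)
  then obtain B where B: "\<And>x. x \<in> cball 0 R \<Longrightarrow> \<bar>\<phi> x\<bar> \<le> B"
    by blast
  have "Lp_energy p \<Omega> \<phi> \<le> (\<integral>\<^sup>+x. ennreal (B powr p) * indicator \<Omega> x \<partial>lborel)"
    unfolding Lp_energy_def nn_integral_lebesgue_on[OF \<Omega>(1)]
  proof (rule nn_integral_mono)
    fix x
    show "ennreal (\<bar>\<phi> x\<bar> powr p) * indicator \<Omega> x \<le> ennreal (B powr p) * indicator \<Omega> x"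
      using R B[of x] p by (cases "x \<in> \<Omega>") (auto intro!: ennreal_leI powr_mono2)
  qed
  also have "\<dots> = ennreal (B powr p) * emeasure lborel \<Omega>"
    using \<Omega>(1) by (intro nn_integral_cmult_indicator) simp
  also have "\<dots> < \<infinity>"
    using fin by (simp add: ennreal_mult_less_top)
  finally have Lp: "Lp_energy p \<Omega> \<phi> < \<infinity>" .
  define a where "a = real CARD('d) + s * p"
  define q where "q = p - a"
  have q: "q + real DIM(real ^ 'd) > 0"
    using p s by (simp add: q_def a_def)
  obtain D where D: "\<And>y::real^'d. (\<integral>\<^sup>+x. ennreal (dist x y powr q) * indicator (ball y (2 * R)) x \<partial>lborel) \<le> ennreal D"
    using nn_integral_dist_powr_inside_ball[OF q, of "2 * R"] R by auto
  have inner: "(\<integral>\<^sup>+x. ennreal (\<bar>\<phi> x - \<phi> y\<bar> powr p / norm (x - y) powr a) * indicator \<Omega> x \<partial>lborel)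
      \<le> ennreal (L powr p) * ennreal D" if y: "y \<in> \<Omega>" for y
  proof -
    have "(\<integral>\<^sup>+x. ennreal (\<bar>\<phi> x - \<phi> y\<bar> powr p / norm (x - y) powr a) * indicator \<Omega> x \<partial>lborel)
        \<le> (\<integral>\<^sup>+x. ennreal (L powr p) * (ennreal (dist x y powr q) * indicator (ball y (2 * R)) x) \<partial>lborel)"
    proof (rule nn_integral_mono)
      fix x
      show "ennreal (\<bar>\<phi> x - \<phi> y\<bar> powr p / norm (x - y) powr a) * indicator \<Omega> x
          \<le> ennreal (L powr p) * (ennreal (dist x y powr q) * indicator (ball y (2 * R)) x)"
      proof (cases "x \<in> \<Omega>")
        case True
        have xy: "norm x < R" "norm y < R"
          using R True y by auto
        then have "dist y x < 2 * R"
          using norm_triangle_ineq4[of y x] by (simp add: dist_norm)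
        have "\<bar>\<phi> x - \<phi> y\<bar> powr p \<le> (L * norm (x - y)) powr p"
          using L(2)[of x y] xy p by (intro powr_mono2) auto
        then have "\<bar>\<phi> x - \<phi> y\<bar> powr p / norm (x - y) powr a \<le> (L * norm (x - y)) powr p / norm (x - y) powr a"
          by (intro divide_right_mono) auto
        also have "\<dots> = L powr p * dist x y powr q"
          using L(1) by (simp add: powr_mult q_def powr_diff dist_norm)
        finally show ?thesis
          using True \<open>dist y x < 2 * R\<close> by (simp add: ennreal_mult[symmetric] ennreal_leI)
      qed simp
    qed
    also have "\<dots> = ennreal (L powr p) * (\<integral>\<^sup>+x. ennreal (dist x y powr q) * indicator (ball y (2 * R)) x \<partial>lborel)"
    proof (rule nn_integral_cmult)
      have [measurable]: "ball y (2 * R) \<in> sets borel" by simp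
      show "(\<lambda>x. ennreal (dist x y powr q) * indicator (ball y (2 * R)) x) \<in> borel_measurable lborel"
        by measurable
    qed
    also have "\<dots> \<le> ennreal (L powr p) * ennreal D"
      by (intro mult_left_mono D) simp
    finally show ?thesis .
  qed
  have "gagliardo_energy s p \<Omega> \<phi> \<le> (\<integral>\<^sup>+y. ennreal (L powr p) * ennreal D * indicator \<Omega> y \<partial>lborel)"
    unfolding gagliardo_energy_def nn_integral_lebesgue_on[OF \<Omega>(1)] a_def[symmetric]
  proof (rule nn_integral_mono)
    fix y
    show "(\<integral>\<^sup>+x. ennreal (\<bar>\<phi> x - \<phi> y\<bar> powr p / norm (x - y) powr a) * indicator \<Omega> x \<partial>lborel) * indicator \<Omega> y
       \<le> ennreal (L powr p) * ennreal D * indicator \<Omega> y"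
      using inner[of y] by (cases "y \<in> \<Omega>") auto
  qed
  also have "\<dots> = ennreal (L powr p) * ennreal D * emeasure lborel \<Omega>"
    using \<Omega>(1) by (intro nn_integral_cmult_indicator) simp
  also have "\<dots> < \<infinity>"
    using fin by (simp add: ennreal_mult_less_top)
  finally show ?thesis
    using Lp meas by (simp add: sobolev_def)
qed

section \<open>Extension by zero of functions supported in the domain\<close>

lemma gagliardo_energy_critical:
  fixes U :: "(real ^ 'd) set"
  assumes "s * p = real CARD('d)"
  shows "gagliardo_energy s p U u = (\<integral>\<^sup>+ y. \<integral>\<^sup>+ x. ennreal (\<bar>u x - u y\<bar> powr p / norm (x - y) ^ (2 * CARD('d)))
        \<partial>lebesgue_on U \<partial>lebesgue_on U)"
proof -
  have "norm z powr (real CARD('d) + s * p) = norm z ^ (2 * CARD('d))" for z :: "real ^ 'd"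
  proof (cases "z = 0")
    case False
    then show ?thesis
      using powr_realpow[of "norm z" "2 * CARD('d)"] assms by simp
  qed simp
  then show ?thesis
    by (simp add: gagliardo_energy_def)
qed

lemma gagliardo_energy_critical_lborel:
  fixes U :: "(real ^ 'd) set"
  assumes "s * p = real CARD('d)" and U: "U \<in> sets borel"
  shows "gagliardo_energy s p U u = (\<integral>\<^sup>+ y. \<integral>\<^sup>+ x. ennreal (\<bar>u x - u y\<bar> powr p / dist x y ^ (2 * CARD('d)))
        * (indicator U x * indicator U y) \<partial>lborel \<partial>lborel)"
  unfolding gagliardo_energy_critical[OF assms(1)] nn_integral_lebesgue_on[OF U]
proof (rule nn_integral_cong)
  fix y
  show "(\<integral>\<^sup>+x. ennreal (\<bar>u x - u y\<bar> powr p / norm (x - y) ^ (2 * CARD('d))) * indicator U x \<partial>lborel) * indicator U y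
    = (\<integral>\<^sup>+ x. ennreal (\<bar>u x - u y\<bar> powr p / dist x y ^ (2 * CARD('d)))
        * (indicator U x * indicator U y) \<partial>lborel)"
    by (cases "y \<in> U") (auto simp: dist_norm)
qed

text \<open>Only pairs with exactly one point in \<open>\<Omega>\<close> contribute to the difference of the two energies. If
  \<open>y\<close> is that point and \<open>x\<close> is outside, then the distance is at least that of \<open>y\<close> to the complement,
  so integrating over \<open>x\<close> gives the integrand of the Hardy inequality at \<open>y\<close>. The function \<open>T\<close>
  below is the bound for such pairs.\<close>

lemma gagliardo_energy_whole_space_le:
  fixes \<Omega> :: "(real ^ 'd) set"
  assumes \<Omega>: "bounded_lipschitz_domain \<Omega>" and d: "2 \<le> CARD('d)" and p: "1 < p" and sp: "s * p = real CARD('d)"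
  obtains C :: real where "C > 0"
    "\<And>\<phi> S. continuous_on UNIV \<phi> \<Longrightarrow> compact S \<Longrightarrow> S \<subseteq> \<Omega> \<Longrightarrow> (\<And>x. x \<notin> S \<Longrightarrow> \<phi> x = 0) \<Longrightarrow>
       gagliardo_energy s p UNIV \<phi> \<le> ennreal C * gagliardo_energy s p \<Omega> \<phi>"
proof -
  let ?d = "CARD('d)" and ?\<delta> = "\<lambda>x. infdist x (- \<Omega>)"
  have op: "open \<Omega>" and bd: "bounded \<Omega>"
    using \<Omega> by (auto simp: bounded_lipschitz_domain_def)
  have nU: "\<Omega> \<noteq> UNIV"
    using bd not_bounded_UNIV by blast
  have \<delta>_pos: "0 < ?\<delta> x" if "x \<in> \<Omega>" for x
    using that op nU by (intro infdist_pos_not_in_closed) (auto simp: closed_Compl)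
  have dim: "DIM(real ^ 'd) = ?d" and p0: "0 < p"
    using p by simp_all
  obtain C c where layer: "C \<ge> 1" "c > 0"
    "\<And>x n. x \<in> \<Omega> \<Longrightarrow> 0 < n \<Longrightarrow>
       ennreal (c * ?\<delta> x ^ ?d / real n) \<le> emeasure lborel (boundary_layer \<Omega> C n x)"
    by (rule boundary_layer_thick[OF \<Omega>]) blast
  obtain M where M: "M \<ge> 0"
    "\<And>\<phi> S. continuous_on UNIV \<phi> \<Longrightarrow> compact S \<Longrightarrow> S \<subseteq> \<Omega> \<Longrightarrow> (\<And>x. x \<notin> S \<Longrightarrow> \<phi> x = 0) \<Longrightarrow>
       (\<integral>\<^sup>+x. ennreal (\<bar>\<phi> x\<bar> powr p / ?\<delta> x ^ ?d) * indicator \<Omega> x \<partial>lborel)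
       \<le> ennreal M * (\<integral>\<^sup>+x. \<integral>\<^sup>+y. ennreal (\<bar>\<phi> x - \<phi> y\<bar> powr p / dist x y ^ (2 * ?d))
            * (indicator \<Omega> x * indicator \<Omega> y) \<partial>lborel \<partial>lborel)"
    using fractional_hardy_inequality_of_thick_layers[where 'a="real^'d", unfolded dim, OF op nU d layer(1,2) p0 layer(3)]
    by blast
  obtain A where A: "A > 0" "\<And>(y::real^'d) R. R > 0 \<Longrightarrow>
       (\<integral>\<^sup>+x. ennreal (1 / dist x y ^ (2 * ?d)) * indicator {x. R \<le> dist x y} x \<partial>lborel)
         \<le> ennreal (A / R ^ ?d)"
    using nn_integral_inverse_dist_power_outside_ball[where 'a="real^'d", unfolded dim] by blast
  show thesis
  proof
    show "1 + 2 * A * M > 0"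
      using A(1) M(1) by (intro add_pos_nonneg) auto
    fix \<phi> :: "real ^ 'd \<Rightarrow> real" and S
    assume cont: "continuous_on UNIV \<phi>" and S: "compact S" "S \<subseteq> \<Omega>" and supp: "\<And>x. x \<notin> S \<Longrightarrow> \<phi> x = 0"
    have [measurable]: "\<phi> \<in> borel_measurable borel" "?\<delta> \<in> borel_measurable borel" "\<Omega> \<in> sets borel"
      using cont op by (auto intro!: borel_measurable_continuous_onI continuous_intros)
    define H where "H = (\<integral>\<^sup>+x. ennreal (\<bar>\<phi> x\<bar> powr p / ?\<delta> x ^ ?d) * indicator \<Omega> x \<partial>lborel)"
    define g where "g x y = ennreal (\<bar>\<phi> x - \<phi> y\<bar> powr p / dist x y ^ (2 * ?d))" for x y
    let ?E = "gagliardo_energy s p \<Omega> \<phi>"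
    have E: "?E = (\<integral>\<^sup>+y. \<integral>\<^sup>+x. g x y * (indicator \<Omega> x * indicator \<Omega> y) \<partial>lborel \<partial>lborel)"
      unfolding g_def by (rule gagliardo_energy_critical_lborel[OF sp]) simp
    have g_sym: "g x y = g y x" for x y
      by (simp add: g_def dist_commute abs_minus_commute)
    have "H \<le> ennreal M * (\<integral>\<^sup>+x. \<integral>\<^sup>+y. g x y * (indicator \<Omega> x * indicator \<Omega> y) \<partial>lborel \<partial>lborel)"
      unfolding H_def g_def by (rule M(2)[OF cont S supp])
    also have "(\<integral>\<^sup>+x. \<integral>\<^sup>+y. g x y * (indicator \<Omega> x * indicator \<Omega> y) \<partial>lborel \<partial>lborel) = ?E"
      unfolding E by (intro nn_integral_cong) (rule arg_cong2[where f="(*)", OF g_sym mult.commute])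
    finally have Hardy: "H \<le> ennreal M * ?E" .
    define T where "T x y = ennreal (\<bar>\<phi> y\<bar> powr p) * indicator \<Omega> y *
        (ennreal (1 / dist x y ^ (2 * ?d)) * indicator {x. ?\<delta> y \<le> dist x y} x)" for x y
    have T_eq: "T x y = ennreal (\<bar>\<phi> y\<bar> powr p) * indicator \<Omega> y *
        (ennreal (1 / dist x y ^ (2 * ?d)) * (if ?\<delta> y \<le> dist x y then 1 else 0))" for x y
      by (simp add: T_def)
    have [measurable]: "(\<lambda>(x, y). T x y) \<in> borel_measurable (borel \<Otimes>\<^sub>M borel)"
      "(\<lambda>(x, y). g x y) \<in> borel_measurable (borel \<Otimes>\<^sub>M borel)"
      unfolding T_eq g_def by measurable
    have T_int: "(\<integral>\<^sup>+y. \<integral>\<^sup>+x. T x y \<partial>lborel \<partial>lborel) \<le> ennreal A * H"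
    proof -
      have "(\<integral>\<^sup>+x. T x y \<partial>lborel) \<le> ennreal A * (ennreal (\<bar>\<phi> y\<bar> powr p / ?\<delta> y ^ ?d) * indicator \<Omega> y)" for y
      proof (cases "y \<in> \<Omega>")
        case True
        have "(\<integral>\<^sup>+x. T x y \<partial>lborel) = ennreal (\<bar>\<phi> y\<bar> powr p) * indicator \<Omega> y *
            (\<integral>\<^sup>+x. ennreal (1 / dist x y ^ (2 * ?d)) * indicator {x. ?\<delta> y \<le> dist x y} x \<partial>lborel)"
          unfolding T_def by (rule nn_integral_cmult) simp
        also have "\<dots> \<le> ennreal (\<bar>\<phi> y\<bar> powr p) * indicator \<Omega> y * ennreal (A / ?\<delta> y ^ ?d)"
          by (intro mult_left_mono A \<delta>_pos True) simp
        also have "\<dots> = ennreal (\<bar>\<phi> y\<bar> powr p * (A / ?\<delta> y ^ ?d))"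
          using True A(1) ennreal_mult[of "\<bar>\<phi> y\<bar> powr p" "A / ?\<delta> y ^ ?d"] by (simp add: infdist_nonneg)
        also have "\<dots> = ennreal (A * (\<bar>\<phi> y\<bar> powr p / ?\<delta> y ^ ?d))"
          by (simp add: mult_ac)
        also have "\<dots> = ennreal A * (ennreal (\<bar>\<phi> y\<bar> powr p / ?\<delta> y ^ ?d) * indicator \<Omega> y)"
          using True A(1) by (subst ennreal_mult) (auto simp: infdist_nonneg)
        finally show ?thesis .
      qed (simp add: T_def)
      then have "(\<integral>\<^sup>+y. \<integral>\<^sup>+x. T x y \<partial>lborel \<partial>lborel) \<le>
          (\<integral>\<^sup>+y. ennreal A * (ennreal (\<bar>\<phi> y\<bar> powr p / ?\<delta> y ^ ?d) * indicator \<Omega> y) \<partial>lborel)"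
        by (intro nn_integral_mono)
      also have "\<dots> = ennreal A * H"
        unfolding H_def by (rule nn_integral_cmult) simp
      finally show ?thesis .
    qed
    have T_int': "(\<integral>\<^sup>+y. \<integral>\<^sup>+x. T y x \<partial>lborel \<partial>lborel) \<le> ennreal A * H"
      using T_int by (subst lborel_pair.Fubini') simp_all
    have cross: "g x y \<le> g x y * (indicator \<Omega> x * indicator \<Omega> y) + T x y + T y x" for x y
    proof -
      have out: "g x y \<le> T x y" if "x \<notin> \<Omega>" "y \<in> \<Omega>" for x y
      proof -
        have "\<phi> x = 0" "?\<delta> y \<le> dist x y"
          using supp S(2) that infdist_le[of x "- \<Omega>" y] by (auto simp: dist_commute)
        then show ?thesis
          using that by (simp add: g_def T_def ennreal_mult[symmetric])
      qed
      consider "x \<in> \<Omega>" "y \<in> \<Omega>" | "x \<notin> \<Omega>" "y \<in> \<Omega>" | "x \<in> \<Omega>" "y \<notin> \<Omega>" | "x \<notin> \<Omega>" "y \<notin> \<Omega>"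
        by blast
      then show ?thesis
      proof cases
        case 1
        then show ?thesis by (simp add: add.assoc)
      next
        case 2
        then show ?thesis using out by (auto intro: add_increasing2)
      next
        case 3
        then show ?thesis using out[of y x] g_sym[of x y] by (auto intro: add_increasing)
      next
        case 4
        then have "\<phi> x = 0" "\<phi> y = 0"
          using supp S(2) by auto
        then show ?thesis by (simp add: g_def)
      qed
    qed
    have "gagliardo_energy s p UNIV \<phi> = (\<integral>\<^sup>+y. \<integral>\<^sup>+x. g x y \<partial>lborel \<partial>lborel)"
      unfolding g_def by (subst gagliardo_energy_critical_lborel[OF sp]) simp_all
    also have "\<dots> \<le> (\<integral>\<^sup>+y. \<integral>\<^sup>+x. g x y * (indicator \<Omega> x * indicator \<Omega> y) + T x y + T y x \<partial>lborel \<partial>lborel)"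
      by (intro nn_integral_mono cross)
    also have "\<dots> = ?E + (\<integral>\<^sup>+y. \<integral>\<^sup>+x. T x y \<partial>lborel \<partial>lborel) + (\<integral>\<^sup>+y. \<integral>\<^sup>+x. T y x \<partial>lborel \<partial>lborel)"
      unfolding E by (simp add: nn_integral_add)
    also have "\<dots> \<le> ?E + ennreal A * H + ennreal A * H"
      by (intro add_mono order_refl T_int T_int')
    also have "\<dots> \<le> ?E + ennreal A * (ennreal M * ?E) + ennreal A * (ennreal M * ?E)"
      by (intro add_mono order_refl mult_left_mono Hardy) auto
    also have "\<dots> = (1 + ennreal (A * M) + ennreal (A * M)) * ?E"
      using A(1) M(1) by (simp add: ennreal_mult distrib_right mult.assoc)
    also have "1 + ennreal (A * M) + ennreal (A * M) = ennreal (1 + 2 * A * M)"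
    proof -
      have "1 + 2 * A * M = 1 + A * M + A * M"
        by simp
      also have "ennreal (1 + A * M + A * M) = ennreal (1 + A * M) + ennreal (A * M)"
        using A(1) M(1) by (intro ennreal_plus) auto
      also have "ennreal (1 + A * M) = 1 + ennreal (A * M)"
        using A(1) M(1) by (subst ennreal_plus) auto
      finally show ?thesis ..
    qed
    finally show "gagliardo_energy s p UNIV \<phi> \<le> ennreal (1 + 2 * A * M) * ?E" .
  qed
qed

section \<open>The closure of the test functions\<close>

lemma sobolev0_subset_sobolev: "u \<in> sobolev0 s p \<Omega> K \<Longrightarrow> u \<in> sobolev s p \<Omega>"
  by (simp add: sobolev0_def)

lemma sobolev0_approx:
  assumes "u \<in> sobolev0 s p \<Omega> K" "0 < \<epsilon>"
  obtains \<phi> where "\<phi> \<in> test_functions (\<Omega> - K)" "sobolev_norm s p \<Omega> (\<lambda>x. u x - \<phi> x) < \<epsilon>"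
  using assms unfolding sobolev0_def by blast

text \<open>The closure of a linear subspace of a complete space. Test functions have finite energy,
  which is needed for the norms of the differences \<open>u - \<phi>\<close> to be meaningful.\<close>

lemma banach_function_space_sobolev0:
  fixes \<Omega> :: "(real ^ 'd) set"
  assumes \<Omega>: "\<Omega> \<in> sets borel" "bounded \<Omega>" and p: "1 \<le> p" and s: "s < 1"
  shows "banach_function_space \<Omega> (sobolev0 s p \<Omega> K) (sobolev_norm s p \<Omega>)"
proof -
  let ?V = "sobolev0 s p \<Omega> K" and ?N = "sobolev_norm s p \<Omega>"
  have \<Omega>l: "\<Omega> \<in> sets lebesgue"
    using \<Omega>(1) by auto
  note test = test_functions_sobolev[OF \<Omega> p s]
  note add = sobolev_add[OF \<Omega>l p] and scale = sobolev_scale[OF \<Omega>l p] and diff = sobolev_diff[OF \<Omega>l p]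
  have V_I: "u \<in> ?V" if "u \<in> sobolev s p \<Omega>"
    and "\<And>\<epsilon>. 0 < \<epsilon> \<Longrightarrow> \<exists>\<phi>\<in>test_functions (\<Omega> - K). ?N (\<lambda>x. u x - \<phi> x) < \<epsilon>" for u
    using that unfolding sobolev0_def by blast
  have N_0: "?N (\<lambda>x. 0) = 0"
    using scale(2)[OF test[OF test_functions_0], of 0] by simp
  have zero: "(\<lambda>x. 0) \<in> ?V"
  proof (rule V_I)
    show "\<exists>\<phi>\<in>test_functions (\<Omega> - K). ?N (\<lambda>x. 0 - \<phi> x) < \<epsilon>" if "0 < \<epsilon>" for \<epsilon>
      using that N_0 by (intro bexI[of _ "\<lambda>x. 0"] test_functions_0) simp
  qed (rule test[OF test_functions_0])
  have sum: "(\<lambda>x. u x + v x) \<in> ?V" if u: "u \<in> ?V" and v: "v \<in> ?V" for u v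
  proof (rule V_I)
    fix \<epsilon> :: real assume "0 < \<epsilon>"
    then have \<epsilon>: "0 < \<epsilon> / 2" by simp
    obtain \<phi> where \<phi>: "\<phi> \<in> test_functions (\<Omega> - K)" "?N (\<lambda>x. u x - \<phi> x) < \<epsilon> / 2"
      by (rule sobolev0_approx[OF u \<epsilon>])
    obtain \<psi> where \<psi>: "\<psi> \<in> test_functions (\<Omega> - K)" "?N (\<lambda>x. v x - \<psi> x) < \<epsilon> / 2"
      by (rule sobolev0_approx[OF v \<epsilon>])
    have "?N (\<lambda>x. (u x - \<phi> x) + (v x - \<psi> x)) < \<epsilon>"
      using add(2)[OF diff[OF sobolev0_subset_sobolev[OF u] test[OF \<phi>(1)]] diff[OF sobolev0_subset_sobolev[OF v] test[OF \<psi>(1)]]]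
        \<phi>(2) \<psi>(2) by linarith
    moreover have "(\<lambda>x. (u x - \<phi> x) + (v x - \<psi> x)) = (\<lambda>x. (u x + v x) - (\<phi> x + \<psi> x))"
      by auto
    ultimately show "\<exists>\<phi>\<in>test_functions (\<Omega> - K). ?N (\<lambda>x. u x + v x - \<phi> x) < \<epsilon>"
      using test_functions_add[OF \<phi>(1) \<psi>(1)] by (intro bexI[of _ "\<lambda>x. \<phi> x + \<psi> x"]) simp_all
  qed (intro add(1) sobolev0_subset_sobolev[OF u] sobolev0_subset_sobolev[OF v])
  have mult: "(\<lambda>x. c * u x) \<in> ?V" if u: "u \<in> ?V" for u c
  proof (rule V_I)
    fix \<epsilon> :: real assume \<epsilon>: "0 < \<epsilon>"
    then have "0 < \<epsilon> / (1 + \<bar>c\<bar>)" by simp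
    then obtain \<phi> where \<phi>: "\<phi> \<in> test_functions (\<Omega> - K)" "?N (\<lambda>x. u x - \<phi> x) < \<epsilon> / (1 + \<bar>c\<bar>)"
      by (rule sobolev0_approx[OF u])
    have "?N (\<lambda>x. c * (u x - \<phi> x)) = \<bar>c\<bar> * ?N (\<lambda>x. u x - \<phi> x)"
      by (rule scale(2)[OF diff[OF sobolev0_subset_sobolev[OF u] test[OF \<phi>(1)]]])
    also have "\<dots> \<le> \<bar>c\<bar> * (\<epsilon> / (1 + \<bar>c\<bar>))"
      using \<phi>(2) by (intro mult_left_mono) auto
    also have "\<dots> < \<epsilon>"
      using \<epsilon> by (simp add: pos_divide_less_eq algebra_simps)
    finally have "?N (\<lambda>x. c * (u x - \<phi> x)) < \<epsilon>" .
    then show "\<exists>\<phi>\<in>test_functions (\<Omega> - K). ?N (\<lambda>x. c * u x - \<phi> x) < \<epsilon>"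
      using test_functions_scale[OF \<phi>(1), of c] by (intro bexI[of _ "\<lambda>x. c * \<phi> x"]) (simp_all add: right_diff_distrib)
  qed (intro scale(1) sobolev0_subset_sobolev[OF u])
  have complete: "\<exists>u\<in>?V. (\<lambda>n. ?N (\<lambda>x. w n x - u x)) \<longlonglongrightarrow> 0"
    if w: "\<forall>n. w n \<in> ?V" and Cauchy: "\<forall>\<epsilon>>0. \<exists>M. \<forall>m\<ge>M. \<forall>n\<ge>M. ?N (\<lambda>x. w m x - w n x) < \<epsilon>" for w :: "nat \<Rightarrow> real ^ 'd \<Rightarrow> real"
  proof -
    have w': "w n \<in> sobolev s p \<Omega>" for n
      using w by (intro sobolev0_subset_sobolev) blast
    obtain u where u: "u \<in> sobolev s p \<Omega>" "(\<lambda>n. ?N (\<lambda>x. w n x - u x)) \<longlonglongrightarrow> 0"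
      by (rule sobolev_complete[where w=w and s=s, OF \<Omega>l p w']) (use Cauchy in blast)+
    have "u \<in> ?V"
    proof (rule V_I[OF u(1)])
      fix \<epsilon> :: real assume "0 < \<epsilon>"
      then have \<epsilon>: "0 < \<epsilon> / 2" by simp
      have "\<forall>\<^sub>F n in sequentially. ?N (\<lambda>x. w n x - u x) < \<epsilon> / 2"
        using u(2) \<epsilon> by (rule order_tendstoD(2))
      then obtain n where n: "?N (\<lambda>x. w n x - u x) < \<epsilon> / 2"
        by (auto simp: eventually_sequentially)
      obtain \<phi> where \<phi>: "\<phi> \<in> test_functions (\<Omega> - K)" "?N (\<lambda>x. w n x - \<phi> x) < \<epsilon> / 2"
        using w by (blast intro: sobolev0_approx[OF _ \<epsilon>])
      have "?N (\<lambda>x. u x - \<phi> x) \<le> ?N (\<lambda>x. u x - w n x) + ?N (\<lambda>x. w n x - \<phi> x)"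
        by (rule sobolev_norm_triangle_diff[OF \<Omega>l p u(1) w' test[OF \<phi>(1)]])
      then show "\<exists>\<phi>\<in>test_functions (\<Omega> - K). ?N (\<lambda>x. u x - \<phi> x) < \<epsilon>"
        using \<phi> n sobolev_norm_diff_commute[OF \<Omega>l p u(1) w', of n] by (intro bexI[of _ \<phi>]) auto
    qed
    with u(2) show ?thesis by blast
  qed
  show ?thesis
    unfolding banach_function_space_def
  proof (intro conjI ballI allI impI)
    show "?N (\<lambda>x. u x + v x) \<le> ?N u + ?N v" if "u \<in> ?V" "v \<in> ?V" for u v
      by (rule add(2)[OF sobolev0_subset_sobolev[OF that(1)] sobolev0_subset_sobolev[OF that(2)]])
    show "?N (\<lambda>x. c * u x) = \<bar>c\<bar> * ?N u" if "u \<in> ?V" for u c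
      by (rule scale(2)[OF sobolev0_subset_sobolev[OF that]])
    show "(?N u = 0) = (AE x in lebesgue_on \<Omega>. u x = 0)" if "u \<in> ?V" for u
      by (rule sobolev_norm_eq_0_iff[OF \<Omega>l p sobolev0_subset_sobolev[OF that]])
  qed (use zero sum mult complete in blast)+
qed

text \<open>Test functions that approximate \<open>u\<close> fast enough converge to it almost everywhere on \<open>\<Omega>\<close>. As they all vanish
  outside \<open>\<Omega>\<close> and on \<open>K\<close>, their limit on the whole space is the zero extension of \<open>u\<close>, and
  \<open>u\<close> itself is \<open>0\<close> almost everywhere on \<open>K\<close>.\<close>

lemma sobolev0_zero_ext_limit:
  fixes \<Omega> :: "(real ^ 'd) set"
  assumes \<Omega>: "\<Omega> \<in> sets borel" "bounded \<Omega>" and p: "1 \<le> p" and s: "s < 1" and u: "u \<in> sobolev0 s p \<Omega> K"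
  obtains \<phi> :: "nat \<Rightarrow> real ^ 'd \<Rightarrow> real" where "\<And>k. \<phi> k \<in> test_functions (\<Omega> - K)"
    "\<And>k. sobolev_norm s p \<Omega> (\<lambda>x. u x - \<phi> k x) \<le> (1/4)^k"
    "AE x in lebesgue. (\<lambda>k. \<phi> k x) \<longlonglongrightarrow> zero_ext \<Omega> K u x"
    "AE x in lebesgue_on \<Omega>. zero_ext \<Omega> K u x = u x"
proof -
  have \<Omega>l: "\<Omega> \<in> sets lebesgue"
    using \<Omega>(1) by auto
  have "\<exists>\<phi>. \<phi> \<in> test_functions (\<Omega> - K) \<and> sobolev_norm s p \<Omega> (\<lambda>x. u x - \<phi> x) < (1/4)^k" for k :: nat
    by (rule sobolev0_approx[OF u, of "(1/4)^k"]) auto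
  then obtain \<phi> where \<phi>: "\<And>k. \<phi> k \<in> test_functions (\<Omega> - K)"
      "\<And>k. sobolev_norm s p \<Omega> (\<lambda>x. u x - \<phi> k x) < (1/4)^k"
    by metis
  have "AE x in lebesgue_on \<Omega>. \<forall>\<^sub>F k in sequentially. \<bar>u x - \<phi> k x\<bar> \<le> (1/2)^k"
    by (rule sobolev_fast_decay_AE[OF \<Omega>l p])
      (auto intro!: sobolev_diff[OF \<Omega>l p sobolev0_subset_sobolev[OF u]] test_functions_sobolev[OF \<Omega> p s \<phi>(1)] less_imp_le[OF \<phi>(2)])
  then have lim: "AE x in lebesgue_on \<Omega>. (\<lambda>k. \<phi> k x) \<longlonglongrightarrow> u x"
  proof eventually_elim
    case (elim x)
    have "(\<lambda>k. (1/2::real)^k) \<longlonglongrightarrow> 0"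
      by (rule LIMSEQ_realpow_zero) auto
    then have "(\<lambda>k. u x - \<phi> k x) \<longlonglongrightarrow> 0"
      by (rule Lim_null_comparison[rotated]) (use elim in simp)
    then have "(\<lambda>k. u x - (u x - \<phi> k x)) \<longlonglongrightarrow> u x - 0"
      by (intro tendsto_diff tendsto_const)
    then show ?case by simp
  qed
  have on_\<Omega>: "AE x in lebesgue_on \<Omega>. zero_ext \<Omega> K u x = u x"
    using lim AE_space
  proof eventually_elim
    case (elim x)
    show ?case
    proof (cases "x \<in> K")
      case True
      then have "\<phi> k x = 0" for k
        using test_functions_zero[OF \<phi>(1)] by simp
      then have "u x = 0"
        using elim(1) by (simp add: LIMSEQ_const_iff)
      then show ?thesis
        by (simp add: zero_ext_def)
    next
      case False
      then show ?thesis
        using elim(2) by (simp add: zero_ext_def)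
    qed
  qed
  have "AE x in lebesgue_on \<Omega>. (\<lambda>k. \<phi> k x) \<longlonglongrightarrow> zero_ext \<Omega> K u x"
    using lim on_\<Omega> by eventually_elim simp
  then have "AE x in lebesgue. x \<in> \<Omega> \<longrightarrow> (\<lambda>k. \<phi> k x) \<longlonglongrightarrow> zero_ext \<Omega> K u x"
    using \<Omega>l by (simp add: AE_restrict_space_iff)
  then have "AE x in lebesgue. (\<lambda>k. \<phi> k x) \<longlonglongrightarrow> zero_ext \<Omega> K u x"
  proof eventually_elim
    case (elim x)
    show ?case
    proof (cases "x \<in> \<Omega>")
      case False
      then have "\<phi> k x = 0" for k
        using test_functions_zero[OF \<phi>(1)] by simp
      then show ?thesis
        using False by (simp add: zero_ext_def)
    qed (use elim in blast)
  qed
  with \<phi> on_\<Omega> that show thesis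
    by (blast intro: less_imp_le)
qed

section \<open>Extension by zero of Sobolev functions\<close>

lemma gagliardo_energy_cong_AE:
  assumes "AE x in lebesgue_on U. u x = v x"
  shows "gagliardo_energy s p U u = gagliardo_energy s p U v"
  unfolding gagliardo_energy_def
proof (rule nn_integral_cong_AE, use assms in eventually_elim)
  case (elim y)
  show ?case
    by (rule nn_integral_cong_AE, use assms in eventually_elim) (simp add: elim)
qed

lemma gagliardo_energy_mono_domain:
  assumes "U \<in> sets borel"
  shows "gagliardo_energy s p U u \<le> gagliardo_energy s p UNIV u"
proof -
  have UNIV_b: "(UNIV :: (real ^ 'a) set) \<in> sets borel"
    by simp
  have "(\<integral>\<^sup>+x. f x * indicator U x \<partial>lborel) \<le> (\<integral>\<^sup>+x. f x * indicator UNIV x \<partial>lborel)" for f :: "real ^ 'a \<Rightarrow> ennreal"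
    by (intro nn_integral_mono) (simp add: indicator_def)
  then show ?thesis
    unfolding gagliardo_energy_def nn_integral_lebesgue_on[OF assms] nn_integral_lebesgue_on[OF UNIV_b]
    by (intro nn_integral_mono mult_mono) (auto simp: indicator_def)
qed

lemma gagliardo_energy_zero_ext_ge:
  assumes "\<Omega> \<in> sets borel" "AE x in lebesgue_on \<Omega>. zero_ext \<Omega> K u x = u x"
  shows "gagliardo_energy s p \<Omega> u \<le> gagliardo_energy s p UNIV (zero_ext \<Omega> K u)"
  unfolding gagliardo_energy_cong_AE[OF assms(2), symmetric] by (rule gagliardo_energy_mono_domain[OF assms(1)])

lemma Lp_energy_zero_ext:
  assumes "\<Omega> \<in> sets borel" "AE x in lebesgue_on \<Omega>. zero_ext \<Omega> K u x = u x"
  shows "Lp_energy p UNIV (zero_ext \<Omega> K u) = Lp_energy p \<Omega> u"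
proof -
  have "Lp_energy p \<Omega> u = Lp_energy p \<Omega> (zero_ext \<Omega> K u)"
    unfolding Lp_energy_eq_power_energy by (rule power_energy_cong_AE) (use assms(2) in eventually_elim, simp)
  also have "\<dots> = (\<integral>\<^sup>+x. ennreal (\<bar>zero_ext \<Omega> K u x\<bar> powr p) * indicator UNIV x \<partial>lborel)"
    unfolding Lp_energy_def nn_integral_lebesgue_on[OF assms(1)]
    by (intro nn_integral_cong) (auto simp: zero_ext_def indicator_def)
  also have "\<dots> = Lp_energy p UNIV (zero_ext \<Omega> K u)"
    unfolding Lp_energy_def by (rule nn_integral_lebesgue_on[symmetric]) simp
  finally show ?thesis ..
qed

lemma zero_ext_measurable:
  assumes "\<Omega> \<in> sets borel" "K \<in> sets borel" and u: "u \<in> borel_measurable (lebesgue_on \<Omega>)"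
  shows "zero_ext \<Omega> K u \<in> borel_measurable (lebesgue_on UNIV)"
proof -
  have 1: "(\<lambda>x. if x \<in> \<Omega> then u x else 0) \<in> borel_measurable lebesgue"
    using u assms(1) by (subst (asm) measurable_restrict_space_iff[where c=0]) auto
  have "- K \<in> sets lebesgue"
    using assms(2) by auto
  then have "(\<lambda>x. (if x \<in> \<Omega> then u x else 0) * indicator (- K) x) \<in> borel_measurable lebesgue"
    by (intro borel_measurable_times 1 borel_measurable_indicator)
  moreover have "(\<lambda>x. (if x \<in> \<Omega> then u x else 0) * indicator (- K) x) = zero_ext \<Omega> K u"
    by (auto simp: zero_ext_def fun_eq_iff indicator_def)
  ultimately show ?thesis
    by (simp add: lebesgue_on_UNIV_eq)
qed

text \<open>The estimate holds for approximating test functions, whose energies over \<open>\<Omega>\<close> are almost at most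
  \<open>2 powr (p - 1)\<close> times that of \<open>u\<close>; Fatou's lemma gives it for the limit.\<close>

lemma gagliardo_energy_zero_ext_le:
  fixes \<Omega> :: "(real ^ 'd) set"
  assumes \<Omega>: "bounded_lipschitz_domain \<Omega>" and d: "2 \<le> CARD('d)" and p: "1 < p" and s: "s < 1" and sp: "s * p = real CARD('d)"
    and K: "K \<in> sets borel"
  obtains C :: real where "C > 0"
    "\<And>u. u \<in> sobolev0 s p \<Omega> K \<Longrightarrow> gagliardo_energy s p UNIV (zero_ext \<Omega> K u) \<le> ennreal C * gagliardo_energy s p \<Omega> u"
proof -
  have \<Omega>b: "\<Omega> \<in> sets borel" and bd: "bounded \<Omega>"
    using \<Omega> by (auto simp: bounded_lipschitz_domain_def)
  have \<Omega>l: "\<Omega> \<in> sets lebesgue"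
    using \<Omega>b by auto
  have p1: "1 \<le> p" using p by simp
  obtain C where C: "C > 0"
    "\<And>\<phi> S. continuous_on UNIV \<phi> \<Longrightarrow> compact S \<Longrightarrow> S \<subseteq> \<Omega> \<Longrightarrow> (\<And>x. x \<notin> S \<Longrightarrow> \<phi> x = 0) \<Longrightarrow>
       gagliardo_energy s p UNIV \<phi> \<le> ennreal C * gagliardo_energy s p \<Omega> \<phi>"
    by (rule gagliardo_energy_whole_space_le[OF \<Omega> d p sp]) blast
  \<comment> \<open>The factor of both energies in the convexity estimate with weight \<open>1 / 2\<close>.\<close>
  define c where "c = (1/2::real) powr (1 - p)"
  have c: "c > 0" by (simp add: c_def)
  show thesis
  proof
    show "C * c > 0" using C c by simp
    fix u assume u: "u \<in> sobolev0 s p \<Omega> K"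
    let ?u = "zero_ext \<Omega> K u"
    have uS: "u \<in> sobolev s p \<Omega>"
      by (rule sobolev0_subset_sobolev[OF u])
    then have u_meas: "u \<in> borel_measurable (lebesgue_on \<Omega>)"
      by (simp add: sobolev_iff)
    obtain \<phi> where \<phi>: "\<And>k. \<phi> k \<in> test_functions (\<Omega> - K)"
      "\<And>k. sobolev_norm s p \<Omega> (\<lambda>x. u x - \<phi> k x) \<le> (1/4)^k"
      "AE x in lebesgue. (\<lambda>k. \<phi> k x) \<longlonglongrightarrow> ?u x"
      by (rule sobolev0_zero_ext_limit[OF \<Omega>b bd p1 s u]) blast
    have \<phi>S: "\<phi> k \<in> sobolev s p \<Omega>" for k
      by (rule test_functions_sobolev[OF \<Omega>b bd p1 s \<phi>(1)])
    have cont: "continuous_on UNIV (\<phi> k)" for k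
      by (rule test_functions_continuous[OF \<phi>(1)])
    have meas: "\<phi> k \<in> borel_measurable (lebesgue_on UNIV)" for k
      using cont by (intro measurable_restrict_space1 measurable_completion) (simp add: borel_measurable_continuous_onI)
    have test: "gagliardo_energy s p UNIV (\<phi> k) \<le> ennreal C * gagliardo_energy s p \<Omega> (\<phi> k)" for k
    proof (rule C(2)[OF cont])
      show "compact (closure {x. \<phi> k x \<noteq> 0})" "closure {x. \<phi> k x \<noteq> 0} \<subseteq> \<Omega>"
        using \<phi>(1)[of k] unfolding test_functions_def by blast+
      show "\<phi> k x = 0" if "x \<notin> closure {x. \<phi> k x \<noteq> 0}" for x
        using that closure_subset[of "{x. \<phi> k x \<noteq> 0}"] by blast
    qed
    have approx: "gagliardo_energy s p UNIV ?u \<le> ennreal C * (ennreal c * gagliardo_energy s p \<Omega> u + ennreal c * ennreal e)"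
      if e: "0 < e" for e :: real
    proof -
      define \<epsilon> where "\<epsilon> = e powr (1 / p)"
      have \<epsilon>: "0 < \<epsilon>" "\<epsilon> powr p = e"
        using e p by (auto simp: \<epsilon>_def powr_powr)
      obtain n where n: "(1/4::real)^n < \<epsilon>"
        using real_arch_pow_inv[OF \<epsilon>(1), of "1/4"] by auto
      let ?\<phi> = "\<lambda>k. \<phi> (k + n)"
      have small: "gagliardo_energy s p \<Omega> (\<lambda>x. ?\<phi> k x - u x) \<le> ennreal e" for k
      proof -
        have "sobolev_norm s p \<Omega> (\<lambda>x. ?\<phi> k x - u x) \<le> (1/4)^(k + n)"
          using \<phi>(2)[of "k + n"] sobolev_norm_diff_commute[OF \<Omega>l p1 uS \<phi>S, of "k + n"] by simp
        also have "\<dots> \<le> (1/4)^n"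
          by (intro power_decreasing) auto
        also note n
        finally have "sobolev_norm s p \<Omega> (\<lambda>x. ?\<phi> k x - u x) \<le> \<epsilon>" by simp
        moreover have "total_energy s p \<Omega> (\<lambda>x. ?\<phi> k x - u x) < \<infinity>"
          using sobolev_diff[OF \<Omega>l p1 \<phi>S uS] by (simp add: sobolev_iff)
        ultimately have "total_energy s p \<Omega> (\<lambda>x. ?\<phi> k x - u x) \<le> ennreal (\<epsilon> powr p)"
          using p \<epsilon> by (subst (asm) sobolev_norm_le_iff) auto
        then have "total_energy s p \<Omega> (\<lambda>x. ?\<phi> k x - u x) \<le> ennreal e"
          by (simp add: \<epsilon>)
        then show ?thesis
          by (rule order_trans[rotated]) (simp add: total_energy_def)
      qed
      have "gagliardo_energy s p UNIV (?\<phi> k) \<le> ennreal C * (ennreal c * gagliardo_energy s p \<Omega> u + ennreal c * ennreal e)" for k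
      proof -
        have "gagliardo_energy s p \<Omega> (\<lambda>x. u x + (?\<phi> k x - u x))
            \<le> ennreal ((1/2) powr (1 - p)) * gagliardo_energy s p \<Omega> u
              + ennreal ((1 - 1/2) powr (1 - p)) * gagliardo_energy s p \<Omega> (\<lambda>x. ?\<phi> k x - u x)"
          using sobolev_diff[OF \<Omega>l p1 \<phi>S uS, of "k + n"] u_meas
          by (intro gagliardo_energy_add_le[OF \<Omega>l p1]) (auto simp: sobolev_iff)
        also have "\<dots> \<le> ennreal c * gagliardo_energy s p \<Omega> u + ennreal c * ennreal e"
          unfolding c_def by (intro add_mono mult_mono small) auto
        finally have "gagliardo_energy s p \<Omega> (?\<phi> k) \<le> ennreal c * gagliardo_energy s p \<Omega> u + ennreal c * ennreal e"
          by simp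
        then show ?thesis
          by (intro order_trans[OF test] mult_left_mono) auto
      qed
      moreover have "AE x in lebesgue_on UNIV. (\<lambda>k. ?\<phi> k x) \<longlonglongrightarrow> ?u x"
        using \<phi>(3) unfolding lebesgue_on_UNIV_eq
        by eventually_elim (rule LIMSEQ_ignore_initial_segment)
      ultimately show ?thesis
        using gagliardo_energy_Fatou[OF _ p1 meas zero_ext_measurable[OF \<Omega>b K u_meas], of "\<lambda>k. k + n"] by simp
    qed
    show "gagliardo_energy s p UNIV ?u \<le> ennreal (C * c) * gagliardo_energy s p \<Omega> u"
    proof (rule ennreal_le_epsilon)
      fix e :: real assume e: "0 < e"
      have split: "ennreal C * (ennreal c * G + ennreal c * ennreal t) = ennreal (C * c) * G + ennreal (C * (c * t))"
        if "0 \<le> t" for t G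
        using that C c by (simp add: distrib_left ennreal_mult mult.assoc)
      have "gagliardo_energy s p UNIV ?u \<le> ennreal C * (ennreal c * gagliardo_energy s p \<Omega> u + ennreal c * ennreal (e / (C * c)))"
        using e C c by (intro approx) simp
      also have "\<dots> = ennreal (C * c) * gagliardo_energy s p \<Omega> u + ennreal (C * (c * (e / (C * c))))"
        using e C c by (intro split) simp
      also have "C * (c * (e / (C * c))) = e"
        using C c by simp
      finally show "gagliardo_energy s p UNIV ?u \<le> ennreal (C * c) * gagliardo_energy s p \<Omega> u + ennreal e" .
    qed
  qed
qed

section \<open>Transfer along the isomorphism\<close>

lemma zero_ext_add: "zero_ext \<Omega> K (\<lambda>x. u x + v x) = (\<lambda>x. zero_ext \<Omega> K u x + zero_ext \<Omega> K v x)"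
  by (auto simp: zero_ext_def)

lemma zero_ext_scale: "zero_ext \<Omega> K (\<lambda>x. c * u x) = (\<lambda>x. c * zero_ext \<Omega> K u x)"
  by (auto simp: zero_ext_def)

text \<open>The lower norm bound pulls Cauchy sequences back along \<open>E\<close>, and the upper one pushes their limits
  forward. An isomorphism preserves the norm only up to constants, so the exact norm identities
  have to be supplied for \<open>N'\<close>.\<close>

lemma banach_function_space_isomorphic_image:
  assumes V: "banach_function_space U V N" and iso: "banach_isomorphism E V N V' N'"
    and add: "\<And>u v. u \<in> V' \<Longrightarrow> v \<in> V' \<Longrightarrow> N' (\<lambda>x. u x + v x) \<le> N' u + N' v"
    and scale: "\<And>u c. u \<in> V' \<Longrightarrow> N' (\<lambda>x. c * u x) = \<bar>c\<bar> * N' u"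
    and zero: "\<And>u. u \<in> V' \<Longrightarrow> N' u = 0 \<longleftrightarrow> (AE x in lebesgue_on U'. u x = 0)"
  shows "banach_function_space U' V' N'"
proof -
  obtain a b where V': "V' = E ` V"
    and E_add: "\<And>u v. u \<in> V \<Longrightarrow> v \<in> V \<Longrightarrow> E (\<lambda>x. u x + v x) = (\<lambda>x. E u x + E v x)"
    and E_scale: "\<And>u c. u \<in> V \<Longrightarrow> E (\<lambda>x. c * u x) = (\<lambda>x. c * E u x)"
    and ab: "a > 0" "b > 0" "\<And>u. u \<in> V \<Longrightarrow> a * N u \<le> N' (E u) \<and> N' (E u) \<le> b * N u"
    using iso unfolding banach_isomorphism_def by blast
  have V_0: "(\<lambda>x. 0) \<in> V"
    and V_add: "\<And>u v. u \<in> V \<Longrightarrow> v \<in> V \<Longrightarrow> (\<lambda>x. u x + v x) \<in> V"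
    and V_scale: "\<And>u c. u \<in> V \<Longrightarrow> (\<lambda>x. c * u x) \<in> V"
    and complete: "\<And>w :: nat \<Rightarrow> real ^ 'a \<Rightarrow> real. (\<forall>n. w n \<in> V) \<Longrightarrow>
        (\<forall>\<epsilon>>0. \<exists>M. \<forall>m\<ge>M. \<forall>n\<ge>M. N (\<lambda>x. w m x - w n x) < \<epsilon>) \<Longrightarrow>
        (\<exists>u\<in>V. (\<lambda>n. N (\<lambda>x. w n x - u x)) \<longlonglongrightarrow> 0)"
    using V unfolding banach_function_space_def by blast+
  have V_diff: "(\<lambda>x. u x - v x) \<in> V" and E_diff: "E (\<lambda>x. u x - v x) = (\<lambda>x. E u x - E v x)"
    if "u \<in> V" "v \<in> V" for u v
    using V_add[OF that(1) V_scale[OF that(2), of "-1"]] E_add[OF that(1) V_scale[OF that(2), of "-1"]]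
      E_scale[OF that(2), of "-1"] by simp_all
  have complete': "\<exists>u\<in>V'. (\<lambda>n. N' (\<lambda>x. w n x - u x)) \<longlonglongrightarrow> 0"
    if w: "\<forall>n. w n \<in> V'" and Cauchy: "\<forall>\<epsilon>>0. \<exists>M. \<forall>m\<ge>M. \<forall>n\<ge>M. N' (\<lambda>x. w m x - w n x) < \<epsilon>" for w :: "nat \<Rightarrow> real ^ 'a \<Rightarrow> real"
  proof -
    have "\<forall>n. \<exists>v\<in>V. w n = E v"
      using w unfolding V' by blast
    then obtain v where v: "\<And>n. v n \<in> V" "\<And>n. w n = E (v n)"
      by metis
    have "\<exists>u\<in>V. (\<lambda>n. N (\<lambda>x. v n x - u x)) \<longlonglongrightarrow> 0"
    proof (rule complete)
      show "\<forall>\<epsilon>>0. \<exists>M. \<forall>m\<ge>M. \<forall>n\<ge>M. N (\<lambda>x. v m x - v n x) < \<epsilon>"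
      proof (intro allI impI)
        fix \<epsilon> :: real assume \<epsilon>: "\<epsilon> > 0"
        then have "a * \<epsilon> > 0" using ab by simp
        then obtain M where M: "\<forall>m\<ge>M. \<forall>n\<ge>M. N' (\<lambda>x. w m x - w n x) < a * \<epsilon>"
          using Cauchy by blast
        have "N (\<lambda>x. v m x - v n x) < \<epsilon>" if "m \<ge> M" "n \<ge> M" for m n
        proof -
          have "a * N (\<lambda>x. v m x - v n x) \<le> N' (\<lambda>x. w m x - w n x)"
            using ab(3)[OF V_diff[OF v(1) v(1)], of m n] by (simp add: E_diff[OF v(1) v(1)] v(2))
          also have "\<dots> < a * \<epsilon>"
            using M that by blast
          finally show ?thesis
            using ab(1) by simp
        qed
        then show "\<exists>M. \<forall>m\<ge>M. \<forall>n\<ge>M. N (\<lambda>x. v m x - v n x) < \<epsilon>" by blast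
      qed
    qed (use v in blast)
    then obtain u where u: "u \<in> V" "(\<lambda>n. N (\<lambda>x. v n x - u x)) \<longlonglongrightarrow> 0" by blast
    have bounds: "a * N (\<lambda>x. v n x - u x) \<le> N' (\<lambda>x. w n x - E u x)" "N' (\<lambda>x. w n x - E u x) \<le> b * N (\<lambda>x. v n x - u x)" for n
      using ab(3)[OF V_diff[OF v(1) u(1)], of n] by (simp_all add: E_diff[OF v(1) u(1)] v(2))
    have "(\<lambda>n. a * N (\<lambda>x. v n x - u x)) \<longlonglongrightarrow> 0" "(\<lambda>n. b * N (\<lambda>x. v n x - u x)) \<longlonglongrightarrow> 0"
      using tendsto_mult_right_zero[OF u(2)] by blast+
    then have "(\<lambda>n. N' (\<lambda>x. w n x - E u x)) \<longlonglongrightarrow> 0"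
      by (rule tendsto_sandwich[rotated 2]) (use bounds in auto)
    then show ?thesis
      using u(1) unfolding V' by blast
  qed
  show ?thesis
    unfolding banach_function_space_def
  proof (intro conjI ballI allI impI)
    have "E (\<lambda>x. 0 * 0) = (\<lambda>x. 0 * E (\<lambda>x. 0) x)"
      by (rule E_scale[OF V_0])
    then show "(\<lambda>x. 0) \<in> V'"
      using V_0 unfolding V' by (intro image_eqI[of _ E "\<lambda>x. 0"]) simp_all
    show "(\<lambda>x. u x + v x) \<in> V'" if uv: "u \<in> V'" "v \<in> V'" for u v
    proof -
      obtain u0 v0 where "u0 \<in> V" "v0 \<in> V" "u = E u0" "v = E v0"
        using uv unfolding V' by blast
      then show ?thesis
        unfolding V' by (intro image_eqI[of _ E "\<lambda>x. u0 x + v0 x"]) (simp_all add: E_add V_add)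
    qed
    show "(\<lambda>x. c * u x) \<in> V'" if u: "u \<in> V'" for u c
    proof -
      obtain u0 where "u0 \<in> V" "u = E u0"
        using u unfolding V' by blast
      then show ?thesis
        unfolding V' by (intro image_eqI[of _ E "\<lambda>x. c * u0 x"]) (simp_all add: E_scale V_scale)
    qed
  qed (use add scale zero complete' in blast)+
qed

theorem proposition5p1:
  fixes \<Omega> K :: "(real ^ 'd) set" and k :: nat and s p :: real
  assumes "1 < k" and "k < CARD('d)"
    and "bounded_lipschitz_domain \<Omega>"
    and "C01_surface \<Omega> k K"
    and "p > 1" and "0 < s" and "s < 1" and "s * p = real CARD('d)"
  shows "(\<exists>C::real. C > 0 \<and> (\<forall>u \<in> sobolev0 s p \<Omega> K.
      (\<integral>\<^sup>+ y. \<integral>\<^sup>+ x. ennreal (\<bar>u x - u y\<bar> powr p / norm (x - y) ^ (2 * CARD('d)))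
          \<partial>lebesgue_on \<Omega> \<partial>lebesgue_on \<Omega>)
        \<le> (\<integral>\<^sup>+ y. \<integral>\<^sup>+ x. ennreal (\<bar>zero_ext \<Omega> K u x - zero_ext \<Omega> K u y\<bar> powr p
              / norm (x - y) ^ (2 * CARD('d))) \<partial>lebesgue \<partial>lebesgue) \<and>
      (\<integral>\<^sup>+ y. \<integral>\<^sup>+ x. ennreal (\<bar>zero_ext \<Omega> K u x - zero_ext \<Omega> K u y\<bar> powr p
              / norm (x - y) ^ (2 * CARD('d))) \<partial>lebesgue \<partial>lebesgue)
        \<le> ennreal C * (\<integral>\<^sup>+ y. \<integral>\<^sup>+ x. ennreal (\<bar>u x - u y\<bar> powr p / norm (x - y) ^ (2 * CARD('d)))
          \<partial>lebesgue_on \<Omega> \<partial>lebesgue_on \<Omega>)))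
    \<and> sobolev0_tilde s p \<Omega> K \<subseteq> sobolev s p UNIV
    \<and> banach_function_space \<Omega> (sobolev0 s p \<Omega> K) (sobolev_norm s p \<Omega>)
    \<and> banach_function_space UNIV (sobolev0_tilde s p \<Omega> K) (sobolev_norm s p UNIV)
    \<and> banach_isomorphism (zero_ext \<Omega> K)
        (sobolev0 s p \<Omega> K) (sobolev_norm s p \<Omega>)
        (sobolev0_tilde s p \<Omega> K) (sobolev_norm s p UNIV)"
proof -
  let ?V = "sobolev0 s p \<Omega> K" and ?V' = "sobolev0_tilde s p \<Omega> K" and ?E = "zero_ext \<Omega> K"
  let ?N = "sobolev_norm s p \<Omega>" and ?N' = "sobolev_norm s p UNIV"
  note sp = assms(8)
  have d: "2 \<le> CARD('d)" and p: "1 \<le> p" "0 < p"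
    using assms by auto
  have \<Omega>b: "\<Omega> \<in> sets borel" and bd: "bounded \<Omega>"
    using assms(3) by (auto simp: bounded_lipschitz_domain_def)
  have UNIV_l: "(UNIV :: (real ^ 'd) set) \<in> sets lebesgue"
    by auto
  have K: "K \<in> sets borel"
    using assms(4) by (auto simp: C01_surface_def intro: borel_compact)
  have energy: "gagliardo_energy s p UNIV v = (\<integral>\<^sup>+ y. \<integral>\<^sup>+ x. ennreal (\<bar>v x - v y\<bar> powr p
              / norm (x - y) ^ (2 * CARD('d))) \<partial>lebesgue \<partial>lebesgue)" for v :: "real ^ 'd \<Rightarrow> real"
    unfolding gagliardo_energy_critical[OF sp] lebesgue_on_UNIV_eq ..
  obtain C where C: "C > 0"
    "\<And>u. u \<in> ?V \<Longrightarrow> gagliardo_energy s p UNIV (?E u) \<le> ennreal C * gagliardo_energy s p \<Omega> u"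
    by (rule gagliardo_energy_zero_ext_le[OF assms(3) d assms(5,7) sp K]) blast
  have ae: "AE x in lebesgue_on \<Omega>. ?E u x = u x" if "u \<in> ?V" for u
    by (rule sobolev0_zero_ext_limit[OF \<Omega>b bd p(1) assms(7) that]) blast
  have lower: "gagliardo_energy s p \<Omega> u \<le> gagliardo_energy s p UNIV (?E u)" if "u \<in> ?V" for u
    by (rule gagliardo_energy_zero_ext_ge[OF \<Omega>b ae[OF that]])
  have Lp: "Lp_energy p UNIV (?E u) = Lp_energy p \<Omega> u" if "u \<in> ?V" for u
    by (rule Lp_energy_zero_ext[OF \<Omega>b ae[OF that]])
  have fin: "total_energy s p \<Omega> u < \<infinity>" and meas: "u \<in> borel_measurable (lebesgue_on \<Omega>)" if "u \<in> ?V" for u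
    using sobolev0_subset_sobolev[OF that] by (auto simp: sobolev_iff)
  define c where "c = max 1 C"
  have c: "1 \<le> c" "C \<le> c" by (auto simp: c_def)
  have total_lower: "total_energy s p \<Omega> u \<le> total_energy s p UNIV (?E u)" if "u \<in> ?V" for u
    unfolding total_energy_def Lp[OF that] using lower[OF that] by (rule add_right_mono)
  have total_upper: "total_energy s p UNIV (?E u) \<le> ennreal c * total_energy s p \<Omega> u" if "u \<in> ?V" for u
  proof -
    have "gagliardo_energy s p UNIV (?E u) \<le> ennreal c * gagliardo_energy s p \<Omega> u"
      using c by (intro order_trans[OF C(2)[OF that]] mult_right_mono ennreal_leI) auto
    moreover have "1 * Lp_energy p \<Omega> u \<le> ennreal c * Lp_energy p \<Omega> u"
      using c by (intro mult_right_mono) auto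
    ultimately show ?thesis
      unfolding total_energy_def Lp[OF that] distrib_left by (intro add_mono) simp_all
  qed
  have fin': "total_energy s p UNIV (?E u) < \<infinity>" if "u \<in> ?V" for u
    using total_upper[OF that] fin[OF that] by (auto intro: le_less_trans simp: ennreal_mult_less_top)
  have in_UNIV: "?V' \<subseteq> sobolev s p UNIV"
    unfolding sobolev0_tilde_def using fin' zero_ext_measurable[OF \<Omega>b K meas] by (auto simp: sobolev_iff)
  have norm_lower: "?N u \<le> ?N' (?E u)" if "u \<in> ?V" for u
  proof -
    have "total_energy s p \<Omega> u \<le> ennreal (?N' (?E u) powr p)"
      using total_lower[OF that] sobolev_norm_le_iff[OF p(2) fin'[OF that], of "?N' (?E u)"] by (auto intro: order_trans)
    then show ?thesis
      using sobolev_norm_le_iff[OF p(2) fin[OF that], of "?N' (?E u)"] by simp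
  qed
  have norm_upper: "?N' (?E u) \<le> c powr (1 / p) * ?N u" if "u \<in> ?V" for u
  proof -
    have "total_energy s p UNIV (?E u) \<le> ennreal c * ennreal (?N u powr p)"
      using sobolev_norm_le_iff[OF p(2) fin[OF that], of "?N u"]
      by (intro order_trans[OF total_upper[OF that]] mult_left_mono) auto
    also have "\<dots> = ennreal ((c powr (1 / p) * ?N u) powr p)"
      using c p by (simp add: powr_mult powr_powr ennreal_mult)
    finally show ?thesis
      using sobolev_norm_le_iff[OF p(2) fin'[OF that], of "c powr (1 / p) * ?N u"] by simp
  qed
  have V: "banach_function_space \<Omega> ?V ?N"
    by (rule banach_function_space_sobolev0[OF \<Omega>b bd p(1) assms(7)])
  have iso: "banach_isomorphism ?E ?V ?N ?V' ?N'"
    unfolding banach_isomorphism_def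
  proof (intro conjI ballI allI)
    show "\<exists>a>0. \<exists>b>0. \<forall>u\<in>?V. a * ?N u \<le> ?N' (?E u) \<and> ?N' (?E u) \<le> b * ?N u"
      using norm_lower norm_upper c by (intro exI[of _ 1] exI[of _ "c powr (1 / p)"] conjI ballI) auto
  qed (simp_all add: sobolev0_tilde_def zero_ext_add zero_ext_scale)
  have V': "banach_function_space UNIV ?V' ?N'"
    by (rule banach_function_space_isomorphic_image[OF V iso])
      (use in_UNIV sobolev_add(2)[OF UNIV_l p(1)] sobolev_scale(2)[OF UNIV_l p(1)] sobolev_norm_eq_0_iff[OF UNIV_l p(1)] in blast)+
  have "\<exists>C>0. \<forall>u\<in>?V. gagliardo_energy s p \<Omega> u \<le> gagliardo_energy s p UNIV (?E u) \<and>
      gagliardo_energy s p UNIV (?E u) \<le> ennreal C * gagliardo_energy s p \<Omega> u"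
    using C lower by blast
  then show ?thesis
    unfolding energy gagliardo_energy_critical[OF sp, of \<Omega>] using in_UNIV V V' iso by blast
qed

end
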